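(* Let $\beta>0$ and $\lambda\in\mathbb R$ (zero external field). Then: (i) $\lim_{N\to\infty}A_N(\beta,\lambda)\le A^{RS}(\beta,\lambda)$; (ii) $\lim_{N\to\infty}A_N(\beta,\lambda)\ge\sup_{R\in(0,\infty)}\Big[A^{sf}(\beta,R)-\frac{\beta^2R^4}{4}+\frac{(\lambda-1)R^2}{2}+\log R+\frac12\Big]$; (iii) $\sup_{R\in(0,\infty)}\Big[A^{sf}(\beta,R)-\frac{\beta^2R^4}{4}+\frac{(\lambda-1)R^2}{2}+\log R+\frac12\Big]=A^{RS}(\beta,\lambda)$. Consequently $$\lim_{N\to\infty}A_N(\beta,\lambda)=A^{RS}(\beta,\lambda)=\begin{cases}-\frac12\log(1-\lambda), & \lambda<1,\ \beta<1-\lambda,\\ -\frac12\log\beta+\frac{\beta\bar q}{2}+\frac{\beta^2\bar q^2}{4},& \beta>1-\lambda,\end{cases}\qquad \bar q=\frac{\beta-(1-\lambda)}{\beta^2}.$$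
   Context: For $N\ge1$, $J=(J_{ij})_{i,j=1}^N$ i.i.d. $\mathcal N(0,1)$ over all ordered pairs (diagonal included), $\mathbb E_z$ integration against the standard Gaussian measure $(2\pi)^{-N/2}e^{-\|z\|^2/2}dz$ on $\mathbb R^N$, $\mathbb E$ the expectation over $J$: $Z_N(\beta,\lambda;J)=\mathbb E_z\exp\big(\frac{\beta}{\sqrt{2N}}\sum_{i,j}J_{ij}z_iz_j-\frac{\beta^2}{4N}(\sum_iz_i^2)^2+\frac\lambda2\sum_iz_i^2\big)$ and $A_N(\beta,\lambda)=\frac1N\mathbb E\log Z_N$ (the limit exists). $A^{RS}(\beta,\lambda)=\inf\{\tilde A(\beta,\lambda,\bar q):\bar q\ge0,\ 1-\lambda+\beta^2\bar q>0\}$ with $\tilde A(\beta,\lambda,\bar q)=\log\sigma+\frac12\beta^2\bar q\sigma^2+\frac{\beta^2}4\bar q^2$, $\sigma=(1-\lambda+\beta^2\bar q)^{-1/2}$. $A^{sf}(\beta,R)$ denotes the (known) quenched pressure of the spherical model $\lim_N\frac1N\mathbb E\log\int\exp\big(\frac{\beta}{\sqrt{2N}}\sum_{i,j}J_{ij}z_iz_j\big)\,d\nu_{R\sqrt N}(z)$, $\nu_{r}$ the uniform probability on the sphere of radius $r$ in $\mathbb R^N$, which is given explicitly by $A^{sf}(\beta,R)=\frac{\beta^2R^4}{4}$ if $\beta R^2\le1$ and $A^{sf}(\beta,R)=\beta R^2-\log R-\frac12\log\beta-\frac34$ if $\beta R^2>1$. *)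

theory Defs
  imports "HOL-Probability.Probability"
begin

definition gauss1 :: "real measure" where
  "gauss1 = density lborel std_normal_density"

definition gaussN :: "nat \<Rightarrow> (nat \<Rightarrow> real) measure" where
  "gaussN N = (\<Pi>\<^sub>M i\<in>{..<N}. gauss1)"

definition disorder :: "nat \<Rightarrow> (nat \<times> nat \<Rightarrow> real) measure" where
  "disorder N = (\<Pi>\<^sub>M ij\<in>{..<N}\<times>{..<N}. gauss1)"

definition Hamil :: "nat \<Rightarrow> real \<Rightarrow> real \<Rightarrow> (nat \<times> nat \<Rightarrow> real) \<Rightarrow> (nat \<Rightarrow> real) \<Rightarrow> real" where
  "Hamil N \<beta> lam J z =
     \<beta> / sqrt (2 * real N) * (\<Sum>i<N. \<Sum>j<N. J (i, j) * z i * z j)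
     - \<beta>\<^sup>2 / (4 * real N) * (\<Sum>i<N. (z i)\<^sup>2)\<^sup>2
     + lam / 2 * (\<Sum>i<N. (z i)\<^sup>2)"

definition ZN :: "nat \<Rightarrow> real \<Rightarrow> real \<Rightarrow> (nat \<times> nat \<Rightarrow> real) \<Rightarrow> real" where
  "ZN N \<beta> lam J = (\<integral>z. exp (Hamil N \<beta> lam J z) \<partial>gaussN N)"

definition AN :: "nat \<Rightarrow> real \<Rightarrow> real \<Rightarrow> real" where
  "AN N \<beta> lam = (1 / real N) * (\<integral>J. ln (ZN N \<beta> lam J) \<partial>disorder N)"

definition Atilde :: "real \<Rightarrow> real \<Rightarrow> real \<Rightarrow> real" where
  "Atilde \<beta> lam q =
     (let \<sigma> = (1 - lam + \<beta>\<^sup>2 * q) powr (-1/2)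
      in ln \<sigma> + 1/2 * \<beta>\<^sup>2 * q * \<sigma>\<^sup>2 + \<beta>\<^sup>2 / 4 * q\<^sup>2)"

definition ARS :: "real \<Rightarrow> real \<Rightarrow> real" where
  "ARS \<beta> lam = Inf (Atilde \<beta> lam ` {q. q \<ge> 0 \<and> 1 - lam + \<beta>\<^sup>2 * q > 0})"

text \<open>Quenched pressure of the spherical model (explicit known formula).\<close>
definition Asf :: "real \<Rightarrow> real \<Rightarrow> real" where
  "Asf \<beta> R = (if \<beta> * R\<^sup>2 \<le> 1 then \<beta>\<^sup>2 * R ^ 4 / 4
               else \<beta> * R\<^sup>2 - ln R - 1/2 * ln \<beta> - 3/4)"

definition SupRHS :: "real \<Rightarrow> real \<Rightarrow> real" where
  "SupRHS \<beta> lam = (SUP R\<in>{0<..}. Asf \<beta> R - \<beta>\<^sup>2 * R ^ 4 / 4 + (lam - 1) * R\<^sup>2 / 2 + ln R + 1/2)"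

end

(* Idea. By rotation invariance, J may be tridiagonalized by Householder reflections without
   changing E log Z: the quadratic form becomes a Jacobi matrix with diagonal J_kk and independent
   chi-distributed off-diagonal entries, which are uniformly close to the deterministic couplings
   beta * sqrt (k/N). For a deterministic Jacobi form both bounds are elementary. Upper bound:
   linearize -(|z|^2)^2 at a level rho and compute the Gaussian integral by an LDL factorization with
   pivots D(k/N), where D(t) + beta^2 t / D(t) = 1 - lam + beta^2 rho. Lower bound: Jensen's
   inequality for the Gaussian Markov chain with the same pivots, shifted by a deterministic profile
   that concentrates near the spectral edge t = 1; the shift carries the condensate q of the
   low-temperature phase. With d = D(1) = 1 - lam + beta^2 q, the two bounds meet at the minimizer
   of Atilde. *)

theory Submission
  imports Defs "HOL-Real_Asymp.Real_Asymp"
begin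

section \<open>Isometry invariance of the Gaussian product measure\<close>

text \<open>The spherical model enters through its explicit formula only. Infimum and supremum are
  evaluated in closed form, independently of the partition function, and the limit of
  \<open>AN\<close> is identified with the same values; so convergence is a conclusion, and (i) and
  (ii) come out as equalities. The level rho and the last pivot d are two names for one parameter:
  theta = d + beta^2 / d = 1 - lam + beta^2 rho gives rho = q + 1 / d, the condensate plus the
  thermal variance. The obstacle is the edge. At d = beta one has theta = 2 beta, the discriminant
  theta^2 - 4 beta^2 t vanishes at t = 1, the trial variances blow up there and the chain is no
  longer uniformly contracting. Hence every estimate at finite N is made at a fixed d > beta, with
  constants depending on d; only the limiting bounds, which are continuous in d, are taken to d =
  beta. For the same reason the profile of the squared shift is a power t^p with p fixed while N
  grows, so that its sums are Riemann sums; p is sent to infinity afterwards.\<close>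

abbreviation lebPi :: "'i set \<Rightarrow> ('i \<Rightarrow> real) measure" where
  "lebPi I \<equiv> PiM I (\<lambda>_. lborel)"

abbreviation gaussPi :: "'i set \<Rightarrow> ('i \<Rightarrow> real) measure" where
  "gaussPi I \<equiv> PiM I (\<lambda>_. gauss1)"

lemma sets_gauss1 [simp, measurable_cong]: "sets gauss1 = sets borel"
  by (simp add: gauss1_def)

lemma space_gauss1 [simp]: "space gauss1 = UNIV"
  by (simp add: gauss1_def)

lemma prob_space_gauss1: "prob_space gauss1"
  unfolding gauss1_def by (rule prob_space_normal_density) simp

interpretation lebP: product_sigma_finite "\<lambda>_. lborel :: real measure"
  by standard

interpretation gaussP: product_sigma_finite "\<lambda>_. gauss1"
  by (simp add: product_sigma_finite_def prob_space_gauss1 prob_space_imp_sigma_finite)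

lemma prob_space_gaussPi: "prob_space (gaussPi I)"
  by (rule prob_space_PiM) (rule prob_space_gauss1)

lemma space_lebPi: "space (lebPi I) = extensional I"
  by (simp add: space_PiM PiE_def)

lemma sets_gaussPi [measurable_cong]: "sets (gaussPi I) = sets (lebPi I)"
  by (rule sets_PiM_cong) (auto simp: gauss1_def)

lemma lebPi_translate:
  assumes "finite I" and f [measurable]: "f \<in> borel_measurable (lebPi I)"
  shows "(\<integral>\<^sup>+x. f (\<lambda>i\<in>I. x i + a i) \<partial>lebPi I) = (\<integral>\<^sup>+x. f x \<partial>lebPi I)"
proof -
  let ?T = "\<lambda>x. \<lambda>i\<in>I. x i + a i"
  have T [measurable]: "?T \<in> measurable (lebPi I) (lebPi I)"
    by measurable
  have "distr (lebPi I) (lebPi I) ?T = lebPi I"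
  proof (rule lebP.PiM_eqI)
    fix A :: "'a \<Rightarrow> real set"
    assume A: "\<And>i. i \<in> I \<Longrightarrow> A i \<in> sets lborel"
    let ?B = "\<lambda>i. (\<lambda>x. x + a i) -` A i"
    have B: "?B i \<in> sets borel" if "i \<in> I" for i
      using A[OF that] measurable_sets[of "\<lambda>x. x + a i" borel borel "A i"] by simp
    have "emeasure (distr (lebPi I) (lebPi I) ?T) (Pi\<^sub>E I A)
        = emeasure (lebPi I) (?T -` (Pi\<^sub>E I A) \<inter> space (lebPi I))"
      using A by (intro emeasure_distr T sets_PiM_I_finite assms) auto
    also have "?T -` (Pi\<^sub>E I A) \<inter> space (lebPi I) = Pi\<^sub>E I ?B"
      by (auto simp: space_PiM PiE_iff)
    also have "emeasure (lebPi I) \<dots> = (\<Prod>i\<in>I. emeasure lborel (?B i))"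
      using B assms by (intro lebP.emeasure_PiM) auto
    also have "\<dots> = (\<Prod>i\<in>I. emeasure lborel (A i))"
    proof (rule prod.cong[OF refl])
      fix i assume i: "i \<in> I"
      have "emeasure lborel (?B i) = emeasure (distr lborel borel (\<lambda>x. a i + x)) (A i)"
        using A[OF i] by (subst emeasure_distr) (auto simp: add.commute[of "a i"] vimage_def)
      then show "emeasure lborel (?B i) = emeasure lborel (A i)"
        by (simp add: lborel_distr_plus)
    qed
    finally show "emeasure (distr (lebPi I) (lebPi I) ?T) (Pi\<^sub>E I A)
        = (\<Prod>i\<in>I. emeasure lborel (A i))" .
  qed (use assms in auto)
  then have "(\<integral>\<^sup>+x. f x \<partial>lebPi I) = (\<integral>\<^sup>+x. f x \<partial>distr (lebPi I) (lebPi I) ?T)"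
    by simp
  also have "\<dots> = (\<integral>\<^sup>+x. f (?T x) \<partial>lebPi I)"
    by (rule nn_integral_distr) auto
  finally show ?thesis by simp
qed

lemma gaussPi_density:
  assumes "finite I"
  shows "gaussPi I = density (lebPi I) (\<lambda>x. \<Prod>i\<in>I. ennreal (std_normal_density (x i)))"
proof (rule sym, rule gaussP.PiM_eqI)
  fix A :: "'a \<Rightarrow> real set"
  assume A: "\<And>i. i \<in> I \<Longrightarrow> A i \<in> sets gauss1"
  have [measurable]: "Pi\<^sub>E I A \<in> sets (lebPi I)"
    using A assms by (intro sets_PiM_I_finite) auto
  have "emeasure (density (lebPi I) (\<lambda>x. \<Prod>i\<in>I. ennreal (std_normal_density (x i)))) (Pi\<^sub>E I A)
     = (\<integral>\<^sup>+x. (\<Prod>i\<in>I. ennreal (std_normal_density (x i))) * indicator (Pi\<^sub>E I A) x \<partial>lebPi I)"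
    by (rule emeasure_density) auto
  also have "\<dots> = (\<integral>\<^sup>+x. (\<Prod>i\<in>I. ennreal (std_normal_density (x i)) * indicator (A i) (x i)) \<partial>lebPi I)"
  proof (intro nn_integral_cong)
    fix x :: "'a \<Rightarrow> real" assume "x \<in> space (lebPi I)"
    then have "x \<in> extensional I" by (simp add: space_lebPi)
    then have "indicator (Pi\<^sub>E I A) x = (\<Prod>i\<in>I. indicator (A i) (x i) :: ennreal)"
      using assms by (auto simp: indicator_def PiE_iff prod_zero_iff)
    then show "(\<Prod>i\<in>I. ennreal (std_normal_density (x i))) * indicator (Pi\<^sub>E I A) x
      = (\<Prod>i\<in>I. ennreal (std_normal_density (x i)) * indicator (A i) (x i))"
      by (simp add: prod.distrib)
  qed
  also have "\<dots> = (\<Prod>i\<in>I. \<integral>\<^sup>+x. ennreal (std_normal_density x) * indicator (A i) x \<partial>lborel)"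
    using A assms by (intro lebP.product_nn_integral_prod) auto
  also have "\<dots> = (\<Prod>i\<in>I. emeasure gauss1 (A i))"
    unfolding gauss1_def using A by (intro prod.cong refl, subst emeasure_density) auto
  finally show "emeasure (density (lebPi I) (\<lambda>x. \<Prod>i\<in>I. ennreal (std_normal_density (x i)))) (Pi\<^sub>E I A)
     = (\<Prod>i\<in>I. emeasure gauss1 (A i))" .
qed (use assms in \<open>auto simp: sets_gaussPi\<close>)

text \<open>All maps needed below (reflections, their row and column actions, the rotation of
  transposed pairs, the reversal of coordinates) are their own inverses, so the inverse is built in
  as \<open>T (T x) = x\<close>. Linearity is recorded as additivity, the form in which it meets
  translation invariance. The conditions refer to \<open>extensional\<close> functions because these
  are the points of a product measure space.\<close>

definition invol_isometry :: "'i set \<Rightarrow> (('i \<Rightarrow> real) \<Rightarrow> 'i \<Rightarrow> real) \<Rightarrow> bool" where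
  "invol_isometry I T \<longleftrightarrow> T \<in> measurable (lebPi I) (lebPi I)
    \<and> (\<forall>x\<in>extensional I. \<forall>y\<in>extensional I. T (\<lambda>i\<in>I. x i + y i) = (\<lambda>i\<in>I. T x i + T y i))
    \<and> (\<forall>x\<in>extensional I. T (T x) = x)
    \<and> (\<forall>x\<in>extensional I. (\<Sum>i\<in>I. (T x i)\<^sup>2) = (\<Sum>i\<in>I. (x i)\<^sup>2))"

lemma prod_std_normal_density:
  assumes "finite I"
  shows "(\<Prod>i\<in>I. ennreal (std_normal_density (x i)))
    = ennreal ((1 / sqrt (2 * pi)) ^ card I * exp (- (\<Sum>i\<in>I. (x i)\<^sup>2) / 2))"
proof -
  have "(\<Prod>i\<in>I. ennreal (std_normal_density (x i))) = ennreal (\<Prod>i\<in>I. std_normal_density (x i))"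
    by (rule prod_ennreal) simp
  also have "(\<Prod>i\<in>I. std_normal_density (x i))
    = (\<Prod>i\<in>I. 1 / sqrt (2 * pi)) * (\<Prod>i\<in>I. exp (- (x i)\<^sup>2 / 2))"
    unfolding std_normal_density_def by (rule prod.distrib)
  also have "(\<Prod>i\<in>I. exp (- (x i)\<^sup>2 / 2)) = exp (\<Sum>i\<in>I. - (x i)\<^sup>2 / 2)"
    by (rule exp_sum[OF assms, symmetric])
  also have "(\<Sum>i\<in>I. - (x i)\<^sup>2 / 2) = - (\<Sum>i\<in>I. (x i)\<^sup>2) / 2"
    by (simp only: sum_divide_distrib[symmetric] sum_negf)
  finally show ?thesis by (simp only: prod_constant)
qed

text \<open>Averaging over translates identifies the image of Lebesgue measure under an isometry with its
  reflection, as in the uniqueness proof for Haar measure; the Gaussian density serves as the test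
  function whose integral is known. Taking the identity as the isometry removes the reflection.\<close>

lemma lebPi_invol_isometry_uminus:
  assumes fin: "finite I" and T: "invol_isometry I T"
    and f [measurable]: "f \<in> borel_measurable (lebPi I)"
  shows "(\<integral>\<^sup>+x. f (T x) \<partial>lebPi I) = (\<integral>\<^sup>+y. f (\<lambda>i\<in>I. - y i) \<partial>lebPi I)"
proof -
  define g where "g x = (\<Prod>i\<in>I. ennreal (std_normal_density (x i)))" for x
  have Tm [measurable]: "T \<in> measurable (lebPi I) (lebPi I)"
    using T by (simp add: invol_isometry_def)
  have add: "T (\<lambda>i\<in>I. x i + y i) = (\<lambda>i\<in>I. T x i + T y i)"
    if "x \<in> extensional I" "y \<in> extensional I" for x y
    using T that by (simp add: invol_isometry_def)
  have inv: "T (T x) = x" if "x \<in> extensional I" for x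
    using T that by (simp add: invol_isometry_def)
  have ext: "T x \<in> extensional I" if "x \<in> extensional I" for x
    using measurable_space[of T "lebPi I" "lebPi I" x] that by (simp add: space_lebPi)
  have gT: "g (T x) = g x" if "x \<in> extensional I" for x
    using T that fin by (simp add: g_def invol_isometry_def prod_std_normal_density)
  have g [measurable]: "g \<in> borel_measurable (lebPi I)"
    unfolding g_def by measurable
  have Tfst [measurable]: "(\<lambda>p. T (fst p)) \<in> measurable (lebPi I \<Otimes>\<^sub>M lebPi I) (lebPi I)"
    by (rule measurable_compose[OF measurable_fst]) measurable
  have Tsnd [measurable]: "(\<lambda>p. T (snd p)) \<in> measurable (lebPi I \<Otimes>\<^sub>M lebPi I) (lebPi I)"
    by (rule measurable_compose[OF measurable_snd]) measurable
  have T1 [measurable]: "(\<lambda>p. T (fst p) i) \<in> borel_measurable (lebPi I \<Otimes>\<^sub>M lebPi I)" if "i \<in> I" for i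
    using measurable_compose[OF Tfst measurable_component_singleton[OF that]] by simp
  have T2 [measurable]: "(\<lambda>p. T (snd p) i) \<in> borel_measurable (lebPi I \<Otimes>\<^sub>M lebPi I)" if "i \<in> I" for i
    using measurable_compose[OF Tsnd measurable_component_singleton[OF that]] by simp
  have T3 [measurable]: "(\<lambda>p. T p i) \<in> borel_measurable (lebPi I)" if "i \<in> I" for i
    using measurable_compose[OF Tm measurable_component_singleton[OF that]] by simp
  \<comment> \<open>The density \<open>g\<close> will be inserted as a factor of total mass 1, in a
    translate that depends on \<open>T x\<close>.\<close>
  have int_g: "(\<integral>\<^sup>+x. g x \<partial>lebPi I) = 1"
  proof -
    have "(\<integral>\<^sup>+x. g x \<partial>lebPi I) = emeasure (gaussPi I) (space (gaussPi I))"
      unfolding gaussPi_density[OF fin] g_def[symmetric]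
      by (simp add: emeasure_density cong: nn_integral_cong)
    then show ?thesis
      using prob_space.emeasure_space_1[OF prob_space_gaussPi] by simp
  qed
  interpret I: finite_product_sigma_finite "\<lambda>_. lborel :: real measure" I
    by standard (rule fin)
  interpret P: pair_sigma_finite "lebPi I" "lebPi I" ..
  have "(\<integral>\<^sup>+x. f (T x) \<partial>lebPi I) = (\<integral>\<^sup>+x. f (T x) * (\<integral>\<^sup>+y. g (\<lambda>i\<in>I. y i + T x i) \<partial>lebPi I) \<partial>lebPi I)"
    by (subst lebPi_translate[OF fin]) (auto simp: int_g)
  also have "\<dots> = (\<integral>\<^sup>+x. (\<integral>\<^sup>+y. f (T x) * g (\<lambda>i\<in>I. y i + T x i) \<partial>lebPi I) \<partial>lebPi I)"
    by (subst nn_integral_cmult) auto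
  also have "\<dots> = (\<integral>\<^sup>+y. (\<integral>\<^sup>+x. f (T x) * g (\<lambda>i\<in>I. y i + T x i) \<partial>lebPi I) \<partial>lebPi I)"
    by (rule P.Fubini'[symmetric]) measurable
  also have "\<dots> = (\<integral>\<^sup>+y. (\<integral>\<^sup>+x. f (\<lambda>i\<in>I. T x i + - y i) * g x \<partial>lebPi I) \<partial>lebPi I)"
  proof (rule nn_integral_cong)
    fix y assume "y \<in> space (lebPi I)"
    \<comment> \<open>Translating x by this \<open>w\<close> replaces \<open>T x\<close> by
      \<open>T x - y\<close>, because \<open>T w = - y\<close>. The argument of \<open>g\<close>
      then becomes \<open>T x\<close>, and \<open>g\<close> does not see T.\<close>
    define w where "w = T (\<lambda>i\<in>I. - y i)"
    have w: "w \<in> extensional I" unfolding w_def by (rule ext) simp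
    have Tw: "T w = (\<lambda>i\<in>I. - y i)" unfolding w_def by (rule inv) simp
    have "(\<integral>\<^sup>+x. f (T x) * g (\<lambda>i\<in>I. y i + T x i) \<partial>lebPi I)
      = (\<integral>\<^sup>+x. f (T (\<lambda>i\<in>I. x i + w i)) * g (\<lambda>i\<in>I. y i + T (\<lambda>i\<in>I. x i + w i) i) \<partial>lebPi I)"
      by (rule lebPi_translate[OF fin, where a = w
            and f = "\<lambda>x. f (T x) * g (\<lambda>i\<in>I. y i + T x i)", symmetric]) measurable
    also have "\<dots> = (\<integral>\<^sup>+x. f (\<lambda>i\<in>I. T x i + - y i) * g x \<partial>lebPi I)"
    proof (rule nn_integral_cong)
      fix x assume "x \<in> space (lebPi I)"
      then have x: "x \<in> extensional I" by (simp add: space_lebPi)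
      have e: "T (\<lambda>i\<in>I. x i + w i) = (\<lambda>i\<in>I. T x i + - y i)"
        unfolding add[OF x w] Tw by (auto simp: restrict_def fun_eq_iff)
      have "(\<lambda>i\<in>I. y i + T (\<lambda>i\<in>I. x i + w i) i) = T x"
        unfolding e using ext[OF x] by (auto simp: restrict_def fun_eq_iff extensional_def)
      then show "f (T (\<lambda>i\<in>I. x i + w i)) * g (\<lambda>i\<in>I. y i + T (\<lambda>i\<in>I. x i + w i) i)
        = f (\<lambda>i\<in>I. T x i + - y i) * g x"
        using e gT[OF x] by simp
    qed
    finally show "(\<integral>\<^sup>+x. f (T x) * g (\<lambda>i\<in>I. y i + T x i) \<partial>lebPi I)
      = (\<integral>\<^sup>+x. f (\<lambda>i\<in>I. T x i + - y i) * g x \<partial>lebPi I)" .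
  qed
  also have "\<dots> = (\<integral>\<^sup>+x. (\<integral>\<^sup>+y. f (\<lambda>i\<in>I. T x i + - y i) * g x \<partial>lebPi I) \<partial>lebPi I)"
    by (rule P.Fubini') measurable
  also have "\<dots> = (\<integral>\<^sup>+x. (\<integral>\<^sup>+y. f (\<lambda>i\<in>I. - y i) \<partial>lebPi I) * g x \<partial>lebPi I)"
  proof (rule nn_integral_cong)
    fix x assume "x \<in> space (lebPi I)"
    then have Tx: "T x \<in> extensional I" "T x \<in> space (lebPi I)"
      by (auto simp: space_lebPi intro: ext)
    have "(\<integral>\<^sup>+y. f (\<lambda>i\<in>I. T x i + - y i) \<partial>lebPi I)
      = (\<integral>\<^sup>+y. f (\<lambda>i\<in>I. T x i + - (\<lambda>i\<in>I. y i + T x i) i) \<partial>lebPi I)"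
      by (rule lebPi_translate[OF fin, where a = "T x"
            and f = "\<lambda>y. f (\<lambda>i\<in>I. T x i + - y i)", symmetric]) measurable
    also have "\<dots> = (\<integral>\<^sup>+y. f (\<lambda>i\<in>I. - y i) \<partial>lebPi I)"
      by (intro nn_integral_cong arg_cong[of _ _ f]) (auto simp: restrict_def fun_eq_iff)
    finally have e: "(\<integral>\<^sup>+y. f (\<lambda>i\<in>I. T x i + - y i) \<partial>lebPi I) = (\<integral>\<^sup>+y. f (\<lambda>i\<in>I. - y i) \<partial>lebPi I)" .
    have "(\<integral>\<^sup>+y. f (\<lambda>i\<in>I. T x i + - y i) * g x \<partial>lebPi I) = (\<integral>\<^sup>+y. f (\<lambda>i\<in>I. T x i + - y i) \<partial>lebPi I) * g x"
      using Tx by (intro nn_integral_multc) measurable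
    then show "(\<integral>\<^sup>+y. f (\<lambda>i\<in>I. T x i + - y i) * g x \<partial>lebPi I)
      = (\<integral>\<^sup>+y. f (\<lambda>i\<in>I. - y i) \<partial>lebPi I) * g x"
      by (simp only: e)
  qed
  also have "\<dots> = (\<integral>\<^sup>+y. f (\<lambda>i\<in>I. - y i) \<partial>lebPi I)"
    by (subst nn_integral_cmult) (auto simp: int_g)
  finally show ?thesis .
qed

lemma invol_isometry_ident: "invol_isometry I (\<lambda>x. x)"
  by (auto simp: invol_isometry_def)

text \<open>The Gaussian density is a function of the norm, hence invariant under T, which reduces
  the claim to Lebesgue measure. There both sides equal the same reflected integral, once for T and
  once for the identity.\<close>

lemma gaussPi_invol_isometry_nn:
  assumes fin: "finite I" and T: "invol_isometry I T"
    and f [measurable]: "f \<in> borel_measurable (lebPi I)"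
  shows "(\<integral>\<^sup>+x. f (T x) \<partial>gaussPi I) = (\<integral>\<^sup>+x. f x \<partial>gaussPi I)"
proof -
  define g where "g x = (\<Prod>i\<in>I. ennreal (std_normal_density (x i)))" for x
  have [measurable]: "T \<in> measurable (lebPi I) (lebPi I)"
    using T by (simp add: invol_isometry_def)
  have g [measurable]: "g \<in> borel_measurable (lebPi I)"
    unfolding g_def by measurable
  have gT: "g (T x) = g x" if "x \<in> extensional I" for x
    using T that fin by (simp add: g_def invol_isometry_def prod_std_normal_density)
  have "(\<integral>\<^sup>+x. f (T x) \<partial>gaussPi I) = (\<integral>\<^sup>+x. g x * f (T x) \<partial>lebPi I)"
    unfolding gaussPi_density[OF fin] g_def[symmetric] by (rule nn_integral_density) auto
  also have "\<dots> = (\<integral>\<^sup>+x. g (T x) * f (T x) \<partial>lebPi I)"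
    by (intro nn_integral_cong) (simp add: space_lebPi gT)
  also have "\<dots> = (\<integral>\<^sup>+x. g (\<lambda>i\<in>I. - x i) * f (\<lambda>i\<in>I. - x i) \<partial>lebPi I)"
    by (rule lebPi_invol_isometry_uminus[OF fin T, where f = "\<lambda>x. g x * f x"]) measurable
  also have "\<dots> = (\<integral>\<^sup>+x. g x * f x \<partial>lebPi I)"
    by (rule lebPi_invol_isometry_uminus[OF fin invol_isometry_ident, where f = "\<lambda>x. g x * f x", symmetric])
      measurable
  also have "\<dots> = (\<integral>\<^sup>+x. f x \<partial>gaussPi I)"
    unfolding gaussPi_density[OF fin] g_def[symmetric] by (rule nn_integral_density[symmetric]) auto
  finally show ?thesis .
qed

section \<open>Householder tridiagonalization\<close>

text \<open>The Householder reflection along \<open>u\<close>; for \<open>u = 0\<close> the convention \<open>x / 0 = 0\<close> makes it the identity.\<close>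

definition hrefl :: "nat \<Rightarrow> (nat \<Rightarrow> real) \<Rightarrow> (nat \<Rightarrow> real) \<Rightarrow> nat \<Rightarrow> real" where
  "hrefl n u z k = (if k < n
     then z k - 2 * (\<Sum>l<n. u l * z l) / (\<Sum>l<n. (u l)\<^sup>2) * u k else z k)"

lemma hrefl_add: "hrefl n u (\<lambda>k. x k + y k) k = hrefl n u x k + hrefl n u y k"
  by (simp add: hrefl_def distrib_left sum.distrib add_divide_distrib algebra_simps)

lemma hrefl_cong: "(\<And>k. k < n \<Longrightarrow> x k = y k) \<Longrightarrow> k < n \<Longrightarrow> hrefl n u x k = hrefl n u y k"
  by (simp add: hrefl_def)

lemma hrefl_cong_u: "(\<And>k. k < n \<Longrightarrow> u k = v k) \<Longrightarrow> hrefl n u x k = hrefl n v x k"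
  by (simp add: hrefl_def)

lemma hrefl_invol: "hrefl n u (hrefl n u z) k = z k"
proof (cases "(\<Sum>l<n. (u l)\<^sup>2) = 0")
  case True
  then show ?thesis by (simp add: hrefl_def)
next
  case False
  define s where "s = (\<Sum>l<n. (u l)\<^sup>2)"
  have "(\<Sum>l<n. u l * hrefl n u z l) = (\<Sum>l<n. u l * z l - 2 * (\<Sum>l<n. u l * z l) / s * (u l)\<^sup>2)"
    by (rule sum.cong) (auto simp: hrefl_def s_def algebra_simps power2_eq_square)
  also have "\<dots> = - (\<Sum>l<n. u l * z l)"
    using False unfolding sum_subtractf sum_distrib_left[symmetric] s_def[symmetric] by simp
  finally have e: "(\<Sum>l<n. u l * hrefl n u z l) = - (\<Sum>l<n. u l * z l)" .
  show ?thesis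
    unfolding hrefl_def[of n u "hrefl n u z"] e by (simp add: hrefl_def)
qed

lemma hrefl_selfadj: "(\<Sum>k<n. hrefl n u x k * y k) = (\<Sum>k<n. x k * hrefl n u y k)"
proof -
  define s where "s = (\<Sum>l<n. (u l)\<^sup>2)"
  have "(\<Sum>k<n. hrefl n u x k * y k)
      = (\<Sum>k<n. x k * y k - 2 * (\<Sum>l<n. u l * x l) / s * (u k * y k))"
    by (rule sum.cong) (auto simp: hrefl_def s_def algebra_simps)
  also have "\<dots> = (\<Sum>k<n. x k * y k) - 2 * (\<Sum>l<n. u l * x l) / s * (\<Sum>l<n. u l * y l)"
    by (simp only: sum_subtractf sum_distrib_left[symmetric])
  finally have 1: "(\<Sum>k<n. hrefl n u x k * y k)
      = (\<Sum>k<n. x k * y k) - 2 * (\<Sum>l<n. u l * x l) / s * (\<Sum>l<n. u l * y l)" .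
  have "(\<Sum>k<n. x k * hrefl n u y k)
      = (\<Sum>k<n. x k * y k - 2 * (\<Sum>l<n. u l * y l) / s * (u k * x k))"
    by (rule sum.cong) (auto simp: hrefl_def s_def algebra_simps)
  also have "\<dots> = (\<Sum>k<n. x k * y k) - 2 * (\<Sum>l<n. u l * y l) / s * (\<Sum>l<n. u l * x l)"
    by (simp only: sum_subtractf sum_distrib_left[symmetric])
  finally show ?thesis using 1 by simp
qed

lemma hrefl_inner: "(\<Sum>k<n. hrefl n u x k * hrefl n u y k) = (\<Sum>k<n. x k * y k)"
  by (simp add: hrefl_selfadj hrefl_invol)

lemma hrefl_norm: "(\<Sum>k<n. (hrefl n u x k)\<^sup>2) = (\<Sum>k<n. (x k)\<^sup>2)"
  using hrefl_inner[of n u x x] by (simp add: power2_eq_square)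

text \<open>Since h and r e have equal length, u = h - r e satisfies |u|^2 = 2 u.h. The reflection
  coefficient is therefore 1, and subtracting u from h leaves r e. If u = 0, then h already lies on
  the axis and the reflection is the identity.\<close>

lemma hrefl_axis:
  assumes n: "0 < n" and u: "\<And>l. l < n \<Longrightarrow> u l = h l - (if l = n - 1 then r else 0)"
    and r: "r\<^sup>2 = (\<Sum>l<n. (h l)\<^sup>2)" and k: "k < n"
  shows "hrefl n u h k = (if k = n - 1 then r else 0)"
proof -
  let ?e = "\<lambda>l. if l = n - 1 then r else (0::real)"
  have uh: "(\<Sum>l<n. u l * h l) = r\<^sup>2 - r * h (n - 1)"
  proof -
    have "(\<Sum>l<n. u l * h l) = (\<Sum>l<n. (h l)\<^sup>2 - (if l = n - 1 then r * h (n - 1) else 0))"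
      by (rule sum.cong) (auto simp: u power2_eq_square algebra_simps)
    also have "\<dots> = r\<^sup>2 - r * h (n - 1)"
      using n by (simp add: sum_subtractf r)
    finally show ?thesis .
  qed
  have uu: "(\<Sum>l<n. (u l)\<^sup>2) = 2 * (r\<^sup>2 - r * h (n - 1))"
  proof -
    have "(\<Sum>l<n. (u l)\<^sup>2) = (\<Sum>l<n. u l * h l - (if l = n - 1 then r * h (n - 1) - r\<^sup>2 else 0))"
      by (rule sum.cong) (auto simp: u power2_eq_square algebra_simps)
    also have "\<dots> = 2 * (r\<^sup>2 - r * h (n - 1))"
      using n by (simp add: sum_subtractf uh)
    finally show ?thesis .
  qed
  show ?thesis
  proof (cases "(\<Sum>l<n. (u l)\<^sup>2) = 0")
    case True
    then have "u k = 0" using k by (simp add: sum_nonneg_eq_0_iff)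
    then show ?thesis using True k u[OF k] by (simp add: hrefl_def)
  next
    case False
    then have "2 * (\<Sum>l<n. u l * h l) / (\<Sum>l<n. (u l)\<^sup>2) = 1"
      unfolding uu uh by simp
    then show ?thesis using k u[OF k] by (simp add: hrefl_def)
  qed
qed

section \<open>Householder conjugation acting on the disorder matrix\<close>

definition Rop :: "nat \<Rightarrow> (nat \<Rightarrow> real) \<Rightarrow> (nat \<times> nat \<Rightarrow> real) \<Rightarrow> nat \<times> nat \<Rightarrow> real" where
  "Rop n u y = (\<lambda>p\<in>{..<n}\<times>{..<n}. hrefl n u (\<lambda>q. y (fst p, q)) (snd p))"

text \<open>With H the symmetric matrix of the reflection, \<open>Rop\<close> is multiplication by H
  from the right and \<open>Cop\<close> from the left. The conjugation H y H is split into these two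
  maps, each of which is an involutive isometry of the space of matrices.\<close>

definition Cop :: "nat \<Rightarrow> (nat \<Rightarrow> real) \<Rightarrow> (nat \<times> nat \<Rightarrow> real) \<Rightarrow> nat \<times> nat \<Rightarrow> real" where
  "Cop n u y = (\<lambda>p\<in>{..<n}\<times>{..<n}. hrefl n u (\<lambda>q. y (q, snd p)) (fst p))"

lemma invol_isometry_Rop: "invol_isometry ({..<n}\<times>{..<n}) (Rop n u)"
  unfolding invol_isometry_def
proof (intro conjI ballI)
  show "Rop n u \<in> lebPi ({..<n} \<times> {..<n}) \<rightarrow>\<^sub>M lebPi ({..<n} \<times> {..<n})"
    unfolding Rop_def[abs_def]
  proof (rule measurable_restrict)
    fix p :: "nat \<times> nat" assume "p \<in> {..<n} \<times> {..<n}"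
    then obtain a b where p: "p = (a, b)" "a < n" "b < n" by auto
    then show "(\<lambda>y. hrefl n u (\<lambda>q. y (fst p, q)) (snd p)) \<in> lebPi ({..<n} \<times> {..<n}) \<rightarrow>\<^sub>M lborel"
      unfolding hrefl_def by (auto intro!: borel_measurable_sum measurable_component_singleton
          borel_measurable_diff borel_measurable_times borel_measurable_divide)
  qed
  fix x y :: "nat \<times> nat \<Rightarrow> real"
  show "Rop n u (\<lambda>i\<in>{..<n}\<times>{..<n}. x i + y i) = (\<lambda>i\<in>{..<n}\<times>{..<n}. Rop n u x i + Rop n u y i)"
    by (auto simp: Rop_def fun_eq_iff restrict_def hrefl_add[symmetric] intro!: hrefl_cong)
next
  fix x :: "nat \<times> nat \<Rightarrow> real" assume x: "x \<in> extensional ({..<n} \<times> {..<n})"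
  show "Rop n u (Rop n u x) = x"
  proof
    fix p
    show "Rop n u (Rop n u x) p = x p"
    proof (cases "p \<in> {..<n} \<times> {..<n}")
      case True
      then have "Rop n u (Rop n u x) p = hrefl n u (hrefl n u (\<lambda>q. x (fst p, q))) (snd p)"
        by (auto simp: Rop_def intro!: hrefl_cong)
      then show ?thesis by (simp add: hrefl_invol)
    next
      case False
      then show ?thesis using extensional_arb[OF x] by (simp add: Rop_def)
    qed
  qed
  have "(\<Sum>p\<in>{..<n}\<times>{..<n}. (Rop n u x p)\<^sup>2) = (\<Sum>k<n. \<Sum>l<n. (hrefl n u (\<lambda>q. x (k, q)) l)\<^sup>2)"
    unfolding sum.cartesian_product by (rule sum.cong) (auto simp: Rop_def)
  also have "\<dots> = (\<Sum>p\<in>{..<n}\<times>{..<n}. (x p)\<^sup>2)"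
    by (simp add: hrefl_norm sum.cartesian_product)
  finally show "(\<Sum>p\<in>{..<n}\<times>{..<n}. (Rop n u x p)\<^sup>2) = (\<Sum>p\<in>{..<n}\<times>{..<n}. (x p)\<^sup>2)" .
qed

lemma invol_isometry_Cop: "invol_isometry ({..<n}\<times>{..<n}) (Cop n u)"
  unfolding invol_isometry_def
proof (intro conjI ballI)
  show "Cop n u \<in> lebPi ({..<n} \<times> {..<n}) \<rightarrow>\<^sub>M lebPi ({..<n} \<times> {..<n})"
    unfolding Cop_def[abs_def]
  proof (rule measurable_restrict)
    fix p :: "nat \<times> nat" assume "p \<in> {..<n} \<times> {..<n}"
    then obtain a b where p: "p = (a, b)" "a < n" "b < n" by auto
    then show "(\<lambda>y. hrefl n u (\<lambda>q. y (q, snd p)) (fst p)) \<in> lebPi ({..<n} \<times> {..<n}) \<rightarrow>\<^sub>M lborel"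
      unfolding hrefl_def by (auto intro!: borel_measurable_sum measurable_component_singleton
          borel_measurable_diff borel_measurable_times borel_measurable_divide)
  qed
  fix x y :: "nat \<times> nat \<Rightarrow> real"
  show "Cop n u (\<lambda>i\<in>{..<n}\<times>{..<n}. x i + y i) = (\<lambda>i\<in>{..<n}\<times>{..<n}. Cop n u x i + Cop n u y i)"
    by (auto simp: Cop_def fun_eq_iff restrict_def hrefl_add[symmetric] intro!: hrefl_cong)
next
  fix x :: "nat \<times> nat \<Rightarrow> real" assume x: "x \<in> extensional ({..<n} \<times> {..<n})"
  show "Cop n u (Cop n u x) = x"
  proof
    fix p
    show "Cop n u (Cop n u x) p = x p"
    proof (cases "p \<in> {..<n} \<times> {..<n}")
      case True
      then have "Cop n u (Cop n u x) p = hrefl n u (hrefl n u (\<lambda>q. x (q, snd p))) (fst p)"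
        by (auto simp: Cop_def intro!: hrefl_cong)
      then show ?thesis by (simp add: hrefl_invol)
    next
      case False
      then show ?thesis using extensional_arb[OF x] by (simp add: Cop_def)
    qed
  qed
  have "(\<Sum>p\<in>{..<n}\<times>{..<n}. (Cop n u x p)\<^sup>2) = (\<Sum>k<n. \<Sum>l<n. (hrefl n u (\<lambda>q. x (q, l)) k)\<^sup>2)"
    unfolding sum.cartesian_product by (rule sum.cong) (auto simp: Cop_def)
  also have "\<dots> = (\<Sum>l<n. \<Sum>k<n. (hrefl n u (\<lambda>q. x (q, l)) k)\<^sup>2)"
    by (rule sum.swap)
  also have "\<dots> = (\<Sum>l<n. \<Sum>k<n. (x (k, l))\<^sup>2)"
    by (simp add: hrefl_norm)
  also have "\<dots> = (\<Sum>k<n. \<Sum>l<n. (x (k, l))\<^sup>2)"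
    by (rule sum.swap)
  also have "\<dots> = (\<Sum>p\<in>{..<n}\<times>{..<n}. (x p)\<^sup>2)"
    by (simp add: sum.cartesian_product)
  finally show "(\<Sum>p\<in>{..<n}\<times>{..<n}. (Cop n u x p)\<^sup>2) = (\<Sum>p\<in>{..<n}\<times>{..<n}. (x p)\<^sup>2)" .
qed

text \<open>The coefficient of z_m z_l in the quadratic form, which sees only the symmetrized
  matrix.\<close>

definition hvec :: "nat \<Rightarrow> (nat \<times> nat \<Rightarrow> real) \<Rightarrow> nat \<Rightarrow> real" where
  "hvec m J l = J (m, l) + J (l, m)"

definition bcoef :: "nat \<Rightarrow> (nat \<times> nat \<Rightarrow> real) \<Rightarrow> real" where
  "bcoef m J = sqrt (\<Sum>l<m. (hvec m J l)\<^sup>2)"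

definition uvec :: "nat \<Rightarrow> (nat \<times> nat \<Rightarrow> real) \<Rightarrow> nat \<Rightarrow> real" where
  "uvec m J l = hvec m J l - (if l = m - 1 then bcoef m J else 0)"

text \<open>Conjugation of the leading block by the reflection that moves \<open>hvec m J\<close> to a multiple of the last
  basis vector. The reflection depends on \<open>J\<close> only through entries outside the block, which makes
  the map measure preserving.\<close>

definition Psi :: "nat \<Rightarrow> nat \<Rightarrow> (nat \<times> nat \<Rightarrow> real) \<Rightarrow> nat \<times> nat \<Rightarrow> real" where
  "Psi N m J = (\<lambda>p\<in>{..<N}\<times>{..<N}. if p \<in> {..<m}\<times>{..<m}
     then Cop m (uvec m J) (Rop m (uvec m J) J) p else J p)"

lemma hvec_measurable [measurable (raw)]:
  assumes "m < N" "l < N"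
  shows "(\<lambda>J. hvec m J l) \<in> borel_measurable (lebPi ({..<N}\<times>{..<N}))"
  unfolding hvec_def using assms
  by (intro borel_measurable_add) (auto intro!: measurable_component_singleton)

lemma bcoef_measurable [measurable (raw)]:
  assumes "m < N"
  shows "bcoef m \<in> borel_measurable (lebPi ({..<N}\<times>{..<N}))"
  unfolding bcoef_def[abs_def] using assms
  by (intro measurable_compose[OF _ borel_measurable_sqrt] borel_measurable_sum borel_measurable_power
      hvec_measurable) auto

lemma uvec_measurable [measurable (raw)]:
  assumes "m < N" "l < N"
  shows "(\<lambda>J. uvec m J l) \<in> borel_measurable (lebPi ({..<N}\<times>{..<N}))"
  unfolding uvec_def using assms
  by (intro borel_measurable_diff hvec_measurable)
    (cases "l = m - 1"; auto intro!: bcoef_measurable)+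

lemma hrefl_measurable:
  assumes "\<And>l. l < n \<Longrightarrow> (\<lambda>J. u J l) \<in> borel_measurable M"
    and "\<And>l. l < n \<Longrightarrow> (\<lambda>J. x J l) \<in> borel_measurable M" and "k < n"
  shows "(\<lambda>J. hrefl n (u J) (x J) k) \<in> borel_measurable M"
  unfolding hrefl_def using assms
  by (auto intro!: borel_measurable_sum borel_measurable_diff borel_measurable_times
      borel_measurable_divide borel_measurable_power)

lemma Psi_measurable [measurable]:
  assumes m: "m < N"
  shows "Psi N m \<in> lebPi ({..<N}\<times>{..<N}) \<rightarrow>\<^sub>M lebPi ({..<N}\<times>{..<N})"
  unfolding Psi_def[abs_def]
proof (rule measurable_restrict)
  fix p :: "nat \<times> nat" assume p: "p \<in> {..<N} \<times> {..<N}"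
  show "(\<lambda>J. if p \<in> {..<m} \<times> {..<m} then Cop m (uvec m J) (Rop m (uvec m J) J) p else J p)
         \<in> lebPi ({..<N} \<times> {..<N}) \<rightarrow>\<^sub>M lborel"
  proof (cases "p \<in> {..<m} \<times> {..<m}")
    case True
    have "(\<lambda>J. hrefl m (uvec m J) (\<lambda>q. Rop m (uvec m J) J (q, snd p)) (fst p))
      \<in> borel_measurable (lebPi ({..<N} \<times> {..<N}))"
    proof (rule hrefl_measurable)
      fix l assume l: "l < m"
      show "(\<lambda>J. uvec m J l) \<in> borel_measurable (lebPi ({..<N} \<times> {..<N}))"
        using l m by (intro uvec_measurable) auto
      have "(\<lambda>J. hrefl m (uvec m J) (\<lambda>q. J (l, q)) (snd p)) \<in> borel_measurable (lebPi ({..<N} \<times> {..<N}))"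
        using True l m by (intro hrefl_measurable uvec_measurable)
          (auto intro!: measurable_component_singleton)
      then show "(\<lambda>J. Rop m (uvec m J) J (l, snd p)) \<in> borel_measurable (lebPi ({..<N} \<times> {..<N}))"
        using True l by (auto simp: Rop_def)
    qed (use True in auto)
    then show ?thesis using True by (auto simp: Cop_def)
  next
    case False
    then show ?thesis using p by (auto intro!: measurable_component_singleton)
  qed
qed

text \<open>Fubini over the entries outside the block (A) and inside it (B). The vector
  \<open>uvec m\<close> reads only entries of row and column m, which lie in A; with these frozen,
  the action on B is a fixed composition of \<open>Rop\<close> and \<open>Cop\<close>, and each
  preserves the Gaussian measure.\<close>

lemma Psi_preserves_nn:
  assumes m: "m < N" and f [measurable]: "f \<in> borel_measurable (lebPi ({..<N}\<times>{..<N}))"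
  shows "(\<integral>\<^sup>+J. f (Psi N m J) \<partial>gaussPi ({..<N}\<times>{..<N})) = (\<integral>\<^sup>+J. f J \<partial>gaussPi ({..<N}\<times>{..<N}))"
proof -
  define B where "B = {..<m} \<times> {..<m}"
  define A where "A = {..<N} \<times> {..<N} - B"
  have AB: "A \<inter> B = {}" "finite A" "finite B" "A \<union> B = {..<N} \<times> {..<N}"
    using m by (auto simp: A_def B_def)
  have g [measurable]: "(\<lambda>J. f (Psi N m J)) \<in> borel_measurable (lebPi ({..<N}\<times>{..<N}))"
    by (rule measurable_compose[OF Psi_measurable[OF m]]) measurable
  have "(\<integral>\<^sup>+J. f (Psi N m J) \<partial>gaussPi (A \<union> B))
    = (\<integral>\<^sup>+x. (\<integral>\<^sup>+y. f (Psi N m (merge A B (x, y))) \<partial>gaussPi B) \<partial>gaussPi A)"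
    by (rule gaussP.product_nn_integral_fold) (use AB g in \<open>auto simp: measurable_cong_sets[OF sets_gaussPi refl]\<close>)
  also have "\<dots> = (\<integral>\<^sup>+x. (\<integral>\<^sup>+y. f (merge A B (x, y)) \<partial>gaussPi B) \<partial>gaussPi A)"
  proof (rule nn_integral_cong)
    fix x assume x: "x \<in> space (gaussPi A)"
    define u where "u = uvec m x"
    have hm: "hvec m (merge A B (x, y)) l = hvec m x l" if "l < m" for y l
      using that m by (simp add: hvec_def merge_def A_def B_def)
    have um: "uvec m (merge A B (x, y)) l = u l" if "l < m" for y l
      using that hm by (simp add: uvec_def u_def bcoef_def)
    have ps: "Psi N m (merge A B (x, y)) = merge A B (x, Cop m u (Rop m u y))" for y
    proof
      fix p
      have r: "Rop m (uvec m (merge A B (x, y))) (merge A B (x, y)) q = Rop m u y q" for q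
      proof (cases "q \<in> {..<m} \<times> {..<m}")
        case True
        have "hrefl m (uvec m (merge A B (x, y))) (\<lambda>qa. merge A B (x, y) (fst q, qa)) (snd q)
          = hrefl m u (\<lambda>qa. merge A B (x, y) (fst q, qa)) (snd q)"
          by (rule hrefl_cong_u) (rule um)
        also have "\<dots> = hrefl m u (\<lambda>qa. y (fst q, qa)) (snd q)"
          using True by (intro hrefl_cong) (auto simp: merge_def A_def B_def)
        finally show ?thesis using True by (auto simp: Rop_def)
      qed (auto simp: Rop_def)
      have c: "Cop m (uvec m (merge A B (x, y))) w p = Cop m u w p" for w
        unfolding Cop_def by (auto simp: restrict_def intro!: hrefl_cong_u um)
      show "Psi N m (merge A B (x, y)) p = merge A B (x, Cop m u (Rop m u y)) p"
      proof (cases "p \<in> B")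
        case True
        then have "p \<in> {..<N} \<times> {..<N}" "p \<in> {..<m} \<times> {..<m}" using m by (auto simp: B_def)
        then have "Psi N m (merge A B (x, y)) p
          = Cop m u (Rop m (uvec m (merge A B (x, y))) (merge A B (x, y))) p"
          by (simp add: Psi_def c)
        also have "\<dots> = Cop m u (Rop m u y) p"
          by (simp only: r[abs_def])
        finally show ?thesis using True by (simp add: merge_def A_def)
      next
        case False
        then show ?thesis using m by (auto simp: Psi_def A_def B_def merge_def)
      qed
    qed
    have fm [measurable]: "(\<lambda>y. f (merge A B (x, y))) \<in> borel_measurable (lebPi B)"
    proof (rule measurable_compose[OF _ f])
      have "x \<in> space (lebPi A)" using x by (simp add: space_PiM)
      then show "(\<lambda>y. merge A B (x, y)) \<in> lebPi B \<rightarrow>\<^sub>M lebPi ({..<N}\<times>{..<N})"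
        using measurable_compose[OF measurable_Pair1' measurable_merge, of x A "\<lambda>_. lborel" B]
        by (simp add: AB)
    qed
    have [measurable]: "Cop m u \<in> lebPi B \<rightarrow>\<^sub>M lebPi B"
      using invol_isometry_Cop[of m u] by (simp add: invol_isometry_def B_def)
    have "(\<integral>\<^sup>+y. f (merge A B (x, Cop m u (Rop m u y))) \<partial>gaussPi B)
      = (\<integral>\<^sup>+y. f (merge A B (x, Cop m u y)) \<partial>gaussPi B)"
      by (rule gaussPi_invol_isometry_nn[OF \<open>finite B\<close> invol_isometry_Rop[of m u, folded B_def]])
        (rule measurable_compose[OF _ fm], measurable)
    also have "\<dots> = (\<integral>\<^sup>+y. f (merge A B (x, y)) \<partial>gaussPi B)"
      by (rule gaussPi_invol_isometry_nn[OF \<open>finite B\<close> invol_isometry_Cop[of m u, folded B_def]])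
        (rule fm)
    finally show "(\<integral>\<^sup>+y. f (Psi N m (merge A B (x, y))) \<partial>gaussPi B)
      = (\<integral>\<^sup>+y. f (merge A B (x, y)) \<partial>gaussPi B)"
      by (simp only: ps)
  qed
  also have "\<dots> = (\<integral>\<^sup>+J. f J \<partial>gaussPi (A \<union> B))"
    by (rule gaussP.product_nn_integral_fold[symmetric])
      (use AB f in \<open>auto simp: measurable_cong_sets[OF sets_gaussPi refl]\<close>)
  finally show ?thesis by (simp add: AB)
qed

text \<open>Indicators show that M is its own image under T. Passing through the image measure
  covers non-integrable F too, so the disorder integrals of log Z may be transformed before their
  integrability has been established.\<close>

lemma measure_preserving_integral:
  fixes F :: "_ \<Rightarrow> real"
  assumes T: "T \<in> M \<rightarrow>\<^sub>M M"
    and nn: "\<And>f. f \<in> borel_measurable M \<Longrightarrow> (\<integral>\<^sup>+x. f (T x) \<partial>M) = (\<integral>\<^sup>+x. f x \<partial>M)"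
    and F: "F \<in> borel_measurable M"
  shows "(\<integral>x. F (T x) \<partial>M) = (\<integral>x. F x \<partial>M)"
proof -
  have "distr M M T = M"
  proof (rule measure_eqI)
    fix A assume A: "A \<in> sets (distr M M T)"
    then have "emeasure (distr M M T) A = (\<integral>\<^sup>+x. indicator A x \<partial>distr M M T)"
      by simp
    also have "\<dots> = (\<integral>\<^sup>+x. indicator A (T x) \<partial>M)"
      using A T by (intro nn_integral_distr) auto
    also have "\<dots> = (\<integral>\<^sup>+x. indicator A x \<partial>M)"
      using A by (intro nn) auto
    finally show "emeasure (distr M M T) A = emeasure M A" using A by simp
  qed simp
  then have "(\<integral>x. F x \<partial>M) = (\<integral>x. F x \<partial>distr M M T)" by simp
  also have "\<dots> = (\<integral>x. F (T x) \<partial>M)"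
    by (rule integral_distr[OF T F])
  finally show ?thesis by simp
qed

section \<open>Free energy of partly tridiagonal forms\<close>

text \<open>Rows from \<open>m\<close> on are already tridiagonalized. At \<open>k = 0\<close> the term with \<open>k - 1 = 0\<close> is harmless, since
  \<open>bcoef 0 J = 0\<close>.\<close>

definition Qtri :: "nat \<Rightarrow> nat \<Rightarrow> (nat \<times> nat \<Rightarrow> real) \<Rightarrow> (nat \<Rightarrow> real) \<Rightarrow> real" where
  "Qtri N m J z = (\<Sum>k<m. \<Sum>l<m. J (k, l) * z k * z l)
     + (\<Sum>k\<in>{m..<N}. J (k, k) * (z k)\<^sup>2 + bcoef k J * z k * z (k - 1))"

text \<open>The part of the energy depending on the squared norm alone is kept apart as phi:
  isometries change q but never phi, so only the quadratic form has to be followed through the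
  reductions.\<close>

definition logZ :: "nat \<Rightarrow> (real \<Rightarrow> real) \<Rightarrow> ((nat \<Rightarrow> real) \<Rightarrow> real) \<Rightarrow> real" where
  "logZ N \<phi> q = ln (\<integral>z. exp (q z + \<phi> (\<Sum>k<N. (z k)\<^sup>2)) \<partial>gaussN N)"

lemma gaussN_eq: "gaussN N = gaussPi {..<N}"
  by (simp add: gaussN_def)

lemma disorder_eq: "disorder N = gaussPi ({..<N} \<times> {..<N})"
  by (simp add: disorder_def)

lemma sets_gaussN [measurable_cong]: "sets (gaussN N) = sets (lebPi {..<N})"
  by (simp add: gaussN_eq sets_gaussPi)

lemma sets_disorder [measurable_cong]: "sets (disorder N) = sets (lebPi ({..<N} \<times> {..<N}))"
  by (simp add: disorder_eq sets_gaussPi)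

lemma sum_square_Suc:
  fixes a :: "nat \<Rightarrow> nat \<Rightarrow> real"
  shows "(\<Sum>k<Suc m. \<Sum>l<Suc m. a k l)
    = (\<Sum>k<m. \<Sum>l<m. a k l) + (\<Sum>l<m. a m l + a l m) + a m m"
  by (simp add: sum.distrib)

text \<open>With H the reflection, the new block H J H evaluated at H z gives back the old block
  form. Row and column m are left alone by \<open>Psi\<close>; paired with H z, self-adjointness
  moves H onto \<open>hvec m J\<close>, which becomes \<open>bcoef m J\<close> times the basis
  vector m - 1. Rows beyond m use only entries outside the block and coordinates from m on, and
  neither changes.\<close>

lemma Qtri_Suc:
  assumes m: "m < N"
  shows "Qtri N (Suc m) (Psi N m J) (\<lambda>k\<in>{..<N}. hrefl m (uvec m J) z k) = Qtri N m J z"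
proof -
  define u where "u = uvec m J"
  define J' where "J' = Psi N m J"
  define y where "y = (\<lambda>k\<in>{..<N}. hrefl m u z k)"
  have y1: "y k = hrefl m u z k" if "k < m" for k using that m by (simp add: y_def)
  have y2: "y k = z k" if "m \<le> k" "k < N" for k using that by (simp add: y_def hrefl_def)
  have J1: "J' (k, l) = hrefl m u (\<lambda>p. hrefl m u (\<lambda>q. J (p, q)) l) k" if "k < m" "l < m" for k l
  proof -
    have "J' (k, l) = hrefl m u (\<lambda>p. Rop m u J (p, l)) k"
      using that m by (simp add: J'_def Psi_def Cop_def u_def)
    also have "\<dots> = hrefl m u (\<lambda>p. hrefl m u (\<lambda>q. J (p, q)) l) k"
      using that by (intro hrefl_cong) (simp_all add: Rop_def)
    finally show ?thesis .
  qed
  have J2: "J' (k, l) = J (k, l)" if "k < N" "l < N" "m \<le> k \<or> m \<le> l" for k l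
    using that by (auto simp: J'_def Psi_def)
  have block: "(\<Sum>k<m. \<Sum>l<m. J' (k, l) * y k * y l) = (\<Sum>k<m. \<Sum>l<m. J (k, l) * z k * z l)"
  proof -
    have "(\<Sum>k<m. \<Sum>l<m. J' (k, l) * y k * y l)
      = (\<Sum>l<m. \<Sum>k<m. hrefl m u (\<lambda>p. hrefl m u (\<lambda>q. J (p, q)) l) k * hrefl m u z k * hrefl m u z l)"
      by (subst sum.swap) (simp add: J1 y1)
    also have "\<dots> = (\<Sum>l<m. (\<Sum>k<m. hrefl m u (\<lambda>q. J (k, q)) l * z k) * hrefl m u z l)"
      by (simp only: sum_distrib_right[symmetric] hrefl_inner)
    also have "\<dots> = (\<Sum>k<m. \<Sum>l<m. hrefl m u (\<lambda>q. J (k, q)) l * z k * hrefl m u z l)"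
      by (subst sum.swap) (simp only: sum_distrib_right)
    also have "\<dots> = (\<Sum>k<m. z k * (\<Sum>l<m. hrefl m u (\<lambda>q. J (k, q)) l * hrefl m u z l))"
      by (simp only: sum_distrib_left mult_ac)
    also have "\<dots> = (\<Sum>k<m. \<Sum>l<m. J (k, l) * z k * z l)"
      by (simp only: hrefl_inner) (simp only: sum_distrib_left mult_ac)
    finally show ?thesis .
  qed
  have cross: "(\<Sum>l<m. J' (m, l) * y m * y l + J' (l, m) * y l * y m) = bcoef m J * z m * z (m - 1)"
  proof (cases "m = 0")
    case True then show ?thesis by (simp add: bcoef_def)
  next
    case False
    have "(\<Sum>l<m. J' (m, l) * y m * y l + J' (l, m) * y l * y m) = z m * (\<Sum>l<m. hvec m J l * hrefl m u z l)"
      unfolding sum_distrib_left using m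
      by (intro sum.cong) (auto simp: J2 y1 y2 hvec_def algebra_simps)
    also have "(\<Sum>l<m. hvec m J l * hrefl m u z l) = (\<Sum>l<m. hrefl m u (hvec m J) l * z l)"
      by (simp add: hrefl_selfadj)
    also have "\<dots> = (\<Sum>l<m. if l = m - 1 then bcoef m J * z l else 0)"
    proof (rule sum.cong[OF refl])
      fix l assume "l \<in> {..<m}"
      then have "hrefl m u (hvec m J) l = (if l = m - 1 then bcoef m J else 0)"
        using False by (intro hrefl_axis) (auto simp: u_def uvec_def bcoef_def sum_nonneg)
      then show "hrefl m u (hvec m J) l * z l = (if l = m - 1 then bcoef m J * z l else 0)"
        by simp
    qed
    also have "\<dots> = bcoef m J * z (m - 1)"
      using False by (simp add: sum.delta)
    finally show ?thesis by (simp add: mult_ac)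
  qed
  have diag: "J' (m, m) * y m * y m = J (m, m) * (z m)\<^sup>2"
    using m by (simp add: J2 y2 power2_eq_square)
  have rest: "(\<Sum>k\<in>{Suc m..<N}. J' (k, k) * (y k)\<^sup>2 + bcoef k J' * y k * y (k - 1))
    = (\<Sum>k\<in>{Suc m..<N}. J (k, k) * (z k)\<^sup>2 + bcoef k J * z k * z (k - 1))"
  proof (rule sum.cong[OF refl])
    fix k assume k: "k \<in> {Suc m..<N}"
    have "hvec k J' l = hvec k J l" if "l < k" for l
      using that k by (simp add: hvec_def J2)
    then have "bcoef k J' = bcoef k J" by (simp add: bcoef_def)
    moreover have "y (k - 1) = z (k - 1)" "y k = z k" "J' (k, k) = J (k, k)"
      using k by (auto simp: y2 J2)
    ultimately show "J' (k, k) * (y k)\<^sup>2 + bcoef k J' * y k * y (k - 1)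
      = J (k, k) * (z k)\<^sup>2 + bcoef k J * z k * z (k - 1)" by simp
  qed
  have "Qtri N (Suc m) J' y = (\<Sum>k<m. \<Sum>l<m. J (k, l) * z k * z l) + bcoef m J * z m * z (m - 1)
      + J (m, m) * (z m)\<^sup>2 + (\<Sum>k\<in>{Suc m..<N}. J (k, k) * (z k)\<^sup>2 + bcoef k J * z k * z (k - 1))"
    unfolding Qtri_def sum_square_Suc block cross diag rest by simp
  also have "\<dots> = Qtri N m J z"
    using m by (simp add: Qtri_def sum.atLeast_Suc_lessThan)
  finally show ?thesis unfolding J'_def y_def u_def .
qed

lemma Qtri_measurable_pair:
  assumes "m \<le> N" and f: "f \<in> M \<rightarrow>\<^sub>M lebPi ({..<N} \<times> {..<N})" and g: "g \<in> M \<rightarrow>\<^sub>M lebPi {..<N}"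
  shows "(\<lambda>w. Qtri N m (f w) (g w)) \<in> borel_measurable M"
proof -
  have fm: "(\<lambda>w. f w (k, l)) \<in> borel_measurable M" if "k < N" "l < N" for k l
    using measurable_compose[OF f measurable_component_singleton[of "(k, l)"]] that by simp
  have gm: "(\<lambda>w. g w k) \<in> borel_measurable M" if "k < N" for k
    using measurable_compose[OF g measurable_component_singleton[of k]] that by simp
  have bm: "(\<lambda>w. bcoef k (f w)) \<in> borel_measurable M" if "k < N" for k
    using measurable_compose[OF f bcoef_measurable[OF that]] .
  show ?thesis
    unfolding Qtri_def using assms(1)
    by (intro borel_measurable_add borel_measurable_sum borel_measurable_times borel_measurable_power
        fm gm bm) auto
qed

lemma logZ_measurable:
  assumes q: "(\<lambda>w. q (fst w) (snd w)) \<in> borel_measurable (M \<Otimes>\<^sub>M gaussN N)"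
    and \<phi> [measurable]: "\<phi> \<in> borel_measurable borel"
  shows "(\<lambda>J. logZ N \<phi> (q J)) \<in> borel_measurable M"
proof -
  interpret prob_space "gaussN N" unfolding gaussN_eq by (rule prob_space_gaussPi)
  have [measurable]: "(\<lambda>z. \<Sum>k<N. (z k)\<^sup>2) \<in> borel_measurable (gaussN N)"
    by measurable
  have "(\<lambda>(J, z). exp (q J z + \<phi> (\<Sum>k<N. (z k)\<^sup>2))) \<in> borel_measurable (M \<Otimes>\<^sub>M gaussN N)"
    using q by (auto simp: case_prod_beta)
  then have "(\<lambda>J. \<integral>z. exp (q J z + \<phi> (\<Sum>k<N. (z k)\<^sup>2)) \<partial>gaussN N) \<in> borel_measurable M"
    by (rule borel_measurable_lebesgue_integral)
  then show ?thesis
    unfolding logZ_def by measurable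
qed

lemma logZ_isometry:
  assumes T: "invol_isometry {..<N} T" and q: "q \<in> borel_measurable (gaussN N)"
    and \<phi> [measurable]: "\<phi> \<in> borel_measurable borel"
  shows "logZ N \<phi> (\<lambda>z. q (T z)) = logZ N \<phi> q"
proof -
  have Tm: "T \<in> gaussN N \<rightarrow>\<^sub>M gaussN N"
    using T by (simp add: invol_isometry_def measurable_cong_sets[OF sets_gaussN sets_gaussN])
  have "(\<integral>z. exp (q (T z) + \<phi> (\<Sum>k<N. (T z k)\<^sup>2)) \<partial>gaussN N)
    = (\<integral>z. exp (q z + \<phi> (\<Sum>k<N. (z k)\<^sup>2)) \<partial>gaussN N)"
  proof (rule measure_preserving_integral[OF Tm])
    show "f \<in> borel_measurable (gaussN N)
      \<Longrightarrow> (\<integral>\<^sup>+x. f (T x) \<partial>gaussN N) = (\<integral>\<^sup>+x. f x \<partial>gaussN N)" for f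
      unfolding gaussN_eq
      by (rule gaussPi_invol_isometry_nn[OF _ T]) (auto simp: measurable_cong_sets[OF sets_gaussPi refl])
    have "(\<lambda>z. \<Sum>k<N. (z k)\<^sup>2) \<in> borel_measurable (gaussN N)" by measurable
    then show "(\<lambda>z. exp (q z + \<phi> (\<Sum>k<N. (z k)\<^sup>2))) \<in> borel_measurable (gaussN N)"
      using q by measurable
  qed
  moreover have "(\<integral>z. exp (q (T z) + \<phi> (\<Sum>k<N. (T z k)\<^sup>2)) \<partial>gaussN N)
    = (\<integral>z. exp (q (T z) + \<phi> (\<Sum>k<N. (z k)\<^sup>2)) \<partial>gaussN N)"
  proof (rule Bochner_Integration.integral_cong[OF refl])
    fix z assume "z \<in> space (gaussN N)"
    then have "z \<in> extensional {..<N}" by (simp add: gaussN_eq space_PiM PiE_def)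
    then show "exp (q (T z) + \<phi> (\<Sum>k<N. (T z k)\<^sup>2)) = exp (q (T z) + \<phi> (\<Sum>k<N. (z k)\<^sup>2))"
      using T by (simp add: invol_isometry_def)
  qed
  ultimately show ?thesis by (simp add: logZ_def)
qed

lemma invol_isometry_hrefl:
  assumes "m \<le> N"
  shows "invol_isometry {..<N} (\<lambda>z. \<lambda>k\<in>{..<N}. hrefl m u z k)"
  unfolding invol_isometry_def
proof (intro conjI ballI)
  show "(\<lambda>z. \<lambda>k\<in>{..<N}. hrefl m u z k) \<in> lebPi {..<N} \<rightarrow>\<^sub>M lebPi {..<N}"
  proof (rule measurable_restrict)
    fix k assume "k \<in> {..<N}"
    then show "(\<lambda>z. hrefl m u z k) \<in> lebPi {..<N} \<rightarrow>\<^sub>M lborel"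
      unfolding hrefl_def using assms by (auto intro!: borel_measurable_sum measurable_component_singleton
          borel_measurable_diff borel_measurable_times borel_measurable_divide)
  qed
  fix x y :: "nat \<Rightarrow> real"
  have "hrefl m u (\<lambda>i\<in>{..<N}. x i + y i) k = hrefl m u (\<lambda>i. x i + y i) k" if "k < N" for k
    using that assms by (auto simp: hrefl_def)
  then show "(\<lambda>k\<in>{..<N}. hrefl m u (\<lambda>i\<in>{..<N}. x i + y i) k)
    = (\<lambda>i\<in>{..<N}. (\<lambda>k\<in>{..<N}. hrefl m u x k) i + (\<lambda>k\<in>{..<N}. hrefl m u y k) i)"
    by (auto simp: restrict_def fun_eq_iff hrefl_add)
next
  fix x :: "nat \<Rightarrow> real" assume x: "x \<in> extensional {..<N}"
  have "hrefl m u (\<lambda>k\<in>{..<N}. hrefl m u x k) k = hrefl m u (hrefl m u x) k" if "k < N" for k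
    using that assms by (auto simp: hrefl_def)
  then show "(\<lambda>k\<in>{..<N}. hrefl m u (\<lambda>k\<in>{..<N}. hrefl m u x k) k) = x"
    using extensional_arb[OF x] by (auto simp: fun_eq_iff restrict_def hrefl_invol)
  have "{..<N} = {..<m} \<union> {m..<N}" using assms by auto
  then have s: "(\<Sum>k<N. f k) = (\<Sum>k<m. f k) + (\<Sum>k\<in>{m..<N}. f k)" for f :: "nat \<Rightarrow> real"
    by (simp add: sum.union_disjoint ivl_disj_int)
  have "(\<Sum>k\<in>{m..<N}. (hrefl m u x k)\<^sup>2) = (\<Sum>k\<in>{m..<N}. (x k)\<^sup>2)"
    by (rule sum.cong) (auto simp: hrefl_def)
  then show "(\<Sum>i<N. ((\<lambda>k\<in>{..<N}. hrefl m u x k) i)\<^sup>2) = (\<Sum>i<N. (x i)\<^sup>2)"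
    by (simp add: s hrefl_norm)
qed

text \<open>Two invariances in succession: replacing J by \<open>Psi N m J\<close> under the
  disorder integral, and then, for each fixed J, reflecting z along \<open>uvec m J\<close> in the
  inner integral, where J may enter the reflection freely.\<close>

lemma integral_logZ_Qtri_Suc:
  assumes m: "m < N" and \<phi> [measurable]: "\<phi> \<in> borel_measurable borel"
  shows "(\<integral>J. logZ N \<phi> (\<lambda>z. c * Qtri N (Suc m) J z) \<partial>disorder N)
    = (\<integral>J. logZ N \<phi> (\<lambda>z. c * Qtri N m J z) \<partial>disorder N)"
proof -
  have qm: "(\<lambda>w. c * Qtri N k (fst w) (snd w)) \<in> borel_measurable (disorder N \<Otimes>\<^sub>M gaussN N)"
    if "k \<le> N" for k
    by (intro borel_measurable_times borel_measurable_const Qtri_measurable_pair[OF that]) measurable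
  have qm1: "(\<lambda>z. c * Qtri N k J z) \<in> borel_measurable (gaussN N)"
    if "k \<le> N" "J \<in> space (disorder N)" for k J
    using measurable_compose[OF measurable_Pair1'[OF that(2)] qm[OF that(1)]] by simp
  have F: "(\<lambda>J. logZ N \<phi> (\<lambda>z. c * Qtri N k J z)) \<in> borel_measurable (disorder N)" if "k \<le> N" for k
    by (rule logZ_measurable[OF qm[OF that]]) measurable
  have P: "Psi N m \<in> disorder N \<rightarrow>\<^sub>M disorder N"
    using Psi_measurable[OF m] by (simp add: measurable_cong_sets[OF sets_disorder sets_disorder])
  have "(\<integral>J. logZ N \<phi> (\<lambda>z. c * Qtri N (Suc m) J z) \<partial>disorder N)
    = (\<integral>J. logZ N \<phi> (\<lambda>z. c * Qtri N (Suc m) (Psi N m J) z) \<partial>disorder N)"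
  proof (rule measure_preserving_integral[OF P _ F, symmetric])
    show "f \<in> borel_measurable (disorder N)
      \<Longrightarrow> (\<integral>\<^sup>+x. f (Psi N m x) \<partial>disorder N) = (\<integral>\<^sup>+x. f x \<partial>disorder N)" for f
      unfolding disorder_eq
      by (rule Psi_preserves_nn[OF m]) (auto simp: measurable_cong_sets[OF sets_gaussPi refl])
  qed (use m in auto)
  also have "\<dots> = (\<integral>J. logZ N \<phi> (\<lambda>z. c * Qtri N m J z) \<partial>disorder N)"
  proof (rule Bochner_Integration.integral_cong[OF refl])
    fix J assume J: "J \<in> space (disorder N)"
    have "logZ N \<phi> (\<lambda>z. c * Qtri N (Suc m) (Psi N m J) z)
      = logZ N \<phi> (\<lambda>z. c * Qtri N (Suc m) (Psi N m J) (\<lambda>k\<in>{..<N}. hrefl m (uvec m J) z k))"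
      using m measurable_space[OF P J]
      by (intro logZ_isometry[symmetric] invol_isometry_hrefl qm1) auto
    then show "logZ N \<phi> (\<lambda>z. c * Qtri N (Suc m) (Psi N m J) z) = logZ N \<phi> (\<lambda>z. c * Qtri N m J z)"
      by (simp add: Qtri_Suc[OF m])
  qed
  finally show ?thesis .
qed

lemma integral_logZ_tridiagonal:
  assumes \<phi>: "\<phi> \<in> borel_measurable borel"
  shows "(\<integral>J. logZ N \<phi> (\<lambda>z. c * Qtri N N J z) \<partial>disorder N)
    = (\<integral>J. logZ N \<phi> (\<lambda>z. c * Qtri N 0 J z) \<partial>disorder N)"
proof -
  have "m \<le> N \<Longrightarrow> (\<integral>J. logZ N \<phi> (\<lambda>z. c * Qtri N m J z) \<partial>disorder N)
    = (\<integral>J. logZ N \<phi> (\<lambda>z. c * Qtri N 0 J z) \<partial>disorder N)" for m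
  proof (induction m)
    case (Suc m)
    then have m: "m < N" by simp
    show ?case
      unfolding integral_logZ_Qtri_Suc[OF m \<phi>] using m by (intro Suc.IH) simp
  qed simp
  then show ?thesis by blast
qed

section \<open>Reduction to independent Gaussian and chi entries\<close>

text \<open>An orthogonal change of the pairs \<open>(J (k, l), J (l, k))\<close> that turns the symmetrized entries into
  \<open>sqrt 2\<close> times independent standard Gaussians.\<close>

definition pair_rot :: "nat \<Rightarrow> (nat \<times> nat \<Rightarrow> real) \<Rightarrow> nat \<times> nat \<Rightarrow> real" where
  "pair_rot N J = (\<lambda>(k, l)\<in>{..<N}\<times>{..<N}. if l < k then (J (k, l) + J (l, k)) / sqrt 2
     else if k < l then (J (l, k) - J (k, l)) / sqrt 2 else J (k, l))"

lemma invol_isometry_pair_rot: "invol_isometry ({..<N}\<times>{..<N}) (pair_rot N)"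
  unfolding invol_isometry_def
proof (intro conjI ballI)
  show "pair_rot N \<in> lebPi ({..<N} \<times> {..<N}) \<rightarrow>\<^sub>M lebPi ({..<N} \<times> {..<N})"
    unfolding pair_rot_def[abs_def]
  proof (rule measurable_restrict)
    fix p :: "nat \<times> nat" assume "p \<in> {..<N} \<times> {..<N}"
    then obtain a b where p: "p = (a, b)" "a < N" "b < N" by auto
    then show "(\<lambda>J. case p of (k, l) \<Rightarrow> if l < k then (J (k, l) + J (l, k)) / sqrt 2
     else if k < l then (J (l, k) - J (k, l)) / sqrt 2 else J (k, l)) \<in> lebPi ({..<N} \<times> {..<N}) \<rightarrow>\<^sub>M lborel"
      by (auto intro!: measurable_component_singleton borel_measurable_diff borel_measurable_add
          borel_measurable_divide)
  qed
  fix x y :: "nat \<times> nat \<Rightarrow> real"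
  show "pair_rot N (\<lambda>i\<in>{..<N}\<times>{..<N}. x i + y i) = (\<lambda>i\<in>{..<N}\<times>{..<N}. pair_rot N x i + pair_rot N y i)"
    by (auto simp: pair_rot_def fun_eq_iff restrict_def add_divide_distrib diff_divide_distrib)
next
  fix x :: "nat \<times> nat \<Rightarrow> real" assume x: "x \<in> extensional ({..<N} \<times> {..<N})"
  have r2: "a / sqrt 2 / sqrt 2 = a / 2" for a :: real
    by simp
  show "pair_rot N (pair_rot N x) = x"
    using extensional_arb[OF x]
    by (auto simp: pair_rot_def fun_eq_iff restrict_def add_divide_distrib diff_divide_distrib r2)
  have sq: "(a / sqrt 2)\<^sup>2 = a\<^sup>2 / 2" for a :: real
    by (simp add: power_divide)
  have two: "2 * (\<Sum>k<N. \<Sum>l<N. f k l) = (\<Sum>k<N. \<Sum>l<N. f k l + f l k)" for f :: "nat \<Rightarrow> nat \<Rightarrow> real"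
    using sum.swap[of "\<lambda>k l. f l k" "{..<N}" "{..<N}"] by (simp add: sum.distrib)
  have "2 * (\<Sum>k<N. \<Sum>l<N. (pair_rot N x (k, l))\<^sup>2) = 2 * (\<Sum>k<N. \<Sum>l<N. (x (k, l))\<^sup>2)"
    unfolding two by (intro sum.cong refl)
      (auto simp: pair_rot_def sq power2_sum power2_diff field_simps)
  then show "(\<Sum>p\<in>{..<N}\<times>{..<N}. (pair_rot N x p)\<^sup>2) = (\<Sum>p\<in>{..<N}\<times>{..<N}. (x p)\<^sup>2)"
    by (simp add: sum.cartesian_product case_prod_beta')
qed

text \<open>Under \<open>disorder N\<close> a chi-square variable with k degrees of freedom, for k <
  N. It uses only row k strictly below the diagonal, so different k are independent of each other
  and of the diagonal.\<close>

definition Yrow :: "nat \<Rightarrow> (nat \<times> nat \<Rightarrow> real) \<Rightarrow> real" where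
  "Yrow k J = (\<Sum>l<k. (J (k, l))\<^sup>2)"

text \<open>The tridiagonal model of the Gaussian orthogonal ensemble, written as a quadratic form.
  Since \<open>Yrow 0 J = 0\<close>, the term at k = 0, where \<open>k - 1\<close> is 0, contributes
  no coupling.\<close>

definition Qchi :: "nat \<Rightarrow> (nat \<times> nat \<Rightarrow> real) \<Rightarrow> (nat \<Rightarrow> real) \<Rightarrow> real" where
  "Qchi N J z = (\<Sum>k<N. J (k, k) * (z k)\<^sup>2 + sqrt 2 * sqrt (Yrow k J) * z k * z (k - 1))"

lemma integral_logZ_chi:
  assumes \<phi> [measurable]: "\<phi> \<in> borel_measurable borel"
  shows "(\<integral>J. logZ N \<phi> (\<lambda>z. c * Qtri N N J z) \<partial>disorder N)
    = (\<integral>J. logZ N \<phi> (\<lambda>z. c * Qchi N J z) \<partial>disorder N)"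
proof -
  let ?F = "\<lambda>J. logZ N \<phi> (\<lambda>z. c * Qtri N 0 J z)"
  have F: "?F \<in> borel_measurable (disorder N)"
    by (rule logZ_measurable, intro borel_measurable_times borel_measurable_const Qtri_measurable_pair) measurable
  have T: "pair_rot N \<in> disorder N \<rightarrow>\<^sub>M disorder N"
    using invol_isometry_pair_rot[of N]
    by (simp add: invol_isometry_def measurable_cong_sets[OF sets_disorder sets_disorder])
  have q: "Qtri N 0 (pair_rot N J) z = Qchi N J z" for J z
  proof -
    have "pair_rot N J (k, k) * (z k)\<^sup>2 + bcoef k (pair_rot N J) * z k * z (k - 1)
      = J (k, k) * (z k)\<^sup>2 + sqrt 2 * sqrt (Yrow k J) * z k * z (k - 1)" if k: "k \<in> {0..<N}" for k
    proof -
    have "(hvec k (pair_rot N J) l)\<^sup>2 = 2 * (J (k, l))\<^sup>2" if "l < k" for l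
    proof -
      have "hvec k (pair_rot N J) l = sqrt 2 * J (k, l)"
      proof -
        have "hvec k (pair_rot N J) l = (J (k, l) + J (l, k)) / sqrt 2 + (J (k, l) - J (l, k)) / sqrt 2"
          using that k by (simp add: hvec_def pair_rot_def)
        also have "\<dots> = J (k, l) * (2 / sqrt 2)"
          unfolding add_divide_distrib[symmetric] by simp
        also have "2 / sqrt 2 = sqrt 2"
          by (rule real_div_sqrt) simp
        finally show ?thesis by simp
      qed
      then show ?thesis by (simp add: power_mult_distrib)
    qed
    then have "bcoef k (pair_rot N J) = sqrt 2 * sqrt (Yrow k J)"
      by (simp add: bcoef_def Yrow_def sum_distrib_left[symmetric] real_sqrt_mult)
    moreover have "pair_rot N J (k, k) = J (k, k)" using k by (simp add: pair_rot_def)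
    ultimately show ?thesis by simp
    qed
    then show ?thesis by (simp add: Qtri_def Qchi_def atLeast0LessThan)
  qed
  have "(\<integral>J. ?F (pair_rot N J) \<partial>disorder N) = (\<integral>J. ?F J \<partial>disorder N)"
  proof (rule measure_preserving_integral[OF T _ F])
    show "f \<in> borel_measurable (disorder N)
      \<Longrightarrow> (\<integral>\<^sup>+x. f (pair_rot N x) \<partial>disorder N) = (\<integral>\<^sup>+x. f x \<partial>disorder N)" for f
      unfolding disorder_eq
      by (rule gaussPi_invol_isometry_nn[OF _ invol_isometry_pair_rot])
        (auto simp: measurable_cong_sets[OF sets_gaussPi refl])
  qed
  then show ?thesis by (simp add: q integral_logZ_tridiagonal)
qed

section \<open>Gaussian chains\<close>

text \<open>A Gaussian autoregressive chain: g is the white noise, r the memory and s the size of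
  the innovations. The map from noise to chain is lower triangular with diagonal s.\<close>

primrec xi :: "(nat \<Rightarrow> real) \<Rightarrow> (nat \<Rightarrow> real) \<Rightarrow> (nat \<Rightarrow> real) \<Rightarrow> nat \<Rightarrow> real" where
  "xi r s g 0 = s 0 * g 0"
| "xi r s g (Suc k) = r (Suc k) * xi r s g k + s (Suc k) * g (Suc k)"

lemma xi_cong: "(\<And>j. j \<le> k \<Longrightarrow> g j = g' j) \<Longrightarrow> xi r s g k = xi r s g' k"
  by (induction k) auto

lemma xi_upd [simp]: "k < n \<Longrightarrow> xi r s (g(n := y)) k = xi r s g k"
  by (rule xi_cong) auto

lemma xi_rec: "xi r s g k = (if k = 0 then 0 else r k * xi r s g (k - 1)) + s k * g k"
  by (cases k) auto

lemma xi_upd_same: "xi r s (g(n := y)) n = (if n = 0 then 0 else r n * xi r s g (n - 1)) + s n * y"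
  by (subst xi_rec) auto

text \<open>An affine substitution in Lebesgue measure; the weight is the Jacobian s times the ratio
  of the normal density at the new point to that at x.\<close>

lemma nn_integral_gauss1_affine:
  assumes s: "s > 0" and f [measurable]: "f \<in> borel_measurable borel"
  shows "(\<integral>\<^sup>+x. f x \<partial>gauss1)
    = (\<integral>\<^sup>+x. f (a + s * x) * ennreal (s * exp (- (a + s * x)\<^sup>2 / 2 + x\<^sup>2 / 2)) \<partial>gauss1)"
proof -
  have "(\<integral>\<^sup>+x. f x \<partial>gauss1) = (\<integral>\<^sup>+x. ennreal (std_normal_density x) * f x \<partial>lborel)"
    unfolding gauss1_def by (rule nn_integral_density) auto
  also have "\<dots> = ennreal \<bar>s\<bar> * (\<integral>\<^sup>+x. ennreal (std_normal_density (a + s * x)) * f (a + s * x) \<partial>lborel)"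
    using s by (intro nn_integral_real_affine) auto
  also have "\<dots> = (\<integral>\<^sup>+x. ennreal s * (ennreal (std_normal_density (a + s * x)) * f (a + s * x)) \<partial>lborel)"
    using s by (subst nn_integral_cmult) auto
  also have "\<dots> = (\<integral>\<^sup>+x. ennreal (std_normal_density x)
      * (f (a + s * x) * ennreal (s * exp (- (a + s * x)\<^sup>2 / 2 + x\<^sup>2 / 2))) \<partial>lborel)"
  proof (rule nn_integral_cong)
    fix x
    have "ennreal s * ennreal (std_normal_density (a + s * x))
      = ennreal (std_normal_density x) * ennreal (s * exp (- (a + s * x)\<^sup>2 / 2 + x\<^sup>2 / 2))"
    proof -
      have "exp (- x\<^sup>2 / 2) * exp (- (a + s * x)\<^sup>2 / 2 + x\<^sup>2 / 2) = exp (- (a + s * x)\<^sup>2 / 2)"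
        by (simp add: mult_exp_exp)
      then have "s * std_normal_density (a + s * x)
        = std_normal_density x * (s * exp (- (a + s * x)\<^sup>2 / 2 + x\<^sup>2 / 2))"
        by (simp add: std_normal_density_def)
      then show ?thesis
        using s by (simp only: ennreal_mult[symmetric] less_imp_le normal_density_nonneg
            zero_le_mult_iff exp_ge_zero simp_thms)
    qed
    then show "ennreal s * (ennreal (std_normal_density (a + s * x)) * f (a + s * x))
      = ennreal (std_normal_density x) * (f (a + s * x) * ennreal (s * exp (- (a + s * x)\<^sup>2 / 2 + x\<^sup>2 / 2)))"
      by (metis mult.assoc mult.commute)
  qed
  also have "\<dots> = (\<integral>\<^sup>+x. f (a + s * x) * ennreal (s * exp (- (a + s * x)\<^sup>2 / 2 + x\<^sup>2 / 2)) \<partial>gauss1)"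
    unfolding gauss1_def by (rule nn_integral_density[symmetric]) auto
  finally show ?thesis .
qed

definition zchain :: "nat \<Rightarrow> (nat \<Rightarrow> real) \<Rightarrow> (nat \<Rightarrow> real) \<Rightarrow> (nat \<Rightarrow> real) \<Rightarrow> (nat \<Rightarrow> real) \<Rightarrow> nat \<Rightarrow> real" where
  "zchain n m r s g = (\<lambda>k\<in>{..<n}. m k + xi r s g k)"

text \<open>The weight of the change of variables from z to the noise g: the determinant of the
  triangular map times the ratio of the two Gaussian densities.\<close>

definition wchain :: "nat \<Rightarrow> (nat \<Rightarrow> real) \<Rightarrow> (nat \<Rightarrow> real) \<Rightarrow> (nat \<Rightarrow> real) \<Rightarrow> (nat \<Rightarrow> real) \<Rightarrow> real" where
  "wchain n m r s g = (\<Prod>k<n. s k)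
     * exp (- (\<Sum>k<n. (m k + xi r s g k)\<^sup>2) / 2 + (\<Sum>k<n. (g k)\<^sup>2) / 2)"

lemma xi_measurable:
  "k < n \<Longrightarrow> (\<lambda>g. xi r s g k) \<in> borel_measurable (lebPi {..<n})"
  by (induction k) (auto intro!: borel_measurable_add borel_measurable_times measurable_component_singleton)

lemma zchain_measurable [measurable]: "zchain n m r s \<in> lebPi {..<n} \<rightarrow>\<^sub>M lebPi {..<n}"
  unfolding zchain_def[abs_def]
  by (rule measurable_restrict) (auto intro!: borel_measurable_add xi_measurable)

lemma wchain_measurable [measurable]: "wchain n m r s \<in> borel_measurable (lebPi {..<n})"
proof -
  have [measurable]: "(\<lambda>g. xi r s g k) \<in> borel_measurable (lebPi {..<n})" if "k \<in> {..<n}" for k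
    using that by (auto intro: xi_measurable)
  show ?thesis unfolding wchain_def[abs_def] by measurable
qed

text \<open>By induction on the last coordinate. Given the earlier ones, it is an affine function of
  its own noise, so the one-dimensional substitution is enough and the determinant builds up as a
  product.\<close>

lemma nn_integral_gaussPi_chain:
  assumes s: "\<And>k. k < n \<Longrightarrow> 0 < s k" and f: "f \<in> borel_measurable (lebPi {..<n})"
  shows "(\<integral>\<^sup>+z. f z \<partial>gaussPi {..<n})
    = (\<integral>\<^sup>+g. f (zchain n m r s g) * ennreal (wchain n m r s g) \<partial>gaussPi {..<n})"
  using assms
proof (induction n arbitrary: f)
  case 0
  then show ?case by (simp add: zchain_def wchain_def PiM_empty nn_integral_count_space_finite restrict_def)
next
  case (Suc n)
  \<comment> \<open>The conditional mean of coordinate n in terms of the earlier coordinates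
    themselves: \<open>x (n - 1) - m (n - 1)\<close> recovers the chain value from the shifted
    chain.\<close>
  define A where "A x = m n + (if n = 0 then 0 else r n * (x (n - 1) - m (n - 1)))" for x :: "nat \<Rightarrow> real"
  define w where "w a y = s n * exp (- (a + s n * y)\<^sup>2 / 2 + y\<^sup>2 / 2)" for a y
  define h where "h x = (\<integral>\<^sup>+y. f (x(n := A x + s n * y)) * ennreal (w (A x) y) \<partial>gauss1)" for x
  have ins: "{..<Suc n} = insert n {..<n}" by auto
  have sn: "0 < s n" using Suc.prems by simp
  have f [measurable]: "f \<in> borel_measurable (lebPi (insert n {..<n}))"
    using Suc.prems by (simp add: ins)
  have [measurable]: "A \<in> borel_measurable (lebPi {..<n})"
    unfolding A_def[abs_def] by (cases "n = 0") (auto intro!: borel_measurable_add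
        borel_measurable_diff borel_measurable_times measurable_component_singleton)
  have upd: "(\<lambda>p. (fst p)(n := u p)) \<in> lebPi {..<n} \<Otimes>\<^sub>M gauss1 \<rightarrow>\<^sub>M lebPi (insert n {..<n})"
    if "u \<in> borel_measurable (lebPi {..<n} \<Otimes>\<^sub>M gauss1)" for u
    by (rule measurable_fun_upd[where J = "{..<n}"]) (use that in auto)
  have h1: "(\<lambda>p. f ((fst p)(n := A (fst p) + s n * snd p))) \<in> borel_measurable (lebPi {..<n} \<Otimes>\<^sub>M gauss1)"
    by (rule measurable_compose[OF upd f]) measurable
  interpret G: prob_space gauss1 by (rule prob_space_gauss1)
  have h [measurable]: "h \<in> borel_measurable (lebPi {..<n})"
    unfolding h_def[abs_def] w_def using h1 by measurable
  have "(\<integral>\<^sup>+z. f z \<partial>gaussPi {..<Suc n}) = (\<integral>\<^sup>+x. (\<integral>\<^sup>+y. f (x(n := y)) \<partial>gauss1) \<partial>gaussPi {..<n})"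
    unfolding ins by (rule gaussP.product_nn_integral_insert) (auto simp: measurable_cong_sets[OF sets_gaussPi refl])
  also have "\<dots> = (\<integral>\<^sup>+x. h x \<partial>gaussPi {..<n})"
  proof (rule nn_integral_cong)
    fix x assume x: "x \<in> space (gaussPi {..<n})"
    have "(\<lambda>y. f (x(n := y))) \<in> borel_measurable borel"
    proof (rule measurable_compose[OF _ f])
      show "(\<lambda>y. x(n := y)) \<in> borel \<rightarrow>\<^sub>M lebPi (insert n {..<n})"
        using x by (intro measurable_fun_upd[where J = "{..<n}"]) (auto simp: space_PiM)
    qed
    then show "(\<integral>\<^sup>+y. f (x(n := y)) \<partial>gauss1) = h x"
      unfolding h_def w_def by (rule nn_integral_gauss1_affine[OF sn])
  qed
  also have "\<dots> = (\<integral>\<^sup>+g. h (zchain n m r s g) * ennreal (wchain n m r s g) \<partial>gaussPi {..<n})"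
    using Suc.prems by (intro Suc.IH) auto
  also have "\<dots> = (\<integral>\<^sup>+g. (\<integral>\<^sup>+y. f (zchain (Suc n) m r s (g(n := y)))
      * ennreal (wchain (Suc n) m r s (g(n := y))) \<partial>gauss1) \<partial>gaussPi {..<n})"
  proof (rule nn_integral_cong)
    fix g assume g: "g \<in> space (gaussPi {..<n})"
    define x where "x = zchain n m r s g"
    have Ax: "A x = m n + (if n = 0 then 0 else r n * xi r s g (n - 1))"
      using A_def[of x] by (auto simp: x_def zchain_def)
    have sp: "x \<in> space (lebPi {..<n})"
      by (auto simp: x_def zchain_def space_PiM)
    have z: "x(n := A x + s n * y) = zchain (Suc n) m r s (g(n := y))" for y
    proof
      fix k
      have "x k = (if k < n then m k + xi r s g k else undefined)"
        by (simp add: x_def zchain_def)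
      then show "(x(n := A x + s n * y)) k = zchain (Suc n) m r s (g(n := y)) k"
        unfolding Ax zchain_def by (cases "k = n") (simp_all add: xi_upd_same less_Suc_eq)
    qed
    have ww: "w (A x) y * wchain n m r s g = wchain (Suc n) m r s (g(n := y))" for y
    proof -
      have e: "m n + xi r s (g(n := y)) n = A x + s n * y"
        by (simp add: xi_upd_same Ax)
      show ?thesis
        unfolding w_def wchain_def by (simp add: e exp_add[symmetric] add_divide_distrib)
    qed
    have wn: "0 \<le> w a y" "0 \<le> wchain n m r s g" for a y
      unfolding w_def wchain_def using Suc.prems sn
      by (intro mult_nonneg_nonneg prod_nonneg; auto simp: less_imp_le)+
    have "h x * ennreal (wchain n m r s g)
      = (\<integral>\<^sup>+y. f (x(n := A x + s n * y)) * ennreal (w (A x) y) * ennreal (wchain n m r s g) \<partial>gauss1)"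
      unfolding h_def
    proof (rule nn_integral_multc[symmetric])
      show "(\<lambda>y. f (x(n := A x + s n * y)) * ennreal (w (A x) y)) \<in> borel_measurable gauss1"
        using measurable_compose[OF measurable_Pair1'[OF sp, of gauss1] h1] unfolding w_def by simp
    qed
    also have "\<dots> = (\<integral>\<^sup>+y. f (zchain (Suc n) m r s (g(n := y)))
      * ennreal (wchain (Suc n) m r s (g(n := y))) \<partial>gauss1)"
      by (simp only: z mult.assoc ennreal_mult[symmetric, OF wn] ww)
    finally show "h (zchain n m r s g) * ennreal (wchain n m r s g) = \<dots>"
      by (simp only: x_def)
  qed
  also have "\<dots> = (\<integral>\<^sup>+g. f (zchain (Suc n) m r s g) * ennreal (wchain (Suc n) m r s g) \<partial>gaussPi {..<Suc n})"
    unfolding ins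
  proof (rule gaussP.product_nn_integral_insert[symmetric])
    have "(\<lambda>g. f (zchain (Suc n) m r s g) * ennreal (wchain (Suc n) m r s g)) \<in> borel_measurable (lebPi {..<Suc n})"
      using Suc.prems(2) by measurable
    then show "(\<lambda>g. f (zchain (Suc n) m r s g) * ennreal (wchain (Suc n) m r s g))
      \<in> borel_measurable (gaussPi (insert n {..<n}))"
      by (simp add: measurable_cong_sets[OF sets_gaussPi refl] ins)
  qed auto
  finally show ?case .
qed

lemma integral_gaussN_chain:
  assumes s: "\<And>k. k < n \<Longrightarrow> 0 < s k" and f: "f \<in> borel_measurable (gaussN n)" "\<And>z. 0 \<le> f z"
  shows "(\<integral>z. f z \<partial>gaussN n) = (\<integral>g. f (zchain n m r s g) * wchain n m r s g \<partial>gaussN n)"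
proof -
  have f1: "f \<in> borel_measurable (lebPi {..<n})"
    using f(1) by (simp add: measurable_cong_sets[OF sets_gaussN refl])
  have w: "0 \<le> wchain n m r s g" for g
    unfolding wchain_def using s by (intro mult_nonneg_nonneg prod_nonneg) (auto simp: less_imp_le)
  have "(\<lambda>g. f (zchain n m r s g) * wchain n m r s g) \<in> borel_measurable (lebPi {..<n})"
    using f1 by measurable
  then have m: "(\<lambda>g. f (zchain n m r s g) * wchain n m r s g) \<in> borel_measurable (gaussN n)"
    by (simp add: measurable_cong_sets[OF sets_gaussN refl])
  have "(\<integral>\<^sup>+z. ennreal (f z) \<partial>gaussN n) = (\<integral>\<^sup>+g. ennreal (f (zchain n m r s g)) * ennreal (wchain n m r s g) \<partial>gaussN n)"
    unfolding gaussN_eq by (rule nn_integral_gaussPi_chain[OF s]) (use f1 in auto)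
  also have "\<dots> = (\<integral>\<^sup>+g. ennreal (f (zchain n m r s g) * wchain n m r s g) \<partial>gaussN n)"
    by (simp only: ennreal_mult[OF f(2) w])
  finally show ?thesis
    using f m w by (simp add: integral_eq_nn_integral)
qed

section \<open>Upper bound for near-deterministic tridiagonal couplings\<close>

lemma prob_space_gaussN: "prob_space (gaussN N)"
  unfolding gaussN_eq by (rule prob_space_gaussPi)

lemma integral_exp_pos:
  assumes "prob_space M" and i: "integrable M (\<lambda>x. exp (h x :: real))"
  shows "0 < (\<integral>x. exp (h x) \<partial>M)"
proof -
  interpret prob_space M by fact
  have "(\<integral>x. exp (h x) \<partial>M) \<noteq> 0"
  proof
    assume "(\<integral>x. exp (h x) \<partial>M) = 0"
    then have "AE x in M. exp (h x) = 0"
      using integral_nonneg_eq_0_iff_AE[OF i] by simp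
    then have "AE x in M. False" by simp
    then show False by simp
  qed
  moreover have "0 \<le> (\<integral>x. exp (h x) \<partial>M)" by (rule Bochner_Integration.integral_nonneg) simp
  ultimately show ?thesis by linarith
qed

lemma gaussN_component_measurable [measurable (raw)]:
  "k < N \<Longrightarrow> (\<lambda>z. z k) \<in> borel_measurable (gaussN N)"
  by (simp add: measurable_cong_sets[OF sets_gaussN refl] measurable_component_singleton)

text \<open>Under the unshifted chain the residual at k equals s_k g_k. The first sum then becomes
  the squared norm of the noise, everything in the exponent cancels against \<open>wchain\<close>,
  and only the constant product of the s_k remains.\<close>

lemma gaussian_chain_integral:
  fixes r s :: "nat \<Rightarrow> real"
  assumes s: "\<And>k. k < N \<Longrightarrow> 0 < s k"
  defines "f \<equiv> \<lambda>z. exp (- (\<Sum>k<N. ((z k - (if k = 0 then 0 else r k * z (k - 1))) / s k)\<^sup>2) / 2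
      + (\<Sum>k<N. (z k)\<^sup>2) / 2)"
  shows "(\<integral>\<^sup>+z. ennreal (f z) \<partial>gaussN N) = ennreal (\<Prod>k<N. s k)"
proof -
  interpret prob_space "gaussN N" by (rule prob_space_gaussN)
  have fm: "f \<in> borel_measurable (lebPi {..<N})"
  proof -
    have *: "(\<lambda>z. (z k - (if k = 0 then 0 else r k * z (k - 1))) / s k) \<in> borel_measurable (lebPi {..<N})"
      if "k \<in> {..<N}" for k
      using that by (cases "k = 0") (auto intro!: borel_measurable_divide borel_measurable_diff
          borel_measurable_times measurable_component_singleton)
    show ?thesis
      unfolding f_def using *
      by (intro measurable_compose[OF _ borel_measurable_exp] borel_measurable_add borel_measurable_divide
          borel_measurable_uminus borel_measurable_sum borel_measurable_power)
        (auto intro!: measurable_component_singleton)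
  qed
  have "(\<integral>\<^sup>+z. ennreal (f z) \<partial>gaussN N)
    = (\<integral>\<^sup>+g. ennreal (f (zchain N (\<lambda>_. 0) r s g)) * ennreal (wchain N (\<lambda>_. 0) r s g) \<partial>gaussN N)"
    unfolding gaussN_eq by (rule nn_integral_gaussPi_chain[OF s]) (use fm in auto)
  also have "\<dots> = (\<integral>\<^sup>+g. ennreal (\<Prod>k<N. s k) \<partial>gaussN N)"
  proof (rule nn_integral_cong)
    fix g
    let ?z = "zchain N (\<lambda>_. 0) r s g"
    have z: "?z k = xi r s g k" if "k < N" for k using that by (simp add: zchain_def)
    have "(\<Sum>k<N. ((?z k - (if k = 0 then 0 else r k * ?z (k - 1))) / s k)\<^sup>2) = (\<Sum>k<N. (g k)\<^sup>2)"
    proof (rule sum.cong[OF refl])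
      fix k assume k: "k \<in> {..<N}"
      then have "?z k - (if k = 0 then 0 else r k * ?z (k - 1)) = s k * g k"
        using z[of "k - 1"] by (simp add: z xi_rec[of r s g k])
      then show "((?z k - (if k = 0 then 0 else r k * ?z (k - 1))) / s k)\<^sup>2 = (g k)\<^sup>2"
        using s[of k] k by simp
    qed
    moreover have "(\<Sum>k<N. (?z k)\<^sup>2) = (\<Sum>k<N. (xi r s g k)\<^sup>2)"
      by (rule sum.cong) (auto simp: z)
    ultimately have "f ?z * wchain N (\<lambda>_. 0) r s g = (\<Prod>k<N. s k)"
      by (simp add: f_def wchain_def mult_exp_exp)
    moreover have "0 \<le> f ?z" by (simp add: f_def)
    moreover have "0 \<le> wchain N (\<lambda>_. 0) r s g"
      unfolding wchain_def using s by (intro mult_nonneg_nonneg prod_nonneg) (auto simp: less_imp_le)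
    ultimately show "ennreal (f ?z) * ennreal (wchain N (\<lambda>_. 0) r s g) = ennreal (\<Prod>k<N. s k)"
      by (simp add: ennreal_mult[symmetric])
  qed
  also have "\<dots> = ennreal (\<Prod>k<N. s k)" by (simp add: emeasure_space_1)
  finally show ?thesis .
qed

lemma invol_isometry_rev: "invol_isometry {..<N} (\<lambda>z. \<lambda>k\<in>{..<N}. z (N - Suc k))"
  unfolding invol_isometry_def
proof (intro conjI ballI)
  show "(\<lambda>z. \<lambda>k\<in>{..<N}. z (N - Suc k)) \<in> lebPi {..<N} \<rightarrow>\<^sub>M lebPi {..<N}"
    by (rule measurable_restrict) (auto intro!: measurable_component_singleton)
next
  fix x :: "nat \<Rightarrow> real" assume x: "x \<in> extensional {..<N}"
  show "(\<lambda>k\<in>{..<N}. (\<lambda>k\<in>{..<N}. x (N - Suc k)) (N - Suc k)) = x"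
    using extensional_arb[OF x] by (auto simp: fun_eq_iff restrict_def)
  show "(\<Sum>i<N. ((\<lambda>k\<in>{..<N}. x (N - Suc k)) i)\<^sup>2) = (\<Sum>i<N. (x i)\<^sup>2)"
    using sum.nat_diff_reindex[of "\<lambda>i. (x i)\<^sup>2" N] by simp
qed (auto simp: fun_eq_iff restrict_def)

text \<open>The LDL factorization runs from the last coordinate down, so that \<open>d\<close> may be chosen
  decreasing; the chain formula runs upwards, whence the reversal of coordinates.\<close>

lemma tridiagonal_gaussian_bound:
  fixes \<kappa> d :: "nat \<Rightarrow> real"
  assumes d: "\<And>k. k < N \<Longrightarrow> 0 < d k"
    and le: "\<And>k. k < N \<Longrightarrow> d k + (if k = 0 then 0 else (\<kappa> k)\<^sup>2 / d (k - 1)) \<le> \<theta>"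
    and \<kappa>0: "\<kappa> 0 = 0"
  shows "(\<integral>\<^sup>+z. ennreal (exp ((\<Sum>k<N. \<kappa> k * z k * z (k - 1)) - (\<theta> - 1) / 2 * (\<Sum>k<N. (z k)\<^sup>2))) \<partial>gaussN N)
    \<le> ennreal (\<Prod>k<N. 1 / sqrt (d k))"
proof -
  \<comment> \<open>Completing the square in z_k adds kappa_(k+1)^2 / d_k to the coefficient of
    z_(k+1)^2. Thus the diagonal of \<open>G\<close> is the left-hand side of \<open>le\<close>, and
    that assumption makes \<open>G\<close> at most theta |z|^2 minus twice the coupling
    form.\<close>
  define c where "c k = \<kappa> (Suc k) / d k" for k
  define G where "G z = (\<Sum>k<N. d k * (z k - (if Suc k < N then c k * z (Suc k) else 0))\<^sup>2)" for z
  have pw: "(\<Sum>k<N. \<kappa> k * z k * z (k - 1)) - \<theta> / 2 * (\<Sum>k<N. (z k)\<^sup>2) \<le> - G z / 2" for z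
  proof (cases N)
    case 0 then show ?thesis by (simp add: G_def)
  next
    case (Suc n)
    have sq: "d k * (z k - c k * z (Suc k))\<^sup>2
      = d k * (z k)\<^sup>2 - 2 * (\<kappa> (Suc k) * z (Suc k) * z k) + (\<kappa> (Suc k))\<^sup>2 / d k * (z (Suc k))\<^sup>2" if "k < n" for k
      using d[of k] that Suc by (simp add: c_def power2_eq_square field_simps)
    have "G z = (\<Sum>k<n. d k * (z k - c k * z (Suc k))\<^sup>2) + d n * (z n)\<^sup>2"
    proof -
      have "(\<Sum>k<n. d k * (z k - (if Suc k < Suc n then c k * z (Suc k) else 0))\<^sup>2)
        = (\<Sum>k<n. d k * (z k - c k * z (Suc k))\<^sup>2)"
        by (rule sum.cong) auto
      then show ?thesis unfolding G_def Suc sum.lessThan_Suc by simp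
    qed
    also have "(\<Sum>k<n. d k * (z k - c k * z (Suc k))\<^sup>2)
      = (\<Sum>k<n. d k * (z k)\<^sup>2) - 2 * (\<Sum>k<n. \<kappa> (Suc k) * z (Suc k) * z k)
        + (\<Sum>k<n. (\<kappa> (Suc k))\<^sup>2 / d k * (z (Suc k))\<^sup>2)"
    proof -
      have "(\<Sum>k<n. d k * (z k - c k * z (Suc k))\<^sup>2) = (\<Sum>k<n. d k * (z k)\<^sup>2
        - 2 * (\<kappa> (Suc k) * z (Suc k) * z k) + (\<kappa> (Suc k))\<^sup>2 / d k * (z (Suc k))\<^sup>2)"
        by (rule sum.cong) (auto simp: sq)
      then show ?thesis
        by (simp only: sum.distrib sum_subtractf sum_distrib_left[symmetric])
    qed
    finally have "G z = (\<Sum>k<N. d k * (z k)\<^sup>2) - 2 * (\<Sum>k<n. \<kappa> (Suc k) * z (Suc k) * z k)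
        + (\<Sum>k<n. (\<kappa> (Suc k))\<^sup>2 / d k * (z (Suc k))\<^sup>2)"
      by (simp add: Suc)
    moreover have "(\<Sum>k<N. \<kappa> k * z k * z (k - 1)) = (\<Sum>k<n. \<kappa> (Suc k) * z (Suc k) * z k)"
      unfolding Suc by (subst sum.lessThan_Suc_shift) (simp add: \<kappa>0)
    moreover have "(\<Sum>k<n. (\<kappa> (Suc k))\<^sup>2 / d k * (z (Suc k))\<^sup>2)
      = (\<Sum>k<N. (if k = 0 then 0 else (\<kappa> k)\<^sup>2 / d (k - 1)) * (z k)\<^sup>2)"
      unfolding Suc by (subst sum.lessThan_Suc_shift) simp
    ultimately have "G z = (\<Sum>k<N. (d k + (if k = 0 then 0 else (\<kappa> k)\<^sup>2 / d (k - 1))) * (z k)\<^sup>2)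
        - 2 * (\<Sum>k<N. \<kappa> k * z k * z (k - 1))"
      by (simp add: distrib_right sum.distrib)
    moreover have "(\<Sum>k<N. (d k + (if k = 0 then 0 else (\<kappa> k)\<^sup>2 / d (k - 1))) * (z k)\<^sup>2) \<le> (\<Sum>k<N. \<theta> * (z k)\<^sup>2)"
      by (rule sum_mono, rule mult_right_mono) (use le in auto)
    ultimately show ?thesis by (simp add: sum_distrib_left[symmetric])
  qed
  \<comment> \<open>The term + |z|^2 / 2 cancels the reference Gaussian; this is also why theta - 1,
    rather than theta, stands in the exponent of the claim.\<close>
  define F where "F z = exp (- G z / 2 + (\<Sum>k<N. (z k)\<^sup>2) / 2)" for z
  define s where "s k = 1 / sqrt (d (N - Suc k))" for k
  define r where "r k = c (N - Suc k)" for k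
  have s: "0 < s k" if "k < N" for k using d[of "N - Suc k"] that by (simp add: s_def)
  have "(\<integral>\<^sup>+z. ennreal (exp ((\<Sum>k<N. \<kappa> k * z k * z (k - 1)) - (\<theta> - 1) / 2 * (\<Sum>k<N. (z k)\<^sup>2))) \<partial>gaussN N)
    \<le> (\<integral>\<^sup>+z. ennreal (F z) \<partial>gaussN N)"
    unfolding F_def
  proof (intro nn_integral_mono ennreal_leI, subst exp_le_cancel_iff)
    fix z :: "nat \<Rightarrow> real"
    have "(\<theta> - 1) / 2 * (\<Sum>k<N. (z k)\<^sup>2) = \<theta> / 2 * (\<Sum>k<N. (z k)\<^sup>2) - (\<Sum>k<N. (z k)\<^sup>2) / 2"
      by (simp add: field_simps)
    then show "(\<Sum>k<N. \<kappa> k * z k * z (k - 1)) - (\<theta> - 1) / 2 * (\<Sum>k<N. (z k)\<^sup>2)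
      \<le> - G z / 2 + (\<Sum>k<N. (z k)\<^sup>2) / 2"
      using pw[of z] by linarith
  qed
  also have "\<dots> = (\<integral>\<^sup>+z. ennreal (F (\<lambda>k\<in>{..<N}. z (N - Suc k))) \<partial>gaussN N)"
    unfolding gaussN_eq
  proof (rule gaussPi_invol_isometry_nn[OF _ invol_isometry_rev, symmetric])
    have "(\<lambda>z. z k - (if Suc k < N then c k * z (Suc k) else 0)) \<in> borel_measurable (lebPi {..<N})"
      if "k \<in> {..<N}" for k
      using that by (cases "Suc k < N") (auto intro!: borel_measurable_diff
          borel_measurable_times measurable_component_singleton)
    then have "F \<in> borel_measurable (lebPi {..<N})"
      unfolding F_def G_def
      by (intro measurable_compose[OF _ borel_measurable_exp] borel_measurable_add borel_measurable_divide
          borel_measurable_uminus borel_measurable_sum borel_measurable_times borel_measurable_power)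
        (auto intro!: measurable_component_singleton)
    then show "(\<lambda>z. ennreal (F z)) \<in> borel_measurable (lebPi {..<N})" by measurable
  qed auto
  also have "\<dots> = (\<integral>\<^sup>+z. ennreal (exp (- (\<Sum>k<N. ((z k - (if k = 0 then 0 else r k * z (k - 1))) / s k)\<^sup>2) / 2
      + (\<Sum>k<N. (z k)\<^sup>2) / 2)) \<partial>gaussN N)"
  proof (rule nn_integral_cong)
    fix z :: "nat \<Rightarrow> real"
    let ?y = "\<lambda>k\<in>{..<N}. z (N - Suc k)"
    have "G ?y = (\<Sum>k<N. (\<lambda>j. ((z j - (if j = 0 then 0 else r j * z (j - 1))) / s j)\<^sup>2) (N - Suc k))"
      unfolding G_def
    proof (rule sum.cong[OF refl])
      fix k assume "k \<in> {..<N}"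
      then have k: "k < N" by simp
      then have sj: "s (N - Suc k) = 1 / sqrt (d k)" "r (N - Suc k) = c k" by (simp_all add: s_def r_def)
      have "?y k - (if Suc k < N then c k * ?y (Suc k) else 0)
        = z (N - Suc k) - (if N - Suc k = 0 then 0 else c k * z (N - Suc k - 1))"
        using k by auto
      then show "d k * (?y k - (if Suc k < N then c k * ?y (Suc k) else 0))\<^sup>2 =
         ((z (N - Suc k) - (if N - Suc k = 0 then 0 else r (N - Suc k) * z (N - Suc k - 1))) / s (N - Suc k))\<^sup>2"
        using d[OF k] unfolding sj by (simp add: power_mult_distrib)
    qed
    also have "\<dots> = (\<Sum>k<N. ((z k - (if k = 0 then 0 else r k * z (k - 1))) / s k)\<^sup>2)"
      by (rule sum.nat_diff_reindex)
    finally have "G ?y = \<dots>" .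
    moreover have "(\<Sum>k<N. (?y k)\<^sup>2) = (\<Sum>k<N. (z k)\<^sup>2)"
      using sum.nat_diff_reindex[of "\<lambda>i. (z i)\<^sup>2" N] by simp
    ultimately show "ennreal (F ?y) = ennreal (exp (- (\<Sum>k<N. ((z k - (if k = 0 then 0 else r k * z (k - 1))) / s k)\<^sup>2) / 2
      + (\<Sum>k<N. (z k)\<^sup>2) / 2))"
      unfolding F_def by simp
  qed
  also have "\<dots> = ennreal (\<Prod>k<N. s k)"
    by (rule gaussian_chain_integral) (rule s)
  also have "(\<Prod>k<N. s k) = (\<Prod>k<N. 1 / sqrt (d k))"
    unfolding s_def by (rule prod.nat_diff_reindex)
  finally show ?thesis .
qed

text \<open>The off-diagonal part of the scaled form \<open>Qchi\<close>, with
  \<open>Yrow k J\<close> replaced by its mean k.\<close>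

definition Hdet :: "nat \<Rightarrow> real \<Rightarrow> (nat \<Rightarrow> real) \<Rightarrow> real" where
  "Hdet N \<beta> z = (\<Sum>k<N. \<beta> * sqrt (real k / real N) * z k * z (k - 1))"

definition phi :: "nat \<Rightarrow> real \<Rightarrow> real \<Rightarrow> real \<Rightarrow> real" where
  "phi N \<beta> lam w = - \<beta>\<^sup>2 / (4 * real N) * w\<^sup>2 + lam / 2 * w"

text \<open>The larger root of D^2 - theta D + beta^2 t = 0, which is the pivot recursion with
  couplings beta sqrt t when consecutive pivots are identified. This root stays at or above theta /
  2 and decreases in t.\<close>

definition Droot :: "real \<Rightarrow> real \<Rightarrow> real \<Rightarrow> real" where
  "Droot \<beta> \<theta> t = (\<theta> + sqrt (\<theta>\<^sup>2 - 4 * \<beta>\<^sup>2 * t)) / 2"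

lemma Droot_disc_nonneg:
  fixes \<beta> \<theta> t :: real
  assumes "0 < \<beta>" "2 * \<beta> \<le> \<theta>" "t \<le> 1"
  shows "0 \<le> \<theta>\<^sup>2 - 4 * \<beta>\<^sup>2 * t"
proof -
  have "(2 * \<beta>)\<^sup>2 \<le> \<theta>\<^sup>2" using assms by (intro power_mono) auto
  moreover have "4 * \<beta>\<^sup>2 * t \<le> 4 * \<beta>\<^sup>2 * 1" using assms by (intro mult_left_mono) auto
  ultimately show ?thesis by (simp add: power_mult_distrib)
qed

lemma Droot_pos:
  assumes "0 < \<beta>" "2 * \<beta> \<le> \<theta>" "t \<le> 1"
  shows "0 < Droot \<beta> \<theta> t"
proof -
  have "0 < \<theta>" using assms by simp
  moreover have "0 \<le> sqrt (\<theta>\<^sup>2 - 4 * \<beta>\<^sup>2 * t)"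
    using Droot_disc_nonneg[OF assms] by simp
  ultimately have "0 < \<theta> + sqrt (\<theta>\<^sup>2 - 4 * \<beta>\<^sup>2 * t)" by linarith
  then show ?thesis by (simp add: Droot_def)
qed

lemma Droot_eq:
  assumes "0 < \<beta>" "2 * \<beta> \<le> \<theta>" "t \<le> 1"
  shows "Droot \<beta> \<theta> t + \<beta>\<^sup>2 * t / Droot \<beta> \<theta> t = \<theta>"
proof -
  define D where "D = Droot \<beta> \<theta> t"
  have "(2 * D - \<theta>)\<^sup>2 = \<theta>\<^sup>2 - 4 * \<beta>\<^sup>2 * t"
  proof -
    have "2 * ((\<theta> + r) / 2) - \<theta> = r" for r :: real by (simp add: field_simps)
    then have "2 * D - \<theta> = sqrt (\<theta>\<^sup>2 - 4 * \<beta>\<^sup>2 * t)" unfolding D_def Droot_def .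
    then show ?thesis using Droot_disc_nonneg[OF assms] by simp
  qed
  then have "D * D + \<beta>\<^sup>2 * t = \<theta> * D" by (simp add: power2_eq_square algebra_simps)
  moreover have "0 < D" using Droot_pos[OF assms] by (simp add: D_def)
  ultimately have "D + \<beta>\<^sup>2 * t / D = \<theta>" by (simp add: field_simps)
  then show ?thesis by (simp add: D_def)
qed

lemma Droot_antimono:
  assumes "0 < \<beta>" "t \<le> u"
  shows "Droot \<beta> \<theta> u \<le> Droot \<beta> \<theta> t"
proof -
  have "4 * \<beta>\<^sup>2 * t \<le> 4 * \<beta>\<^sup>2 * u" using assms by (intro mult_left_mono) auto
  then show ?thesis by (simp add: Droot_def)
qed

text \<open>The quartic term lies below its tangent line in |z|^2, after which the integral is
  Gaussian and the pivot bound applies. The bound holds for each disorder separately, with x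
  measuring its distance from the deterministic form, and it yields the integrability on which the
  lower bound relies.\<close>

lemma logZ_upper:
  assumes N: "0 < N" and \<beta>: "0 < \<beta>" and \<theta>: "\<theta> = 1 - lam + \<beta>\<^sup>2 * \<rho>" "2 * \<beta> \<le> \<theta>"
    and q: "q \<in> borel_measurable (gaussN N)"
    and le: "\<And>z. q z \<le> Hdet N \<beta> z + 2 * x * (\<Sum>k<N. (z k)\<^sup>2)"
  shows "integrable (gaussN N) (\<lambda>z. exp (q z + phi N \<beta> lam (\<Sum>k<N. (z k)\<^sup>2)))"
    and "logZ N (phi N \<beta> lam) q
      \<le> real N * \<beta>\<^sup>2 * (\<rho> + 4 * x / \<beta>\<^sup>2)\<^sup>2 / 4 - (\<Sum>k<N. ln (Droot \<beta> \<theta> (real k / real N))) / 2"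
proof -
  define d where "d k = Droot \<beta> \<theta> (real k / real N)" for k
  \<comment> \<open>The point of tangency is raised so that the extra slope, beta^2 / 2 times 4 x /
    beta^2 = 2 x, absorbs the error 2 x |z|^2. The quadratic form then keeps the parameter theta
    that belongs to rho.\<close>
  define \<rho>' where "\<rho>' = \<rho> + 4 * x / \<beta>\<^sup>2"
  define C where "C = real N * \<beta>\<^sup>2 * \<rho>'\<^sup>2 / 4"
  have t1: "real k / real N \<le> 1" if "k < N" for k using that by simp
  have d: "0 < d k" if "k < N" for k
    unfolding d_def using Droot_pos[OF \<beta> \<theta>(2) t1[OF that]] .
  let ?f = "\<lambda>z. exp (q z + phi N \<beta> lam (\<Sum>k<N. (z k)\<^sup>2))"
  let ?g = "\<lambda>z. exp ((\<Sum>k<N. \<beta> * sqrt (real k / real N) * z k * z (k - 1)) - (\<theta> - 1) / 2 * (\<Sum>k<N. (z k)\<^sup>2))"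
  have pw: "?f z \<le> exp C * ?g z" for z
  proof -
    define S where "S = (\<Sum>k<N. (z k)\<^sup>2)"
    have "0 \<le> \<beta>\<^sup>2 / (4 * real N) * (S - real N * \<rho>')\<^sup>2" using N by simp
    also have "\<dots> = \<beta>\<^sup>2 / (4 * real N) * S\<^sup>2 - \<beta>\<^sup>2 * \<rho>' / 2 * S + C"
      using N by (simp add: C_def power2_eq_square field_simps)
    finally have "- \<beta>\<^sup>2 / (4 * real N) * S\<^sup>2 \<le> C - \<beta>\<^sup>2 * \<rho>' / 2 * S" by simp
    moreover have "\<beta>\<^sup>2 * \<rho>' / 2 * S = \<beta>\<^sup>2 * \<rho> / 2 * S + 2 * x * S"
      using \<beta> by (simp add: \<rho>'_def field_simps)
    moreover have "(\<theta> - 1) / 2 * S = \<beta>\<^sup>2 * \<rho> / 2 * S - lam / 2 * S"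
      by (simp add: \<theta> field_simps)
    ultimately have "q z + phi N \<beta> lam S \<le> C + (Hdet N \<beta> z - (\<theta> - 1) / 2 * S)"
      using le[of z] unfolding phi_def S_def[symmetric] by linarith
    then show ?thesis
      by (simp add: S_def[symmetric] Hdet_def mult_exp_exp)
  qed
  have [measurable]: "(\<lambda>z. z (k - 1)) \<in> borel_measurable (gaussN N)" if "k \<in> {..<N}" for k
    using that by (intro gaussN_component_measurable) auto
  have gm: "?g \<in> borel_measurable (gaussN N)" by measurable
  have fm: "?f \<in> borel_measurable (gaussN N)"
    unfolding phi_def using q by measurable
  have gi: "(\<integral>\<^sup>+z. ennreal (?g z) \<partial>gaussN N) \<le> ennreal (\<Prod>k<N. 1 / sqrt (d k))"
  proof (rule tridiagonal_gaussian_bound[OF d])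
    fix k assume k: "k < N"
    show "d k + (if k = 0 then 0 else (\<beta> * sqrt (real k / real N))\<^sup>2 / d (k - 1)) \<le> \<theta>"
    proof -
      have "(if k = 0 then 0 else (\<beta> * sqrt (real k / real N))\<^sup>2 / d (k - 1)) \<le> \<beta>\<^sup>2 * (real k / real N) / d k"
      proof (cases "k = 0")
        case False
        \<comment> \<open>The recursion involves the previous pivot, which is larger; replacing it
          by the current one only increases the quotient, and then the quadratic equation holds
          exactly.\<close>
        have "d k \<le> d (k - 1)"
          unfolding d_def using N by (intro Droot_antimono[OF \<beta>] divide_right_mono) auto
        then have "\<beta>\<^sup>2 * (real k / real N) / d (k - 1) \<le> \<beta>\<^sup>2 * (real k / real N) / d k"
          using d[OF k] d[of "k - 1"] k by (intro divide_left_mono) auto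
        then show ?thesis using False by (simp add: power_mult_distrib)
      qed simp
      then show ?thesis
        using Droot_eq[OF \<beta> \<theta>(2) t1[OF k]] by (simp add: d_def)
    qed
  qed auto
  have gint: "integrable (gaussN N) ?g"
    using gm by (rule integrableI_nonneg) (use le_less_trans[OF gi] in auto)
  show fint: "integrable (gaussN N) ?f"
    by (rule Bochner_Integration.integrable_bound[OF integrable_mult_right[OF gint, of "exp C"] fm])
      (use pw in auto)
  have "(\<integral>z. ?f z \<partial>gaussN N) \<le> (\<integral>z. exp C * ?g z \<partial>gaussN N)"
    by (rule integral_mono[OF fint integrable_mult_right[OF gint]]) (use pw in auto)
  also have "\<dots> = exp C * (\<integral>z. ?g z \<partial>gaussN N)" by simp
  also have "(\<integral>z. ?g z \<partial>gaussN N) \<le> (\<Prod>k<N. 1 / sqrt (d k))"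
  proof -
    have "ennreal (\<integral>z. ?g z \<partial>gaussN N) \<le> ennreal (\<Prod>k<N. 1 / sqrt (d k))"
    proof -
      have "(\<integral>\<^sup>+z. ennreal (?g z) \<partial>gaussN N) = ennreal (\<integral>z. ?g z \<partial>gaussN N)"
        by (rule nn_integral_eq_integral[OF gint]) simp
      then show ?thesis using gi by (simp only:)
    qed
    moreover have "0 \<le> (\<Prod>k<N. 1 / sqrt (d k))" using d by (intro prod_nonneg) (auto simp: less_imp_le)
    ultimately show ?thesis by (simp add: ennreal_le_iff)
  qed
  finally have "(\<integral>z. ?f z \<partial>gaussN N) \<le> exp C * (\<Prod>k<N. 1 / sqrt (d k))" by simp
  then have "ln (\<integral>z. ?f z \<partial>gaussN N) \<le> ln (exp C * (\<Prod>k<N. 1 / sqrt (d k)))"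
    using integral_exp_pos[OF prob_space_gaussN fint] by (simp add: ln_mono)
  also have "\<dots> = C + (\<Sum>k<N. ln (1 / sqrt (d k)))"
  proof -
    have "0 < (\<Prod>k<N. 1 / sqrt (d k))" using d by (intro prod_pos) auto
    moreover have "ln (\<Prod>k<N. 1 / sqrt (d k)) = (\<Sum>k<N. ln (1 / sqrt (d k)))"
    proof (rule ln_prod)
      fix i assume "i \<in> {..<N}"
      then show "1 / sqrt (d i) \<noteq> 0" using d[of i] by simp
    qed simp
    ultimately show ?thesis by (simp only: ln_mult_pos exp_gt_zero ln_exp)
  qed
  also have "(\<Sum>k<N. ln (1 / sqrt (d k))) = - (\<Sum>k<N. ln (d k)) / 2"
    unfolding sum_divide_distrib sum_negf[symmetric]
  proof (rule sum.cong[OF refl])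
    fix i assume "i \<in> {..<N}"
    then show "ln (1 / sqrt (d i)) = - ln (d i) / 2" using d[of i] by (simp add: ln_div ln_sqrt)
  qed
  finally show "logZ N (phi N \<beta> lam) q
      \<le> real N * \<beta>\<^sup>2 * (\<rho> + 4 * x / \<beta>\<^sup>2)\<^sup>2 / 4 - (\<Sum>k<N. ln (Droot \<beta> \<theta> (real k / real N))) / 2"
    unfolding logZ_def C_def \<rho>'_def d_def by simp
qed

section \<open>Lower bound by a Gaussian trial measure\<close>

text \<open>Membership in all \<open>L\<^sup>p\<close> spaces: a class containing the coordinates and closed under products.\<close>

definition polyint :: "'a measure \<Rightarrow> ('a \<Rightarrow> real) \<Rightarrow> bool" where
  "polyint M f \<longleftrightarrow> f \<in> borel_measurable M \<and> (\<forall>p::nat. integrable M (\<lambda>x. \<bar>f x\<bar> ^ p))"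

lemma polyint_integrable: "polyint M f \<Longrightarrow> integrable M f"
proof -
  assume f: "polyint M f"
  then have "integrable M (\<lambda>x. \<bar>f x\<bar> ^ 1)" unfolding polyint_def by blast
  then show "integrable M f" using f by (simp add: polyint_def integrable_abs_iff)
qed

lemma polyint_const: "finite_measure M \<Longrightarrow> polyint M (\<lambda>_. c)"
  by (simp add: polyint_def finite_measure.integrable_const)

lemma polyint_mult:
  assumes f: "polyint M f" and g: "polyint M g"
  shows "polyint M (\<lambda>x. f x * g x)"
  unfolding polyint_def
proof (intro conjI allI)
  have m: "f \<in> borel_measurable M" "g \<in> borel_measurable M" using f g by (auto simp: polyint_def)
  then show "(\<lambda>x. f x * g x) \<in> borel_measurable M" by simp
  fix p :: nat
  have i: "integrable M (\<lambda>x. \<bar>f x\<bar> ^ (2 * p) + \<bar>g x\<bar> ^ (2 * p))"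
    using f g unfolding polyint_def by (intro Bochner_Integration.integrable_add) auto
  show "integrable M (\<lambda>x. \<bar>f x * g x\<bar> ^ p)"
  proof (rule Bochner_Integration.integrable_bound[OF i])
    show "(\<lambda>x. \<bar>f x * g x\<bar> ^ p) \<in> borel_measurable M" using m by simp
    show "AE x in M. norm (\<bar>f x * g x\<bar> ^ p) \<le> norm (\<bar>f x\<bar> ^ (2 * p) + \<bar>g x\<bar> ^ (2 * p))"
    proof (intro AE_I2)
      fix x
      define a b where "a = \<bar>f x\<bar> ^ p" and "b = \<bar>g x\<bar> ^ p"
      have "a * b \<le> a\<^sup>2 + b\<^sup>2"
      proof -
        have "0 \<le> a * b" by (simp add: a_def b_def)
        moreover have "2 * a * b \<le> a\<^sup>2 + b\<^sup>2" by (rule sum_squares_bound)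
        ultimately show ?thesis by simp
      qed
      then show "norm (\<bar>f x * g x\<bar> ^ p) \<le> norm (\<bar>f x\<bar> ^ (2 * p) + \<bar>g x\<bar> ^ (2 * p))"
        by (simp add: a_def b_def abs_mult power_mult_distrib power_mult[symmetric] mult.commute[of 2])
    qed
  qed
qed

lemma polyint_add:
  assumes f: "polyint M f" and g: "polyint M g"
  shows "polyint M (\<lambda>x. f x + g x)"
  unfolding polyint_def
proof (intro conjI allI)
  have m: "f \<in> borel_measurable M" "g \<in> borel_measurable M" using f g by (auto simp: polyint_def)
  then show "(\<lambda>x. f x + g x) \<in> borel_measurable M" by simp
  fix p :: nat
  have i: "integrable M (\<lambda>x. 2 ^ p * (\<bar>f x\<bar> ^ p + \<bar>g x\<bar> ^ p))"
    using f g unfolding polyint_def by (intro integrable_mult_right Bochner_Integration.integrable_add) auto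
  show "integrable M (\<lambda>x. \<bar>f x + g x\<bar> ^ p)"
  proof (rule Bochner_Integration.integrable_bound[OF i])
    show "(\<lambda>x. \<bar>f x + g x\<bar> ^ p) \<in> borel_measurable M" using m by simp
    show "AE x in M. norm (\<bar>f x + g x\<bar> ^ p) \<le> norm (2 ^ p * (\<bar>f x\<bar> ^ p + \<bar>g x\<bar> ^ p))"
    proof (intro AE_I2)
      fix x
      have "\<bar>f x + g x\<bar> ^ p \<le> (2 * max \<bar>f x\<bar> \<bar>g x\<bar>) ^ p" by (intro power_mono) auto
      also have "\<dots> = 2 ^ p * max \<bar>f x\<bar> \<bar>g x\<bar> ^ p" by (simp add: power_mult_distrib)
      also have "\<dots> \<le> 2 ^ p * (\<bar>f x\<bar> ^ p + \<bar>g x\<bar> ^ p)"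
        by (intro mult_left_mono) (auto simp: max_def)
      finally show "norm (\<bar>f x + g x\<bar> ^ p) \<le> norm (2 ^ p * (\<bar>f x\<bar> ^ p + \<bar>g x\<bar> ^ p))" by simp
    qed
  qed
qed

lemma polyint_uminus: "polyint M f \<Longrightarrow> polyint M (\<lambda>x. - f x)"
  by (simp add: polyint_def)

lemma polyint_diff: "polyint M f \<Longrightarrow> polyint M g \<Longrightarrow> polyint M (\<lambda>x. f x - g x)"
  using polyint_add[OF _ polyint_uminus, of M f g] by simp

lemma polyint_power: "finite_measure M \<Longrightarrow> polyint M f \<Longrightarrow> polyint M (\<lambda>x. f x ^ p)"
  by (induction p) (auto intro: polyint_const polyint_mult)

lemma polyint_sum:
  "finite_measure M \<Longrightarrow> (\<And>i. i \<in> A \<Longrightarrow> polyint M (f i)) \<Longrightarrow> polyint M (\<lambda>x. \<Sum>i\<in>A. f i x)"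
  by (induction A rule: infinite_finite_induct) (auto intro: polyint_const polyint_add)

section \<open>Polynomial moments of the Gaussian product\<close>

lemma integrable_gauss1_power_abs: "integrable gauss1 (\<lambda>x. \<bar>x\<bar> ^ p)"
  unfolding gauss1_def by (subst integrable_density) (auto intro: integrable_std_normal_moment_abs)

lemma integrable_gauss1_power: "integrable gauss1 (\<lambda>x. x ^ p)"
  unfolding gauss1_def by (subst integrable_density) (auto intro: integrable_std_normal_moment)

lemma gauss1_moment: "(\<integral>x. x ^ p \<partial>gauss1) = (\<integral>x. std_normal_density x * x ^ p \<partial>lborel)"
  unfolding gauss1_def by (subst integral_density) auto

lemma gauss1_moments:
  "(\<integral>x. x \<partial>gauss1) = 0" "(\<integral>x. x ^ 2 \<partial>gauss1) = 1"
  "(\<integral>x. x ^ 3 \<partial>gauss1) = 0" "(\<integral>x. x ^ 4 \<partial>gauss1) = 3"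
  using gauss1_moment[of 1] integral_std_normal_moment_odd[of 0]
    gauss1_moment[of 2] integral_std_normal_moment_even[of 1]
    gauss1_moment[of 3] integral_std_normal_moment_odd[of 1]
    gauss1_moment[of 4] integral_std_normal_moment_even[of 2]
  by (simp_all add: numeral_eq_Suc fact_numeral)

lemma gauss1_integral_quartic:
  "(\<integral>y. a + b * y + c * y ^ 2 + d * y ^ 3 + e * y ^ 4 \<partial>gauss1) = a + c + 3 * e"
proof -
  interpret prob_space gauss1 by (rule prob_space_gauss1)
  have i: "integrable gauss1 (\<lambda>y. b * y)" "integrable gauss1 (\<lambda>y. c * y ^ 2)"
    "integrable gauss1 (\<lambda>y. d * y ^ 3)" "integrable gauss1 (\<lambda>y. e * y ^ 4)"
    using integrable_gauss1_power[of 1] by (auto intro!: integrable_gauss1_power)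
  have "prob UNIV = 1" using prob_space by simp
  with i show ?thesis by (simp add: gauss1_moments)
qed

lemma finite_measure_gaussN: "finite_measure (gaussN n)"
  using prob_space_gaussN[of n] by (simp add: prob_space_def)

lemma polyint_gaussPi_coordinate:
  assumes "finite I" "k \<in> I"
  shows "polyint (gaussPi I) (\<lambda>g. g k)"
  unfolding polyint_def
proof (intro conjI allI)
  show "(\<lambda>g. g k) \<in> borel_measurable (gaussPi I)"
    using assms measurable_component_singleton[of k I "\<lambda>_. gauss1"] by (simp cong: measurable_cong_sets)
  fix p
  have "integrable (gaussPi I) (\<lambda>x. \<Prod>i\<in>I. (if i = k then \<bar>x i\<bar> ^ p else 1))"
  proof (intro gaussP.product_integrable_prod)
    fix i
    show "integrable gauss1 (\<lambda>a. if i = k then \<bar>a\<bar> ^ p else 1)"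
      using prob_space_gauss1 integrable_gauss1_power_abs
      by (cases "i = k") (auto simp: prob_space_def intro: finite_measure.integrable_const)
  qed (use assms in auto)
  then show "integrable (gaussPi I) (\<lambda>x. \<bar>x k\<bar> ^ p)"
    using assms by (simp add: prod.delta)
qed

lemma polyint_coordinate: "k < n \<Longrightarrow> polyint (gaussN n) (\<lambda>g. g k)"
  unfolding gaussN_eq by (rule polyint_gaussPi_coordinate) auto

lemma polyint_xi: "k < n \<Longrightarrow> polyint (gaussN n) (\<lambda>g. xi r s g k)"
  by (induction k) (auto intro!: polyint_add polyint_mult polyint_const polyint_coordinate finite_measure_gaussN)

lemmas polyint_intros = polyint_add polyint_mult polyint_const polyint_diff polyint_uminus
  polyint_power polyint_sum polyint_coordinate polyint_xi finite_measure_gaussN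

text \<open>Integrating out the last noise. Every moment up to the variance of the squared norm has
  degree at most 4 in it, so only the coefficients of degree 0, 2 and 4 survive, with weights 1, 1
  and 3.\<close>

lemma integral_gaussN_Suc:
  fixes A B C D E :: "(nat \<Rightarrow> real) \<Rightarrow> real"
  assumes F: "polyint (gaussN (Suc n)) F"
    and upd: "\<And>g y. F (g(n := y)) = A g + B g * y + C g * y ^ 2 + D g * y ^ 3 + E g * y ^ 4"
    and A: "polyint (gaussN n) A" and C: "polyint (gaussN n) C" and E: "polyint (gaussN n) E"
  shows "(\<integral>g. F g \<partial>gaussN (Suc n)) = (\<integral>g. A g \<partial>gaussN n) + (\<integral>g. C g \<partial>gaussN n) + 3 * (\<integral>g. E g \<partial>gaussN n)"
proof -
  have ins: "{..<Suc n} = insert n {..<n}" by auto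
  have "(\<integral>g. F g \<partial>gaussN (Suc n)) = (\<integral>g. (\<integral>y. F (g(n := y)) \<partial>gauss1) \<partial>gaussN n)"
    unfolding gaussN_eq ins
    by (rule gaussP.product_integral_insert) (use polyint_integrable[OF F] in \<open>auto simp: gaussN_eq ins\<close>)
  also have "\<dots> = (\<integral>g. A g + C g + 3 * E g \<partial>gaussN n)"
    unfolding upd gauss1_integral_quartic ..
  also have "\<dots> = (\<integral>g. A g \<partial>gaussN n) + (\<integral>g. C g \<partial>gaussN n) + 3 * (\<integral>g. E g \<partial>gaussN n)"
    using polyint_integrable[OF A] polyint_integrable[OF C] polyint_integrable[OF E] by simp
  finally show ?thesis .
qed

lemma integral_gaussN_Suc_const:
  assumes F: "polyint (gaussN (Suc n)) F" and F': "polyint (gaussN n) F"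
    and upd: "\<And>g y. F (g(n := y)) = F g"
  shows "(\<integral>g. F g \<partial>gaussN (Suc n)) = (\<integral>g. F g \<partial>gaussN n)"
  using integral_gaussN_Suc[OF F, of F "\<lambda>_. 0" "\<lambda>_. 0" "\<lambda>_. 0" "\<lambda>_. 0"] F'
  by (simp add: upd polyint_const finite_measure_gaussN)

section \<open>Moments of the chain and of its squared norm\<close>

definition xprev :: "(nat \<Rightarrow> real) \<Rightarrow> (nat \<Rightarrow> real) \<Rightarrow> nat \<Rightarrow> (nat \<Rightarrow> real) \<Rightarrow> real" where
  "xprev r s n g = (if n = 0 then 0 else xi r s g (n - 1))"

text \<open>The variance of \<open>xprev\<close>. Both are indexed by the step about to be made,
  with state 0 before the first one, so that all moment recursions start from zero and
  \<open>r 0\<close> multiplies a zero.\<close>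

primrec vprev :: "(nat \<Rightarrow> real) \<Rightarrow> (nat \<Rightarrow> real) \<Rightarrow> nat \<Rightarrow> real" where
  "vprev r s 0 = 0"
| "vprev r s (Suc n) = (r n)\<^sup>2 * vprev r s n + (s n)\<^sup>2"

text \<open>The fluctuation of the squared norm of the shifted chain; \<open>cov_lin\<close>, \<open>cov_sq\<close> and \<open>Uvar\<close> are its covariances
  with the last coordinate and with its square, and its variance.\<close>

definition Xfluc :: "(nat \<Rightarrow> real) \<Rightarrow> (nat \<Rightarrow> real) \<Rightarrow> (nat \<Rightarrow> real) \<Rightarrow> nat \<Rightarrow> (nat \<Rightarrow> real) \<Rightarrow> real" where
  "Xfluc m r s n g = (\<Sum>k<n. 2 * m k * xi r s g k + (xi r s g k)\<^sup>2 - vprev r s (Suc k))"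

primrec cov_lin :: "(nat \<Rightarrow> real) \<Rightarrow> (nat \<Rightarrow> real) \<Rightarrow> (nat \<Rightarrow> real) \<Rightarrow> nat \<Rightarrow> real" where
  "cov_lin m r s 0 = 0"
| "cov_lin m r s (Suc n) = r n * cov_lin m r s n + 2 * m n * vprev r s (Suc n)"

primrec cov_sq :: "(nat \<Rightarrow> real) \<Rightarrow> (nat \<Rightarrow> real) \<Rightarrow> nat \<Rightarrow> real" where
  "cov_sq r s 0 = 0"
| "cov_sq r s (Suc n) = (r n)\<^sup>2 * cov_sq r s n + 2 * (vprev r s (Suc n))\<^sup>2"

primrec Uvar :: "(nat \<Rightarrow> real) \<Rightarrow> (nat \<Rightarrow> real) \<Rightarrow> (nat \<Rightarrow> real) \<Rightarrow> nat \<Rightarrow> real" where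
  "Uvar m r s 0 = 0"
| "Uvar m r s (Suc n) = Uvar m r s n + 4 * m n * r n * cov_lin m r s n + 2 * (r n)\<^sup>2 * cov_sq r s n
     + 4 * (m n)\<^sup>2 * vprev r s (Suc n) + 2 * (vprev r s (Suc n))\<^sup>2"

lemma xprev_upd [simp]: "xprev r s n (g(n := y)) = xprev r s n g"
  by (auto simp: xprev_def)

lemma Xfluc_upd [simp]: "Xfluc m r s n (g(n := y)) = Xfluc m r s n g"
  by (auto simp: Xfluc_def intro!: sum.cong)

lemma xi_xprev: "xi r s g n = r n * xprev r s n g + s n * g n"
  by (cases n) (auto simp: xprev_def xi_rec[of r s g 0])

lemma polyint_xprev: "n \<le> k \<Longrightarrow> polyint (gaussN k) (xprev r s n)"
  by (cases n) (auto simp: xprev_def[abs_def] intro!: polyint_intros)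

lemma polyint_Xfluc: "n \<le> k \<Longrightarrow> polyint (gaussN k) (Xfluc m r s n)"
  unfolding Xfluc_def[abs_def] by (auto intro!: polyint_intros)

lemma Xfluc_Suc: "Xfluc m r s (Suc n) g
  = Xfluc m r s n g + (2 * m n * xi r s g n + (xi r s g n)\<^sup>2 - vprev r s (Suc n))"
  by (simp add: Xfluc_def)

text \<open>The new state is r times the old one plus s times a fresh noise that is independent of
  the old state and of Y. Expanding the power, only the even powers of the fresh noise
  survive.\<close>

lemma xi_moments_step:
  fixes r s :: "nat \<Rightarrow> real"
  assumes "polyint (gaussN n) Y" "polyint (gaussN (Suc n)) Y" "\<And>g y. Y (g(n := y)) = Y g"
  defines "p \<equiv> xprev r s n"
  shows "(\<integral>g. xi r s g n * Y g \<partial>gaussN (Suc n)) = r n * (\<integral>g. p g * Y g \<partial>gaussN n)"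
    and "(\<integral>g. xi r s g n ^ 2 * Y g \<partial>gaussN (Suc n))
      = (r n)\<^sup>2 * (\<integral>g. p g ^ 2 * Y g \<partial>gaussN n) + (s n)\<^sup>2 * (\<integral>g. Y g \<partial>gaussN n)"
    and "(\<integral>g. xi r s g n ^ 3 * Y g \<partial>gaussN (Suc n))
      = r n ^ 3 * (\<integral>g. p g ^ 3 * Y g \<partial>gaussN n) + 3 * r n * (s n)\<^sup>2 * (\<integral>g. p g * Y g \<partial>gaussN n)"
    and "(\<integral>g. xi r s g n ^ 4 * Y g \<partial>gaussN (Suc n))
      = r n ^ 4 * (\<integral>g. p g ^ 4 * Y g \<partial>gaussN n) + 6 * (r n)\<^sup>2 * (s n)\<^sup>2 * (\<integral>g. p g ^ 2 * Y g \<partial>gaussN n)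
        + 3 * s n ^ 4 * (\<integral>g. Y g \<partial>gaussN n)"
proof -
  have p: "polyint (gaussN n) p" "polyint (gaussN (Suc n)) p"
    unfolding p_def by (auto intro: polyint_xprev)
  have pu: "p (g(n := y)) = p g" for g y by (simp add: p_def)
  have x: "xi r s (g(n := y)) n = r n * p g + s n * y" for g y
    unfolding xi_xprev p_def by simp
  have fm: "finite_measure (gaussN n)" "finite_measure (gaussN (Suc n))" by (rule finite_measure_gaussN)+
  note I = polyint_intros p assms(1,2)
  have "(\<integral>g. xi r s g n * Y g \<partial>gaussN (Suc n)) = (\<integral>g. r n * (p g * Y g) \<partial>gaussN n)
      + (\<integral>g. 0 \<partial>gaussN n) + 3 * (\<integral>g. 0 \<partial>gaussN n)"
    by (rule integral_gaussN_Suc[where B = "\<lambda>g. s n * Y g" and D = "\<lambda>_. 0"])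
      (auto intro!: I simp: x assms(3) algebra_simps)
  then show "(\<integral>g. xi r s g n * Y g \<partial>gaussN (Suc n)) = r n * (\<integral>g. p g * Y g \<partial>gaussN n)" by simp
  have "(\<integral>g. xi r s g n ^ 2 * Y g \<partial>gaussN (Suc n)) = (\<integral>g. (r n)\<^sup>2 * (p g ^ 2 * Y g) \<partial>gaussN n)
      + (\<integral>g. (s n)\<^sup>2 * Y g \<partial>gaussN n) + 3 * (\<integral>g. 0 \<partial>gaussN n)"
    by (rule integral_gaussN_Suc[where B = "\<lambda>g. 2 * r n * s n * p g * Y g" and D = "\<lambda>_. 0"])
      (auto intro!: I simp: x assms(3) algebra_simps power2_eq_square)
  then show "(\<integral>g. xi r s g n ^ 2 * Y g \<partial>gaussN (Suc n))
      = (r n)\<^sup>2 * (\<integral>g. p g ^ 2 * Y g \<partial>gaussN n) + (s n)\<^sup>2 * (\<integral>g. Y g \<partial>gaussN n)" by simp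
  have "(\<integral>g. xi r s g n ^ 3 * Y g \<partial>gaussN (Suc n)) = (\<integral>g. r n ^ 3 * (p g ^ 3 * Y g) \<partial>gaussN n)
      + (\<integral>g. 3 * r n * (s n)\<^sup>2 * (p g * Y g) \<partial>gaussN n) + 3 * (\<integral>g. 0 \<partial>gaussN n)"
    by (rule integral_gaussN_Suc[where B = "\<lambda>g. 3 * (r n)\<^sup>2 * s n * p g ^ 2 * Y g" and D = "\<lambda>g. s n ^ 3 * Y g"])
      (auto intro!: I simp: x assms(3) algebra_simps power2_eq_square power3_eq_cube)
  then show "(\<integral>g. xi r s g n ^ 3 * Y g \<partial>gaussN (Suc n))
      = r n ^ 3 * (\<integral>g. p g ^ 3 * Y g \<partial>gaussN n) + 3 * r n * (s n)\<^sup>2 * (\<integral>g. p g * Y g \<partial>gaussN n)" by simp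
  have "(\<integral>g. xi r s g n ^ 4 * Y g \<partial>gaussN (Suc n)) = (\<integral>g. r n ^ 4 * (p g ^ 4 * Y g) \<partial>gaussN n)
      + (\<integral>g. 6 * (r n)\<^sup>2 * (s n)\<^sup>2 * (p g ^ 2 * Y g) \<partial>gaussN n) + 3 * (\<integral>g. s n ^ 4 * Y g \<partial>gaussN n)"
    by (rule integral_gaussN_Suc[where B = "\<lambda>g. 4 * r n ^ 3 * s n * p g ^ 3 * Y g"
          and D = "\<lambda>g. 4 * r n * s n ^ 3 * p g * Y g"])
      (auto intro!: I simp: x assms(3) algebra_simps power2_eq_square power3_eq_cube power4_eq_xxxx)
  then show "(\<integral>g. xi r s g n ^ 4 * Y g \<partial>gaussN (Suc n))
      = r n ^ 4 * (\<integral>g. p g ^ 4 * Y g \<partial>gaussN n) + 6 * (r n)\<^sup>2 * (s n)\<^sup>2 * (\<integral>g. p g ^ 2 * Y g \<partial>gaussN n)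
        + 3 * s n ^ 4 * (\<integral>g. Y g \<partial>gaussN n)" by simp
qed

lemma xprev_Suc: "xprev r s (Suc n) g = xi r s g n"
  by (simp add: xprev_def)

text \<open>These eight moments close under one step and are proved together. Multiplying the
  increment 2 m xi + xi^2 - v of \<open>Xfluc\<close> by xi or by xi^2 is what brings in the third
  and fourth moments of the state.\<close>

lemma chain_moments:
  fixes m r s :: "nat \<Rightarrow> real"
  defines "p \<equiv> xprev r s" and "X \<equiv> Xfluc m r s"
  shows "(\<integral>g. p n g \<partial>gaussN n) = 0 \<and> (\<integral>g. p n g ^ 2 \<partial>gaussN n) = vprev r s n
    \<and> (\<integral>g. p n g ^ 3 \<partial>gaussN n) = 0 \<and> (\<integral>g. p n g ^ 4 \<partial>gaussN n) = 3 * (vprev r s n)\<^sup>2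
    \<and> (\<integral>g. X n g \<partial>gaussN n) = 0 \<and> (\<integral>g. p n g * X n g \<partial>gaussN n) = cov_lin m r s n
    \<and> (\<integral>g. p n g ^ 2 * X n g \<partial>gaussN n) = cov_sq r s n
    \<and> (\<integral>g. X n g ^ 2 \<partial>gaussN n) = Uvar m r s n"
proof (induction n)
  case 0
  then show ?case by (simp add: p_def X_def xprev_def Xfluc_def)
next
  case (Suc n)
  define x where "x g = xi r s g n" for g
  define v where "v = vprev r s (Suc n)"
  interpret G: prob_space "gaussN n" by (rule prob_space_gaussN)
  interpret G': prob_space "gaussN (Suc n)" by (rule prob_space_gaussN)
  have Xp: "polyint (gaussN n) (X n)" "polyint (gaussN (Suc n)) (X n)"
    unfolding X_def by (auto intro: polyint_Xfluc)
  have xp: "polyint (gaussN (Suc n)) x" unfolding x_def by (auto intro: polyint_intros)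
  note fm = finite_measure_gaussN[of "Suc n"]
  note xi1 = xi_moments_step[of n "\<lambda>_. 1" r s, folded x_def p_def, simplified,
      OF polyint_const[OF finite_measure_gaussN] polyint_const[OF finite_measure_gaussN]]
  note xiX = xi_moments_step[OF Xp, of r s, folded x_def p_def]
  have upd: "X n (g(n := y)) = X n g" for g y by (simp add: X_def)
  have E1: "(\<integral>g. x g \<partial>gaussN (Suc n)) = 0" using xi1(1) Suc by simp
  have E2: "(\<integral>g. x g ^ 2 \<partial>gaussN (Suc n)) = v"
    using xi1(2) Suc by (simp add: v_def G.prob_space)
  have E3: "(\<integral>g. x g ^ 3 \<partial>gaussN (Suc n)) = 0" using xi1(3) Suc by simp
  have E4: "(\<integral>g. x g ^ 4 \<partial>gaussN (Suc n)) = 3 * v\<^sup>2"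
    using xi1(4) Suc by (simp add: v_def G.prob_space power2_eq_square power4_eq_xxxx algebra_simps)
  have EX: "(\<integral>g. X n g \<partial>gaussN (Suc n)) = 0"
    using integral_gaussN_Suc_const[OF Xp(2,1)] upd Suc by simp
  have EXX: "(\<integral>g. X n g ^ 2 \<partial>gaussN (Suc n)) = Uvar m r s n"
  proof -
    have "(\<integral>g. X n g ^ 2 \<partial>gaussN (Suc n)) = (\<integral>g. X n g ^ 2 \<partial>gaussN n)"
      by (rule integral_gaussN_Suc_const) (auto intro!: polyint_power finite_measure_gaussN Xp simp: upd)
    then show ?thesis using Suc by simp
  qed
  have ExX: "(\<integral>g. x g * X n g \<partial>gaussN (Suc n)) = r n * cov_lin m r s n"
    using xiX(1) upd Suc by simp
  have Ex2X: "(\<integral>g. x g ^ 2 * X n g \<partial>gaussN (Suc n)) = (r n)\<^sup>2 * cov_sq r s n"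
    using xiX(2) upd Suc by simp
  have XS: "X (Suc n) g = X n g + (2 * m n * x g + x g ^ 2 - v)" for g
    by (simp add: X_def x_def v_def Xfluc_Suc)
  have PS: "p (Suc n) g = x g" for g by (simp add: p_def x_def xprev_Suc)
  have i: "integrable (gaussN (Suc n)) (\<lambda>g. x g ^ j)" for j
    by (intro polyint_integrable polyint_power fm xp)
  have i1: "integrable (gaussN (Suc n)) x" by (intro polyint_integrable xp)
  have iX: "integrable (gaussN (Suc n)) (\<lambda>g. x g ^ j * X n g)" for j
    by (intro polyint_integrable polyint_mult polyint_power fm xp Xp)
  have iX1: "integrable (gaussN (Suc n)) (\<lambda>g. x g * X n g)"
    by (intro polyint_integrable polyint_mult fm xp Xp)
  have iX0: "integrable (gaussN (Suc n)) (X n)" by (intro polyint_integrable Xp)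
  have iXX: "integrable (gaussN (Suc n)) (\<lambda>g. X n g ^ 2)"
    by (intro polyint_integrable polyint_power fm Xp)
  note ii = i i1 iX iX1 iX0 iXX
  have "(\<integral>g. X (Suc n) g \<partial>gaussN (Suc n)) = 0"
    unfolding XS by (simp add: ii E1 E2 EX G'.prob_space)
  moreover have "(\<integral>g. x g * X (Suc n) g \<partial>gaussN (Suc n)) = cov_lin m r s (Suc n)"
  proof -
    have "x g * X (Suc n) g = x g * X n g + 2 * m n * x g ^ 2 + x g ^ 3 - v * x g" for g
      unfolding XS by (simp add: algebra_simps power2_eq_square power3_eq_cube)
    then show ?thesis by (simp add: ii ExX E1 E2 E3 v_def)
  qed
  moreover have "(\<integral>g. x g ^ 2 * X (Suc n) g \<partial>gaussN (Suc n)) = cov_sq r s (Suc n)"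
  proof -
    have "x g ^ 2 * X (Suc n) g = x g ^ 2 * X n g + 2 * m n * x g ^ 3 + x g ^ 4 - v * x g ^ 2" for g
      unfolding XS by (simp add: algebra_simps power2_eq_square power3_eq_cube power4_eq_xxxx)
    then show ?thesis by (simp add: ii Ex2X E2 E3 E4 v_def[symmetric] del: vprev.simps)
        (simp add: power2_eq_square)
  qed
  moreover have "(\<integral>g. X (Suc n) g ^ 2 \<partial>gaussN (Suc n)) = Uvar m r s (Suc n)"
  proof -
    have "X (Suc n) g ^ 2 = X n g ^ 2 + 4 * m n * (x g * X n g) + 2 * (x g ^ 2 * X n g) - 2 * v * X n g
      + 4 * (m n)\<^sup>2 * x g ^ 2 + 4 * m n * x g ^ 3 + x g ^ 4 - 4 * m n * v * x g - 2 * v * x g ^ 2 + v\<^sup>2" for g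
      unfolding XS by (simp add: algebra_simps power2_eq_square power3_eq_cube power4_eq_xxxx)
    then show ?thesis
      by (simp add: ii EX EXX ExX Ex2X E1 E2 E3 E4 v_def[symmetric] G'.prob_space del: vprev.simps)
        (simp add: power2_eq_square algebra_simps)
  qed
  ultimately show ?case
    unfolding PS using E1 E2 E3 E4 by (simp add: v_def)
qed

lemma vprev_nonneg: "0 \<le> vprev r s n"
  by (induction n) auto

text \<open>b / (1 - R) is the fixed point of the extremal recursion a |-> R a + b.\<close>

lemma affine_recursion_bound:
  fixes a R b c :: real
  assumes "0 \<le> a" "a \<le> b / (1 - R)" "0 \<le> c" "c \<le> R" "R < 1" "0 \<le> d" "d \<le> b"
  shows "0 \<le> c * a + d" "c * a + d \<le> b / (1 - R)"
proof -
  show "0 \<le> c * a + d" using assms by simp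
  have "c * a \<le> R * (b / (1 - R))" using assms by (intro mult_mono) auto
  moreover have "R * (b / (1 - R)) + b = b / (1 - R)" using assms by (simp add: field_simps)
  ultimately show "c * a + d \<le> b / (1 - R)" using assms by linarith
qed

text \<open>Because r is at most R < 1, the covariances of the fluctuation with the last coordinate
  and with its square stay bounded, so the variance grows by a bounded amount per step. A variance
  of order N costs only O(1) in the quartic term, which carries the factor 1 / N.\<close>

lemma Uvar_bound:
  fixes m r s :: "nat \<Rightarrow> real"
  assumes m: "\<And>k. k < N \<Longrightarrow> 0 \<le> m k \<and> m k \<le> M" and r: "\<And>k. k < N \<Longrightarrow> 0 \<le> r k \<and> r k \<le> R"
    and R: "R < 1" and V: "\<And>k. k < N \<Longrightarrow> vprev r s (Suc k) \<le> V"
  shows "Uvar m r s N \<le> real N * (8 * M\<^sup>2 * V / (1 - R) + 4 * V\<^sup>2 / (1 - R) + 4 * M\<^sup>2 * V + 2 * V\<^sup>2)"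
proof (cases "N = 0")
  case False
  define K where "K = 8 * M\<^sup>2 * V / (1 - R) + 4 * V\<^sup>2 / (1 - R) + 4 * M\<^sup>2 * V + 2 * V\<^sup>2"
  have "n \<le> N \<Longrightarrow> 0 \<le> cov_lin m r s n \<and> cov_lin m r s n \<le> 2 * M * V / (1 - R)
     \<and> 0 \<le> cov_sq r s n \<and> cov_sq r s n \<le> 2 * V\<^sup>2 / (1 - R) \<and> Uvar m r s n \<le> real n * K" for n
  proof (induction n)
    case 0
    have "0 \<le> M" using m[of 0] False by auto
    moreover have "0 \<le> V" using order_trans[OF vprev_nonneg V[of 0]] False by simp
    ultimately show ?case using R by simp
  next
    case (Suc n)
    then have n: "n < N" by simp
    define v where "v = vprev r s (Suc n)"
    have v: "0 \<le> v" "v \<le> V" using V[OF n] by (auto simp: v_def vprev_nonneg simp del: vprev.simps)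
    have mn: "0 \<le> m n" "m n \<le> M" and rn: "0 \<le> r n" "r n \<le> R" using m[OF n] r[OF n] by auto
    have rr: "(r n)\<^sup>2 \<le> R"
    proof -
      have "r n * r n \<le> R * 1" using rn R by (intro mult_mono) auto
      then show ?thesis by (simp add: power2_eq_square)
    qed
    have mv: "m n * v \<le> M * V" using mn v by (intro mult_mono) auto
    have vv: "v\<^sup>2 \<le> V\<^sup>2" using v by (intro power_mono) auto
    have mm: "(m n)\<^sup>2 \<le> M\<^sup>2" using mn by (intro power_mono) auto
    have mmv: "(m n)\<^sup>2 * v \<le> M\<^sup>2 * V" using mm v by (intro mult_mono) auto
    have IH: "0 \<le> cov_lin m r s n" "cov_lin m r s n \<le> 2 * M * V / (1 - R)"
     "0 \<le> cov_sq r s n" "cov_sq r s n \<le> 2 * V\<^sup>2 / (1 - R)" "Uvar m r s n \<le> real n * K"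
      using Suc by auto
    have c1: "0 \<le> cov_lin m r s (Suc n)" "cov_lin m r s (Suc n) \<le> 2 * M * V / (1 - R)"
      using affine_recursion_bound[OF IH(1,2) rn R, of "2 * m n * v"] mn v mv
      by (simp_all add: v_def del: vprev.simps)
    have c2: "0 \<le> cov_sq r s (Suc n)" "cov_sq r s (Suc n) \<le> 2 * V\<^sup>2 / (1 - R)"
      using affine_recursion_bound[OF IH(3,4) _ rr R, of "2 * v\<^sup>2"] vv
      by (simp_all add: v_def del: vprev.simps)
    have "4 * m n * r n * cov_lin m r s n \<le> 4 * M * 1 * (2 * M * V / (1 - R))"
      using mn rn R IH by (intro mult_mono) auto
    also have "\<dots> = 8 * M\<^sup>2 * V / (1 - R)" by (simp add: power2_eq_square)
    finally have t1: "4 * m n * r n * cov_lin m r s n \<le> 8 * M\<^sup>2 * V / (1 - R)" .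
    have "2 * (r n)\<^sup>2 * cov_sq r s n \<le> 2 * 1 * (2 * V\<^sup>2 / (1 - R))"
      using rr R IH by (intro mult_mono) auto
    then have t2: "2 * (r n)\<^sup>2 * cov_sq r s n \<le> 4 * V\<^sup>2 / (1 - R)" by simp
    have "Uvar m r s (Suc n) \<le> real n * K + K"
      using IH(5) t1 t2 mmv vv unfolding K_def Uvar.simps v_def[symmetric] by linarith
    then show ?case using c1 c2 by (simp add: algebra_simps del: Uvar.simps cov_lin.simps cov_sq.simps)
  qed
  then show ?thesis by (simp add: K_def)
qed simp

lemma integral_gaussN_marginal:
  assumes F: "\<And>k. n \<le> k \<Longrightarrow> polyint (gaussN k) F" and upd: "\<And>k g y. n \<le> k \<Longrightarrow> F (g(k := y)) = F g"
    and N: "n \<le> N"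
  shows "(\<integral>g. F g \<partial>gaussN N) = (\<integral>g. F g \<partial>gaussN n)"
  using N
proof (induction N rule: dec_induct)
  case (step k)
  have "(\<integral>g. F g \<partial>gaussN (Suc k)) = (\<integral>g. F g \<partial>gaussN k)"
    by (rule integral_gaussN_Suc_const) (use F upd step in auto)
  then show ?case using step by simp
qed simp

lemma integral_xi:
  assumes "k < N"
  shows "(\<integral>g. xi r s g k \<partial>gaussN N) = 0"
proof -
  have "(\<integral>g. xi r s g k \<partial>gaussN N) = (\<integral>g. xi r s g k \<partial>gaussN (Suc k))"
    by (rule integral_gaussN_marginal) (use assms in \<open>auto intro!: polyint_xi\<close>)
  then show ?thesis using chain_moments[where r = r and s = s and n = "Suc k"] by (simp add: xprev_Suc)
qed

lemma integral_xi_xi: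
  assumes "0 < k" "k < N"
  shows "(\<integral>g. xi r s g k * xi r s g (k - 1) \<partial>gaussN N) = r k * vprev r s k"
proof -
  have "(\<integral>g. xi r s g k * xi r s g (k - 1) \<partial>gaussN N) = (\<integral>g. xi r s g k * xi r s g (k - 1) \<partial>gaussN (Suc k))"
    by (rule integral_gaussN_marginal) (use assms in \<open>auto intro!: polyint_xi polyint_mult\<close>)
  also have "\<dots> = (\<integral>g. xi r s g k * xprev r s k g \<partial>gaussN (Suc k))"
    using assms by (simp add: xprev_def)
  also have "\<dots> = r k * (\<integral>g. xprev r s k g * xprev r s k g \<partial>gaussN k)"
    by (rule xi_moments_step(1)) (auto intro: polyint_xprev)
  also have "(\<integral>g. xprev r s k g * xprev r s k g \<partial>gaussN k) = vprev r s k"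
    using chain_moments[where r = r and s = s and n = k] by (simp add: power2_eq_square)
  finally show ?thesis .
qed

text \<open>White noise is itself the chain with r = 0 and s = 1, so the chain moments
  apply.\<close>

lemma integral_coordinate_square:
  assumes "k < N"
  shows "(\<integral>g. (g k)\<^sup>2 \<partial>gaussN N) = 1"
proof -
  have "(\<integral>g. (g k)\<^sup>2 \<partial>gaussN N) = (\<integral>g. xi (\<lambda>_. 0) (\<lambda>_. 1) g k * xi (\<lambda>_. 0) (\<lambda>_. 1) g k \<partial>gaussN N)"
  proof -
    have "xi (\<lambda>_. 0) (\<lambda>_. 1) g k = g k" for g :: "nat \<Rightarrow> real" by (cases k) auto
    then show ?thesis by (simp add: power2_eq_square)
  qed
  also have "\<dots> = (\<integral>g. xi (\<lambda>_. 0) (\<lambda>_. 1) g k * xi (\<lambda>_. 0) (\<lambda>_. 1) g k \<partial>gaussN (Suc k))"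
    by (rule integral_gaussN_marginal) (use assms in \<open>auto intro!: polyint_xi polyint_mult\<close>)
  also have "\<dots> = 1"
    using chain_moments[where r = "\<lambda>_. 0" and s = "\<lambda>_. 1" and n = "Suc k"] by (simp add: xprev_Suc power2_eq_square)
  finally show ?thesis .
qed

text \<open>Jensen by the tangent of exp at the mean of h0. Working with a minorant h0 means that h
  itself need not be integrated: in the application h0 is a polynomial in the noise, while h
  contains the disordered form.\<close>

lemma jensen_ln_integral_exp:
  assumes M: "prob_space M" and i: "integrable M (\<lambda>x. exp (h x :: real))" and i0: "integrable M h0"
    and le: "\<And>x. x \<in> space M \<Longrightarrow> h0 x \<le> h x"
  shows "(\<integral>x. h0 x \<partial>M) \<le> ln (\<integral>x. exp (h x) \<partial>M)"
proof -
  interpret prob_space M by fact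
  define a where "a = (\<integral>x. h0 x \<partial>M)"
  have "exp a = (\<integral>x. exp a * (1 + (h0 x - a)) \<partial>M)"
    using i0 by (simp add: a_def prob_space)
  also have "\<dots> \<le> (\<integral>x. exp (h x) \<partial>M)"
  proof (rule integral_mono[OF _ i])
    show "integrable M (\<lambda>x. exp a * (1 + (h0 x - a)))" using i0 by simp
    fix x assume "x \<in> space M"
    then have "1 + (h0 x - a) \<le> exp (h x - a)"
      using exp_ge_add_one_self[of "h0 x - a"] le[of x] exp_le_cancel_iff[of "h0 x - a" "h x - a"] by linarith
    then have "exp a * (1 + (h0 x - a)) \<le> exp a * exp (h x - a)" by simp
    then show "exp a * (1 + (h0 x - a)) \<le> exp (h x)" by (simp add: mult_exp_exp)
  qed
  finally show ?thesis
    using integral_exp_pos[OF M i] by (simp add: a_def ln_ge_iff)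
qed

text \<open>The Gibbs variational bound with the law of the shifted chain as trial measure. The
  logarithms of s and N / 2 come from the weight \<open>wchain\<close>, whose term - |z|^2 / 2 is
  merged into (1 - lam) / 2. The quartic term gives S^2 plus the variance \<open>Uvar\<close>,
  because |z|^2 = S + X with X centred.\<close>

lemma logZ_lower:
  fixes m r s :: "nat \<Rightarrow> real" and q :: "(nat \<Rightarrow> real) \<Rightarrow> real"
  assumes N: "0 < N" and s: "\<And>k. k < N \<Longrightarrow> 0 < s k"
    and q: "q \<in> borel_measurable (gaussN N)"
    and int: "integrable (gaussN N) (\<lambda>z. exp (q z + phi N \<beta> lam (\<Sum>k<N. (z k)\<^sup>2)))"
    and ge: "\<And>z. Hdet N \<beta> z - 2 * x * (\<Sum>k<N. (z k)\<^sup>2) \<le> q z"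
  defines "S \<equiv> (\<Sum>k<N. (m k)\<^sup>2 + vprev r s (Suc k))"
  shows "(\<Sum>k<N. ln (s k)) + real N / 2 + (\<Sum>k<N. \<beta> * sqrt (real k / real N) * (m k * m (k - 1) + r k * vprev r s k))
      - ((1 - lam) / 2 + 2 * x) * S - \<beta>\<^sup>2 / (4 * real N) * (S\<^sup>2 + Uvar m r s N)
    \<le> logZ N (phi N \<beta> lam) q"
proof -
  let ?z = "\<lambda>g. zchain N m r s g"
  let ?f = "\<lambda>z. exp (q z + phi N \<beta> lam (\<Sum>k<N. (z k)\<^sup>2))"
  define X where "X = Xfluc m r s N"
  define B where "B g = (\<Sum>k<N. (g k)\<^sup>2) / 2" for g :: "nat \<Rightarrow> real"
  define L where "L = (\<Sum>k<N. ln (s k))"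
  define h where "h g = q (?z g) + phi N \<beta> lam (\<Sum>k<N. (?z g k)\<^sup>2) + L - (\<Sum>k<N. (?z g k)\<^sup>2) / 2 + B g" for g
  define h0 where "h0 g = (\<Sum>k<N. \<beta> * sqrt (real k / real N) * ((m k + xi r s g k) * (m (k - 1) + xi r s g (k - 1))))
      - 2 * x * (S + X g) + phi N \<beta> lam (S + X g) + L - (S + X g) / 2 + B g" for g
  have zk: "?z g k = m k + xi r s g k" if "k < N" for g k using that by (simp add: zchain_def)
  have zz: "(\<Sum>k<N. (?z g k)\<^sup>2) = S + X g" for g
  proof -
    have "(\<Sum>k<N. (?z g k)\<^sup>2) = (\<Sum>k<N. (m k)\<^sup>2 + vprev r s (Suc k)
        + (2 * m k * xi r s g k + (xi r s g k)\<^sup>2 - vprev r s (Suc k)))"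
      by (rule sum.cong) (auto simp: zk power2_sum)
    also have "\<dots> = S + X g" by (simp only: sum.distrib S_def X_def Xfluc_def)
    finally show ?thesis .
  qed
  have zz': "(\<Sum>k<N. (m k + xi r s g k)\<^sup>2) = S + X g" for g
    unfolding zz[symmetric] by (rule sum.cong) (auto simp: zk)
  have h0h: "h0 g \<le> h g" for g
  proof -
    have "Hdet N \<beta> (?z g)
      = (\<Sum>k<N. \<beta> * sqrt (real k / real N) * ((m k + xi r s g k) * (m (k - 1) + xi r s g (k - 1))))"
      unfolding Hdet_def by (rule sum.cong) (auto simp: zk)
    then show ?thesis using ge[of "?z g"] unfolding h_def h0_def zz by simp
  qed
  have w: "wchain N m r s g = exp (L - (\<Sum>k<N. (?z g k)\<^sup>2) / 2 + B g)" for g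
  proof -
    have pe: "(\<Prod>k<N. s k) = exp L"
      unfolding L_def by (subst exp_sum) (auto simp: s intro!: prod.cong)
    show ?thesis
      unfolding wchain_def B_def zz zz' pe mult_exp_exp by (rule arg_cong[of _ _ exp]) linarith
  qed
  have fw: "?f (?z g) * wchain N m r s g = exp (h g)" for g
    unfolding w h_def by (simp add: mult_exp_exp algebra_simps)
  have eq: "(\<integral>z. ?f z \<partial>gaussN N) = (\<integral>g. exp (h g) \<partial>gaussN N)"
  proof -
    have "(\<integral>z. ?f z \<partial>gaussN N) = (\<integral>g. ?f (?z g) * wchain N m r s g \<partial>gaussN N)"
      by (rule integral_gaussN_chain) (use s borel_measurable_integrable[OF int] in auto)
    then show ?thesis by (simp only: fw)
  qed
  \<comment> \<open>Its integral equals the positive integral of the original integrand, whereas a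
    non-integrable function would have integral 0.\<close>
  have inth: "integrable (gaussN N) (\<lambda>g. exp (h g))"
    using integral_exp_pos[OF prob_space_gaussN int] not_integrable_integral_eq[of "gaussN N" "\<lambda>g. exp (h g)"]
    unfolding eq by force
  have Xi: "polyint (gaussN N) X" unfolding X_def by (rule polyint_Xfluc) simp
  have xip: "polyint (gaussN N) (\<lambda>g. xi r s g k)" if "k < N" for k using that by (rule polyint_xi)
  have xip': "polyint (gaussN N) (\<lambda>g. xi r s g (k - 1))" if "k < N" for k using that by (intro polyint_xi) auto
  have Bi: "polyint (gaussN N) B"
    unfolding B_def[abs_def] divide_inverse by (intro polyint_intros) auto
  interpret prob_space "gaussN N" by (rule prob_space_gaussN)
  have Ei: "polyint (gaussN N) (\<lambda>g. \<Sum>k<N. \<beta> * sqrt (real k / real N) * ((m k + xi r s g k) * (m (k - 1) + xi r s g (k - 1))))"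
    by (intro polyint_sum polyint_mult polyint_const finite_measure_gaussN polyint_add xip xip') auto
  have EX: "(\<integral>g. X g \<partial>gaussN N) = 0" "(\<integral>g. (X g)\<^sup>2 \<partial>gaussN N) = Uvar m r s N"
    using chain_moments[where r = r and s = s and n = N and m = m] by (auto simp: X_def)
  have EB: "(\<integral>g. B g \<partial>gaussN N) = real N / 2"
  proof -
    have "(\<integral>g. (\<Sum>k<N. (g k)\<^sup>2) \<partial>gaussN N) = (\<Sum>k<N. (\<integral>g. (g k)\<^sup>2 \<partial>gaussN N))"
      by (rule Bochner_Integration.integral_sum)
        (auto intro!: polyint_integrable polyint_power finite_measure_gaussN polyint_coordinate)
    also have "\<dots> = real N" by (simp add: integral_coordinate_square)
    finally show ?thesis by (simp add: B_def)
  qed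
  have EE: "(\<integral>g. (\<Sum>k<N. \<beta> * sqrt (real k / real N) * ((m k + xi r s g k) * (m (k - 1) + xi r s g (k - 1)))) \<partial>gaussN N)
     = (\<Sum>k<N. \<beta> * sqrt (real k / real N) * (m k * m (k - 1) + r k * vprev r s k))"
  proof -
    have "(\<integral>g. (\<Sum>k<N. \<beta> * sqrt (real k / real N) * ((m k + xi r s g k) * (m (k - 1) + xi r s g (k - 1)))) \<partial>gaussN N)
      = (\<Sum>k<N. (\<integral>g. \<beta> * sqrt (real k / real N) * ((m k + xi r s g k) * (m (k - 1) + xi r s g (k - 1))) \<partial>gaussN N))"
      by (rule Bochner_Integration.integral_sum, rule polyint_integrable)
        (intro polyint_mult polyint_const finite_measure_gaussN polyint_add xip xip', auto)
    also have "\<dots> = (\<Sum>k<N. \<beta> * sqrt (real k / real N) * (m k * m (k - 1) + r k * vprev r s k))"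
    proof (rule sum.cong[OF refl])
      fix k assume "k \<in> {..<N}"
      then have k: "k < N" by simp
      show "(\<integral>g. \<beta> * sqrt (real k / real N) * ((m k + xi r s g k) * (m (k - 1) + xi r s g (k - 1))) \<partial>gaussN N)
        = \<beta> * sqrt (real k / real N) * (m k * m (k - 1) + r k * vprev r s k)"
      proof (cases "k = 0")
        case False
        have i: "integrable (gaussN N) (\<lambda>g. xi r s g k)" "integrable (gaussN N) (\<lambda>g. xi r s g (k - 1))"
          "integrable (gaussN N) (\<lambda>g. xi r s g k * xi r s g (k - 1))"
          using xip[OF k] xip'[OF k] by (auto intro!: polyint_integrable polyint_mult)
        have "(\<integral>g. (m k + xi r s g k) * (m (k - 1) + xi r s g (k - 1)) \<partial>gaussN N)
          = (\<integral>g. m k * m (k - 1) + m k * xi r s g (k - 1) + m (k - 1) * xi r s g k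
              + xi r s g k * xi r s g (k - 1) \<partial>gaussN N)"
          by (simp add: algebra_simps)
        also have "\<dots> = m k * m (k - 1) + m k * (\<integral>g. xi r s g (k - 1) \<partial>gaussN N)
          + m (k - 1) * (\<integral>g. xi r s g k \<partial>gaussN N) + (\<integral>g. xi r s g k * xi r s g (k - 1) \<partial>gaussN N)"
          using i by (simp add: prob_space)
        also have "\<dots> = m k * m (k - 1) + r k * vprev r s k"
          using False k by (simp add: integral_xi integral_xi_xi[simplified])
        finally show ?thesis by simp
      qed simp
    qed
    finally show ?thesis .
  qed
  define E where "E g = (\<Sum>k<N. \<beta> * sqrt (real k / real N) * ((m k + xi r s g k) * (m (k - 1) + xi r s g (k - 1))))" for g
  have h0': "h0 g = E g - (2 * x - lam / 2 + 1 / 2) * S - (2 * x - lam / 2 + 1 / 2) * X g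
      - \<beta>\<^sup>2 / (4 * real N) * S\<^sup>2 - \<beta>\<^sup>2 / (4 * real N) * 2 * S * X g - \<beta>\<^sup>2 / (4 * real N) * (X g)\<^sup>2 + L + B g" for g
  proof -
    define b where "b = \<beta>\<^sup>2 / (4 * real N)"
    have "phi N \<beta> lam w = - b * w\<^sup>2 + lam / 2 * w" for w by (simp add: phi_def b_def)
    then have ph: "phi N \<beta> lam (S + X g) = - b * (S + X g)\<^sup>2 + lam / 2 * (S + X g)" .
    show ?thesis unfolding h0_def E_def[symmetric] b_def[symmetric] ph
      by (simp add: power2_sum field_simps)
  qed
  have ints: "integrable (gaussN N) E" "integrable (gaussN N) X" "integrable (gaussN N) B"
    "integrable (gaussN N) (\<lambda>g. (X g)\<^sup>2)"
    using Ei Xi Bi unfolding E_def[symmetric]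
    by (auto intro!: polyint_integrable polyint_power finite_measure_gaussN)
  have "(\<integral>g. h0 g \<partial>gaussN N) = (\<integral>g. E g \<partial>gaussN N) - (2 * x - lam / 2 + 1 / 2) * S
      - \<beta>\<^sup>2 / (4 * real N) * S\<^sup>2 - \<beta>\<^sup>2 / (4 * real N) * Uvar m r s N + L + real N / 2"
    unfolding h0' using ints by (simp add: EX EB prob_space)
  moreover have "integrable (gaussN N) h0"
    unfolding h0'[abs_def] using ints by simp
  then have "(\<integral>g. h0 g \<partial>gaussN N) \<le> ln (\<integral>g. exp (h g) \<partial>gaussN N)"
    by (intro jensen_ln_integral_exp[OF prob_space_gaussN inth]) (auto intro: h0h)
  ultimately show ?thesis
    unfolding logZ_def eq EE[symmetric] E_def[symmetric] L_def
    by (simp add: algebra_simps add_divide_distrib diff_divide_distrib)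
qed

section \<open>Riemann sums\<close>

text \<open>In each cell the mean value theorem turns the increment of F into a value of f, which
  differs from the left endpoint value by at most the increment of f. By monotonicity these
  increments all have one sign and telescope.\<close>

lemma riemann_sum_monotone_bound:
  fixes f F :: "real \<Rightarrow> real"
  assumes N: "0 < N"
    and F: "\<And>t. 0 \<le> t \<Longrightarrow> t \<le> 1 \<Longrightarrow> (F has_real_derivative f t) (at t)"
    and mono: "(\<forall>t u. 0 \<le> t \<longrightarrow> t \<le> u \<longrightarrow> u \<le> 1 \<longrightarrow> f t \<le> f u)
      \<or> (\<forall>t u. 0 \<le> t \<longrightarrow> t \<le> u \<longrightarrow> u \<le> 1 \<longrightarrow> f u \<le> f t)"
  shows "\<bar>(\<Sum>k<N. f (real k / real N)) / real N - (F 1 - F 0)\<bar> \<le> \<bar>f 1 - f 0\<bar> / real N"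
proof -
  define t where "t k = real k / real N" for k
  have t: "0 \<le> t k" "t k \<le> t (Suc k)" "t (Suc k) \<le> 1" "t k < t (Suc k)" if "k < N" for k
    using that N by (auto simp: t_def divide_right_mono field_simps)
  have ends: "t 0 = 0" "t N = 1" using N by (auto simp: t_def)
  have mvt: "\<exists>x. t k \<le> x \<and> x \<le> t (Suc k) \<and> F (t (Suc k)) - F (t k) = f x / real N" if k: "k < N" for k
  proof -
    note tk = t[OF k]
    have "\<exists>x>t k. x < t (Suc k) \<and> F (t (Suc k)) - F (t k) = (t (Suc k) - t k) * f x"
      by (rule MVT2[OF tk(4)]) (use tk F in auto)
    moreover have "t (Suc k) - t k = 1 / real N" using N by (simp add: t_def field_simps)
    ultimately show ?thesis by (auto intro: less_imp_le)
  qed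
  have tele: "(\<Sum>k<N. F (t (Suc k)) - F (t k)) = F 1 - F 0"
    using sum_lessThan_telescope[of "\<lambda>k. F (t k)" N] by (simp add: ends)
  have telef: "(\<Sum>k<N. f (t (Suc k)) - f (t k)) = f 1 - f 0"
    using sum_lessThan_telescope[of "\<lambda>k. f (t k)" N] by (simp add: ends)
  have s: "(\<Sum>k<N. f (t k)) / real N - (F 1 - F 0) = (\<Sum>k<N. f (t k) / real N - (F (t (Suc k)) - F (t k)))"
  proof -
    have "(\<Sum>k<N. f (t k) / real N - (F (t (Suc k)) - F (t k)))
      = (\<Sum>k<N. f (t k) / real N) - (\<Sum>k<N. F (t (Suc k)) - F (t k))"
      by (rule sum_subtractf)
    then show ?thesis by (simp only: tele sum_divide_distrib)
  qed
  have "\<bar>(\<Sum>k<N. f (t k)) / real N - (F 1 - F 0)\<bar> \<le> (\<Sum>k<N. \<bar>f (t k) / real N - (F (t (Suc k)) - F (t k))\<bar>)"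
    unfolding s by (rule sum_abs)
  also have "\<dots> \<le> (\<Sum>k<N. \<bar>f (t (Suc k)) - f (t k)\<bar> / real N)"
  proof (rule sum_mono)
    fix k assume "k \<in> {..<N}"
    then have k: "k < N" by simp
    obtain x where x: "t k \<le> x" "x \<le> t (Suc k)" "F (t (Suc k)) - F (t k) = f x / real N"
      using mvt[OF k] by blast
    note tk = t[OF k]
    have "\<bar>f (t k) - f x\<bar> \<le> \<bar>f (t (Suc k)) - f (t k)\<bar>"
      using mono
    proof
      assume m: "\<forall>t u. 0 \<le> t \<longrightarrow> t \<le> u \<longrightarrow> u \<le> 1 \<longrightarrow> f t \<le> f u"
      have "f (t k) \<le> f x" "f x \<le> f (t (Suc k))" using m x tk by auto
      then show ?thesis by simp
    next
      assume m: "\<forall>t u. 0 \<le> t \<longrightarrow> t \<le> u \<longrightarrow> u \<le> 1 \<longrightarrow> f u \<le> f t"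
      have "f x \<le> f (t k)" "f (t (Suc k)) \<le> f x" using m x tk by auto
      then show ?thesis by simp
    qed
    then show "\<bar>f (t k) / real N - (F (t (Suc k)) - F (t k))\<bar> \<le> \<bar>f (t (Suc k)) - f (t k)\<bar> / real N"
      unfolding x(3) diff_divide_distrib[symmetric] using N by (simp add: divide_right_mono)
  qed
  also have "\<dots> = (\<Sum>k<N. \<bar>f (t (Suc k)) - f (t k)\<bar>) / real N"
    by (simp add: sum_divide_distrib)
  also have "(\<Sum>k<N. \<bar>f (t (Suc k)) - f (t k)\<bar>) = \<bar>\<Sum>k<N. f (t (Suc k)) - f (t k)\<bar>"
    using mono
  proof
    assume m: "\<forall>t u. 0 \<le> t \<longrightarrow> t \<le> u \<longrightarrow> u \<le> 1 \<longrightarrow> f t \<le> f u"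
    then have ge: "0 \<le> f (t (Suc k)) - f (t k)" if "k < N" for k using t[OF that] by simp
    then have "(\<Sum>k<N. \<bar>f (t (Suc k)) - f (t k)\<bar>) = (\<Sum>k<N. f (t (Suc k)) - f (t k))"
      by (intro sum.cong) auto
    moreover have "0 \<le> (\<Sum>k<N. f (t (Suc k)) - f (t k))" using ge by (intro sum_nonneg) auto
    ultimately show ?thesis by linarith
  next
    assume m: "\<forall>t u. 0 \<le> t \<longrightarrow> t \<le> u \<longrightarrow> u \<le> 1 \<longrightarrow> f u \<le> f t"
    then have le: "f (t (Suc k)) - f (t k) \<le> 0" if "k < N" for k using t[OF that] by simp
    then have "(\<Sum>k<N. \<bar>f (t (Suc k)) - f (t k)\<bar>) = (\<Sum>k<N. - (f (t (Suc k)) - f (t k)))"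
      by (intro sum.cong) auto
    also have "\<dots> = - (\<Sum>k<N. f (t (Suc k)) - f (t k))" by (rule sum_negf)
    moreover have "(\<Sum>k<N. f (t (Suc k)) - f (t k)) \<le> 0" using le by (intro sum_nonpos) auto
    ultimately show ?thesis by linarith
  qed
  finally show ?thesis unfolding telef by (simp only: t_def)
qed

lemma riemann_sum_tendsto:
  fixes f F :: "real \<Rightarrow> real"
  assumes F: "\<And>t. 0 \<le> t \<Longrightarrow> t \<le> 1 \<Longrightarrow> (F has_real_derivative f t) (at t)"
    and mono: "(\<forall>t u. 0 \<le> t \<longrightarrow> t \<le> u \<longrightarrow> u \<le> 1 \<longrightarrow> f t \<le> f u)
      \<or> (\<forall>t u. 0 \<le> t \<longrightarrow> t \<le> u \<longrightarrow> u \<le> 1 \<longrightarrow> f u \<le> f t)"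
  shows "(\<lambda>N. (\<Sum>k<N. f (real k / real N)) / real N) \<longlonglongrightarrow> F 1 - F 0"
proof -
  have "(\<lambda>N. (\<Sum>k<N. f (real k / real N)) / real N - (F 1 - F 0)) \<longlonglongrightarrow> 0"
  proof (rule tendsto_rabs_zero_cancel, rule tendsto_sandwich[OF _ _ tendsto_const])
    show "\<forall>\<^sub>F N in sequentially. \<bar>(\<Sum>k<N. f (real k / real N)) / real N - (F 1 - F 0)\<bar> \<le> \<bar>f 1 - f 0\<bar> / real N"
      using eventually_gt_at_top[of 0] by eventually_elim (rule riemann_sum_monotone_bound[OF _ F mono])
    show "(\<lambda>N. \<bar>f 1 - f 0\<bar> / real N) \<longlonglongrightarrow> 0"
      by (rule tendsto_divide_0[OF tendsto_const filterlim_at_top_imp_at_infinity[OF filterlim_real_sequentially]])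
  qed auto
  then show ?thesis by (rule LIM_zero_cancel)
qed

section \<open>Limits of the site averages\<close>

text \<open>An antiderivative of \<open>t \<mapsto> ln (Droot \<beta> \<theta> t)\<close>, obtained by parametrizing with
  \<open>t = D * (\<theta> - D) / \<beta>\<^sup>2\<close> and integrating by parts.\<close>

definition lnDroot_prim :: "real \<Rightarrow> real \<Rightarrow> real \<Rightarrow> real" where
  "lnDroot_prim \<beta> \<theta> t = t * ln (Droot \<beta> \<theta> t) - (\<theta> * Droot \<beta> \<theta> t - (Droot \<beta> \<theta> t)\<^sup>2 / 2) / \<beta>\<^sup>2"

lemma Droot_deriv:
  assumes \<beta>: "0 < \<beta>" and \<theta>: "2 * \<beta> < \<theta>" and t: "t \<le> 1"
  shows "(Droot \<beta> \<theta> has_real_derivative - \<beta>\<^sup>2 / sqrt (\<theta>\<^sup>2 - 4 * \<beta>\<^sup>2 * t)) (at t)"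
    and "0 < \<theta>\<^sup>2 - 4 * \<beta>\<^sup>2 * t"
proof -
  have "(2 * \<beta>)\<^sup>2 < \<theta>\<^sup>2" using assms by (intro power_strict_mono) auto
  moreover have "4 * \<beta>\<^sup>2 * t \<le> 4 * \<beta>\<^sup>2 * 1" using t by (intro mult_left_mono) auto
  ultimately show pos: "0 < \<theta>\<^sup>2 - 4 * \<beta>\<^sup>2 * t" by (simp add: power_mult_distrib)
  show "(Droot \<beta> \<theta> has_real_derivative - \<beta>\<^sup>2 / sqrt (\<theta>\<^sup>2 - 4 * \<beta>\<^sup>2 * t)) (at t)"
    unfolding Droot_def[abs_def] using pos
    by (auto intro!: derivative_eq_intros simp: divide_simps)
qed

text \<open>Besides ln D, differentiation produces t D' / D - (theta - D) D' / beta^2, which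
  vanishes because the defining equation of D says t / D = (theta - D) / beta^2.\<close>

lemma lnDroot_prim_deriv:
  assumes \<beta>: "0 < \<beta>" and \<theta>: "2 * \<beta> < \<theta>" and t: "t \<le> 1"
  shows "(lnDroot_prim \<beta> \<theta> has_real_derivative ln (Droot \<beta> \<theta> t)) (at t)"
proof -
  define D where "D = Droot \<beta> \<theta> t"
  define D' where "D' = - \<beta>\<^sup>2 / sqrt (\<theta>\<^sup>2 - 4 * \<beta>\<^sup>2 * t)"
  have Dpos: "0 < D" unfolding D_def using Droot_pos[of \<beta> \<theta> t] assms by simp
  have De: "D + \<beta>\<^sup>2 * t / D = \<theta>" unfolding D_def using Droot_eq[of \<beta> \<theta> t] assms by simp
  have dD: "(Droot \<beta> \<theta> has_real_derivative D') (at t)"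
    unfolding D'_def by (rule Droot_deriv[OF assms])
  have "(lnDroot_prim \<beta> \<theta> has_real_derivative
     (1 * ln D + (D' * inverse D) * t) - (\<theta> * D' - (2 * D * D') / 2) / \<beta>\<^sup>2) (at t)"
  proof -
    have l: "((\<lambda>t. ln (Droot \<beta> \<theta> t)) has_real_derivative D' * inverse D) (at t)"
      unfolding D_def by (rule DERIV_cong[OF DERIV_chain2[OF DERIV_ln dD]]) (use Dpos D_def in auto)
    have sq: "((\<lambda>t. (Droot \<beta> \<theta> t)\<^sup>2 / 2) has_real_derivative (2 * D * D') / 2) (at t)"
      unfolding D_def using DERIV_power[OF dD, of 2] by (intro DERIV_cdivide) (simp add: mult_ac)
    show ?thesis
      unfolding lnDroot_prim_def[abs_def] D_def[symmetric]
      using DERIV_mult'[OF DERIV_ident l] by (intro DERIV_diff DERIV_cdivide DERIV_cmult dD sq) (simp add: D_def mult_ac add_ac)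
  qed
  moreover have "t / D = (\<theta> - D) / \<beta>\<^sup>2"
    using De \<beta> Dpos by (simp add: field_simps)
  then have "t / D * D' = (\<theta> - D) / \<beta>\<^sup>2 * D'" by simp
  then have "(D' * inverse D) * t = (\<theta> - D) * D' / \<beta>\<^sup>2"
    by (simp add: divide_inverse mult_ac)
  moreover have "(\<theta> - D) * D' = \<theta> * D' - (2 * D * D') / 2"
    by (simp add: left_diff_distrib)
  ultimately show ?thesis by (simp add: D_def)
qed


text \<open>Parametrizing theta by d makes the discriminant at t = 1 the square of d - beta^2 / d,
  which is nonnegative exactly when d is at least beta; so d is the larger root, that is, the last
  pivot.\<close>

lemma Droot_ends:
  assumes "0 < \<beta>" "\<beta> \<le> d" and \<theta>: "\<theta> = d + \<beta>\<^sup>2 / d"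
  shows "Droot \<beta> \<theta> 1 = d" "Droot \<beta> \<theta> 0 = \<theta>"
proof -
  have d: "0 < d" using assms by simp
  have "\<theta>\<^sup>2 - 4 * \<beta>\<^sup>2 * 1 = (d - \<beta>\<^sup>2 / d)\<^sup>2"
    using d by (simp add: \<theta> power2_sum power2_diff)
  moreover have "0 \<le> d - \<beta>\<^sup>2 / d"
  proof -
    have "\<beta>\<^sup>2 \<le> d * d" using assms by (simp add: power2_eq_square mult_mono)
    then show ?thesis using d by (simp add: field_simps)
  qed
  ultimately show "Droot \<beta> \<theta> 1 = d" by (simp add: Droot_def \<theta>)
  have "0 < \<theta>" using d by (simp add: \<theta> add_pos_nonneg)
  then show "Droot \<beta> \<theta> 0 = \<theta>" by (simp add: Droot_def)
qed

lemma theta_gt: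
  fixes \<beta> d :: real
  assumes "0 < \<beta>" "\<beta> < d"
  shows "2 * \<beta> < d + \<beta>\<^sup>2 / d"
proof -
  have "0 < (d - \<beta>)\<^sup>2 / d" using assms by simp
  also have "\<dots> = d + \<beta>\<^sup>2 / d - 2 * \<beta>" using assms by (simp add: power2_eq_square field_simps)
  finally show ?thesis by simp
qed

definition lnD_avg :: "real \<Rightarrow> real \<Rightarrow> nat \<Rightarrow> real" where
  "lnD_avg \<beta> \<theta> N = (\<Sum>k<N. ln (Droot \<beta> \<theta> (real k / real N))) / real N"

definition var_avg :: "real \<Rightarrow> real \<Rightarrow> nat \<Rightarrow> real" where
  "var_avg \<beta> \<theta> N = (\<Sum>k<N. 1 / sqrt (\<theta>\<^sup>2 - 4 * \<beta>\<^sup>2 * (real k / real N))) / real N"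

text \<open>The squared shift at site k will be mu (k/N)^p. Exponent p gives its mass per site, and
  exponent p + 1 a lower estimate of its coupling energy.\<close>

definition pow_avg :: "nat \<Rightarrow> nat \<Rightarrow> real" where
  "pow_avg n N = (\<Sum>k<N. (real k / real N) ^ n) / real N"

lemma lnD_avg_tendsto:
  assumes \<beta>: "0 < \<beta>" "\<beta> < d" and \<theta>: "\<theta> = d + \<beta>\<^sup>2 / d"
  shows "lnD_avg \<beta> \<theta> \<longlonglongrightarrow> ln d + \<beta>\<^sup>2 / (2 * d\<^sup>2)"
proof -
  have t2: "2 * \<beta> < \<theta>" unfolding \<theta> by (rule theta_gt[OF \<beta>])
  have d: "0 < d" using \<beta> by simp
  have "lnD_avg \<beta> \<theta> \<longlonglongrightarrow> lnDroot_prim \<beta> \<theta> 1 - lnDroot_prim \<beta> \<theta> 0"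
    unfolding lnD_avg_def[abs_def]
  proof (rule riemann_sum_tendsto)
    show "(lnDroot_prim \<beta> \<theta> has_real_derivative ln (Droot \<beta> \<theta> t)) (at t)" if "0 \<le> t" "t \<le> 1" for t
      by (rule lnDroot_prim_deriv[OF \<beta>(1) t2 that(2)])
    show "(\<forall>t u. 0 \<le> t \<longrightarrow> t \<le> u \<longrightarrow> u \<le> 1 \<longrightarrow> ln (Droot \<beta> \<theta> t) \<le> ln (Droot \<beta> \<theta> u))
      \<or> (\<forall>t u. 0 \<le> t \<longrightarrow> t \<le> u \<longrightarrow> u \<le> 1 \<longrightarrow> ln (Droot \<beta> \<theta> u) \<le> ln (Droot \<beta> \<theta> t))"
      using Droot_antimono[OF \<beta>(1)] Droot_pos[OF \<beta>(1) less_imp_le[OF t2]] by (auto intro!: ln_mono)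
  qed
  also have "lnDroot_prim \<beta> \<theta> 1 - lnDroot_prim \<beta> \<theta> 0 = ln d + \<beta>\<^sup>2 / (2 * d\<^sup>2)"
  proof -
    have "lnDroot_prim \<beta> \<theta> 1 - lnDroot_prim \<beta> \<theta> 0 = ln d + (\<theta> - d)\<^sup>2 / (2 * \<beta>\<^sup>2)"
      unfolding lnDroot_prim_def Droot_ends[OF \<beta>(1) less_imp_le[OF \<beta>(2)] \<theta>] power2_diff
      using \<beta> by (simp add: power2_eq_square field_simps)
    also have "(\<theta> - d)\<^sup>2 / (2 * \<beta>\<^sup>2) = \<beta>\<^sup>2 / (2 * d\<^sup>2)"
      using \<beta> d by (simp add: \<theta> power2_eq_square field_simps)
    finally show ?thesis .
  qed
  finally show ?thesis .
qed

text \<open>Up to the factor - beta^2 the integrand is the derivative of \<open>Droot\<close>, so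
  the limit is (theta - d) / beta^2 = 1 / d.\<close>

lemma var_avg_tendsto:
  assumes \<beta>: "0 < \<beta>" "\<beta> < d" and \<theta>: "\<theta> = d + \<beta>\<^sup>2 / d"
  shows "var_avg \<beta> \<theta> \<longlonglongrightarrow> 1 / d"
proof -
  have t2: "2 * \<beta> < \<theta>" unfolding \<theta> by (rule theta_gt[OF \<beta>])
  have d: "0 < d" using \<beta> by simp
  let ?F = "\<lambda>t. - Droot \<beta> \<theta> t / \<beta>\<^sup>2"
  have "var_avg \<beta> \<theta> \<longlonglongrightarrow> ?F 1 - ?F 0"
    unfolding var_avg_def[abs_def]
  proof (rule riemann_sum_tendsto)
    show "(?F has_real_derivative 1 / sqrt (\<theta>\<^sup>2 - 4 * \<beta>\<^sup>2 * t)) (at t)" if "0 \<le> t" "t \<le> 1" for t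
      using DERIV_cdivide[OF DERIV_minus[OF Droot_deriv(1)[OF \<beta>(1) t2 that(2)]], of "\<beta>\<^sup>2"] \<beta>(1) by simp
    show "(\<forall>t u. 0 \<le> t \<longrightarrow> t \<le> u \<longrightarrow> u \<le> 1 \<longrightarrow> 1 / sqrt (\<theta>\<^sup>2 - 4 * \<beta>\<^sup>2 * t) \<le> 1 / sqrt (\<theta>\<^sup>2 - 4 * \<beta>\<^sup>2 * u))
      \<or> (\<forall>t u. 0 \<le> t \<longrightarrow> t \<le> u \<longrightarrow> u \<le> 1 \<longrightarrow> 1 / sqrt (\<theta>\<^sup>2 - 4 * \<beta>\<^sup>2 * u) \<le> 1 / sqrt (\<theta>\<^sup>2 - 4 * \<beta>\<^sup>2 * t))"
      using Droot_deriv(2)[OF \<beta>(1) t2] by (intro disjI1 allI impI divide_left_mono) (auto simp: mult_left_mono)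
  qed
  also have "?F 1 - ?F 0 = 1 / d"
    using Droot_ends[OF \<beta>(1) less_imp_le[OF \<beta>(2)] \<theta>] \<beta> d by (simp add: \<theta> field_simps power2_eq_square)
  finally show ?thesis .
qed

lemma pow_avg_tendsto: "pow_avg n \<longlonglongrightarrow> 1 / (real n + 1)"
proof -
  let ?F = "\<lambda>t::real. t ^ Suc n / (real n + 1)"
  have "pow_avg n \<longlonglongrightarrow> ?F 1 - ?F 0"
    unfolding pow_avg_def[abs_def]
  proof (rule riemann_sum_tendsto)
    show "(?F has_real_derivative t ^ n) (at t)" for t
      using DERIV_cdivide[OF DERIV_pow[of "Suc n" t UNIV], of "real n + 1"] by (simp add: add_ac)
  qed (auto intro: power_mono)
  then show ?thesis by simp
qed

lemma sum_shift_pred: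
  fixes f :: "nat \<Rightarrow> real"
  assumes "0 < N"
  shows "(\<Sum>k<N. if k = 0 then 0 else f (k - 1)) = (\<Sum>k<N. f k) - f (N - 1)"
proof -
  obtain n where n: "N = Suc n" using assms gr0_implies_Suc by blast
  have "(\<Sum>k<N. if k = 0 then 0 else f (k - 1)) = (\<Sum>k<n. f k)"
    unfolding n by (subst sum.lessThan_Suc_shift) simp
  then show ?thesis by (simp add: n)
qed

text \<open>The limiting value of the trial energy per site when the log-pivots average to \<open>a\<close>, the variances
  to \<open>v\<close>, the squared shift to \<open>m\<close> and its coupling energy to \<open>t\<close>.\<close>

definition Lval :: "real \<Rightarrow> real \<Rightarrow> real \<Rightarrow> real \<Rightarrow> real \<Rightarrow> real \<Rightarrow> real \<Rightarrow> real" where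
  "Lval \<beta> lam \<theta> a v m t
    = - a / 2 + \<theta> / 2 * v + \<beta> * t - (1 - lam) / 2 * (v + m) - \<beta>\<^sup>2 / 4 * (v + m)\<^sup>2"

text \<open>The trial chain has the pivots of the upper bound and the variances \<open>1 / (2 * D - \<theta>)\<close>, stationary for
  frozen couplings. They increase with \<open>k\<close>, so all discretization errors have a favourable sign or
  telescope.\<close>

lemma logZ_lower_explicit:
  fixes \<beta> \<theta> lam \<mu> :: real and p :: nat
  assumes \<beta>: "0 < \<beta>" and \<theta>: "2 * \<beta> < \<theta>" and \<mu>: "0 \<le> \<mu>"
  shows "\<exists>c0. \<forall>N>0. \<forall>x q. q \<in> borel_measurable (gaussN N)
    \<longrightarrow> integrable (gaussN N) (\<lambda>z. exp (q z + phi N \<beta> lam (\<Sum>k<N. (z k)\<^sup>2)))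
    \<longrightarrow> (\<forall>z. Hdet N \<beta> z - 2 * x * (\<Sum>k<N. (z k)\<^sup>2) \<le> q z)
    \<longrightarrow> real N * (Lval \<beta> lam \<theta> (lnD_avg \<beta> \<theta> N) (var_avg \<beta> \<theta> N) (\<mu> * pow_avg p N) (\<mu> * pow_avg (Suc p) N)
        - 2 * x * (var_avg \<beta> \<theta> N + \<mu> * pow_avg p N)) - c0
      \<le> logZ N (phi N \<beta> lam) q"
proof -
  \<comment> \<open>V is the trial variance at the edge t = 1 and bounds all others. R bounds the
    chain coefficients, since D is at least theta / 2. The strict inequality 2 beta < theta makes V
    finite and R < 1.\<close>
  define V where "V = 1 / sqrt (\<theta>\<^sup>2 - 4 * \<beta>\<^sup>2)"
  define R where "R = 2 * \<beta> / \<theta>"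
  define K where "K = 8 * (sqrt \<mu>)\<^sup>2 * V / (1 - R) + 4 * V\<^sup>2 / (1 - R) + 4 * (sqrt \<mu>)\<^sup>2 * V + 2 * V\<^sup>2"
  define a where "a N = lnD_avg \<beta> \<theta> N" for N
  define v where "v N = var_avg \<beta> \<theta> N" for N
  define P where "P n N = pow_avg n N" for n N
  \<comment> \<open>The first two summands are the boundary terms lost when sums over k - 1 are
    completed to sums over k; the third is the cost of the variance of the squared norm.\<close>
  define c0 where "c0 = \<theta> / 2 * V + \<beta> * \<mu> + \<beta>\<^sup>2 / 4 * K"
  have \<theta>0: "0 < \<theta>" using \<beta> \<theta> by simp
  have R: "0 \<le> R" "R < 1" using \<beta> \<theta> by (auto simp: R_def field_simps)
  show ?thesis
  proof (intro exI[of _ c0] allI impI)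
    fix N :: nat and x :: real and q :: "(nat \<Rightarrow> real) \<Rightarrow> real"
    assume N: "0 < N" and q: "q \<in> borel_measurable (gaussN N)"
      and int: "integrable (gaussN N) (\<lambda>z. exp (q z + phi N \<beta> lam (\<Sum>k<N. (z k)\<^sup>2)))"
      and ge: "\<forall>z. Hdet N \<beta> z - 2 * x * (\<Sum>k<N. (z k)\<^sup>2) \<le> q z"
    define \<tau> where "\<tau> k = real k / real N" for k
    define D where "D k = Droot \<beta> \<theta> (\<tau> k)" for k
    define w where "w k = 1 / sqrt (\<theta>\<^sup>2 - 4 * \<beta>\<^sup>2 * \<tau> k)" for k
    define r where "r k = \<beta> * sqrt (\<tau> k) / D k" for k
    define m where "m k = sqrt (\<mu> * \<tau> k ^ p)" for k
    define wp where "wp k = (if k = 0 then 0 else w (k - 1))" for k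
    \<comment> \<open>The innovation is chosen so that the variance at site k is exactly w k;
      \<open>wp\<close> is the variance at the preceding site, and 0 before the first.\<close>
    define s where "s k = sqrt (w k - (r k)\<^sup>2 * wp k)" for k
    have \<tau>: "0 \<le> \<tau> k" "\<tau> k \<le> 1" "\<tau> (k - 1) \<le> \<tau> k" if "k < N" for k
      using that N by (auto simp: \<tau>_def divide_right_mono)
    have disc: "0 < \<theta>\<^sup>2 - 4 * \<beta>\<^sup>2 * \<tau> k" if "k < N" for k
      by (rule Droot_deriv(2)[OF \<beta> \<theta> \<tau>(2)[OF that]])
    have wpos: "0 < w k" if "k < N" for k using disc[OF that] by (simp add: w_def)
    have D2: "2 * D k - \<theta> = sqrt (\<theta>\<^sup>2 - 4 * \<beta>\<^sup>2 * \<tau> k)" for k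
      by (simp add: D_def Droot_def field_simps)
    have Dw: "(2 * D k - \<theta>) * w k = 1" if "k < N" for k
      unfolding D2 w_def using disc[OF that] by simp
    have Dpos: "0 < D k" if "k < N" for k
      unfolding D_def by (rule Droot_pos[OF \<beta> less_imp_le[OF \<theta>] \<tau>(2)[OF that]])
    have Dge: "\<theta> / 2 \<le> D k" if "k < N" for k
      using D2[of k] disc[OF that] real_sqrt_ge_zero[of "\<theta>\<^sup>2 - 4 * \<beta>\<^sup>2 * \<tau> k"] by linarith
    have De: "\<beta>\<^sup>2 * \<tau> k / D k = \<theta> - D k" if "k < N" for k
      using Droot_eq[OF \<beta> less_imp_le[OF \<theta>] \<tau>(2)[OF that]] by (simp add: D_def)
    have r2: "(r k)\<^sup>2 = (\<theta> - D k) / D k" if "k < N" for k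
      using De[OF that, symmetric] \<tau>[OF that] by (simp add: r_def power_divide power_mult_distrib power2_eq_square)
    have r0: "0 \<le> r k" if "k < N" for k
      using \<beta> \<tau>[OF that] Dpos[OF that] by (simp add: r_def)
    have rR: "r k \<le> R" if "k < N" for k
    proof -
      have "\<beta> * sqrt (\<tau> k) \<le> \<beta> * 1" using \<beta> \<tau>[OF that] by (intro mult_left_mono) auto
      then have "r k \<le> \<beta> * 1 / D k" unfolding r_def using Dpos[OF that] by (intro divide_right_mono) auto
      also have "\<dots> \<le> \<beta> * 1 / (\<theta> / 2)" using Dge[OF that] Dpos[OF that] \<beta> \<theta>0 by (intro divide_left_mono) auto
      finally show ?thesis by (simp add: R_def mult.commute)
    qed
    have wV: "w k \<le> V" if "k < N" for k
    proof -
      have "\<theta>\<^sup>2 - 4 * \<beta>\<^sup>2 * 1 \<le> \<theta>\<^sup>2 - 4 * \<beta>\<^sup>2 * \<tau> k" using \<tau>[OF that] by (intro diff_left_mono mult_left_mono) auto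
      moreover have "0 < \<theta>\<^sup>2 - 4 * \<beta>\<^sup>2 * 1" using Droot_deriv(2)[OF \<beta> \<theta>, of 1] by simp
      ultimately show ?thesis unfolding w_def V_def by (intro divide_left_mono) auto
    qed
    have wpw: "wp k \<le> w k" "0 \<le> wp k" if "k < N" for k
    proof -
      have k1: "k - 1 < N" using that by simp
      have "\<theta>\<^sup>2 - 4 * \<beta>\<^sup>2 * \<tau> k \<le> \<theta>\<^sup>2 - 4 * \<beta>\<^sup>2 * \<tau> (k - 1)"
        using \<tau>(3)[OF that] by (intro diff_left_mono mult_left_mono) auto
      then have "w (k - 1) \<le> w k" unfolding w_def using disc[OF that] disc[OF k1] by (intro divide_left_mono) auto
      then show "wp k \<le> w k" using wpos[OF that] by (auto simp: wp_def intro: less_imp_le)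
      show "0 \<le> wp k" using wpos[OF k1] by (simp add: wp_def)
    qed
    \<comment> \<open>Frozen couplings would give w (1 - r^2) = w (2 D - theta) / D = 1 / D. Since
      the preceding variance is smaller, the true innovation is larger, which helps.\<close>
    have s2: "1 / D k \<le> w k - (r k)\<^sup>2 * wp k" if "k < N" for k
    proof -
      have "(r k)\<^sup>2 * wp k \<le> (r k)\<^sup>2 * w k" using wpw[OF that] by (intro mult_left_mono) auto
      moreover have "w k - (r k)\<^sup>2 * w k = 1 / D k"
        using Dw[OF that] Dpos[OF that] by (simp add: r2[OF that] field_simps)
      ultimately show ?thesis by simp
    qed
    have s2pos: "0 < w k - (r k)\<^sup>2 * wp k" if "k < N" for k
      using s2[OF that] Dpos[OF that] by (meson divide_pos_pos less_le_trans zero_less_one)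
    have spos: "0 < s k" if "k < N" for k
      using s2pos[OF that] by (simp add: s_def)
    have lns: "- ln (D k) / 2 \<le> ln (s k)" if "k < N" for k
    proof -
      have "ln (1 / D k) \<le> ln (w k - (r k)\<^sup>2 * wp k)"
        using s2[OF that] s2pos[OF that] Dpos[OF that] by (intro ln_mono) auto
      then show ?thesis using s2pos[OF that] Dpos[OF that] by (simp add: s_def ln_sqrt ln_div)
    qed
    have vp: "k < N \<Longrightarrow> vprev r s (Suc k) = w k \<and> vprev r s k = wp k" for k
    proof (induction k)
      case 0
      have "r 0 = 0" by (simp add: r_def \<tau>_def)
      then show ?case using wpos[OF 0] by (simp add: s_def wp_def)
    next
      case (Suc k)
      then have "vprev r s (Suc k) = wp (Suc k)" by (simp add: wp_def del: vprev.simps)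
      moreover have "(s (Suc k))\<^sup>2 = w (Suc k) - (r (Suc k))\<^sup>2 * wp (Suc k)"
        using s2pos[OF Suc.prems] by (simp add: s_def)
      ultimately show ?case by (simp only: vprev.simps(2)[of r s "Suc k"]) simp
    qed
    define S where "S = (\<Sum>k<N. (m k)\<^sup>2 + vprev r s (Suc k))"
    have m2: "(m k)\<^sup>2 = \<mu> * \<tau> k ^ p" if "k < N" for k
      using \<mu> \<tau>[OF that] by (simp add: m_def)
    have S: "S = real N * (v N + \<mu> * P p N)"
    proof -
      have "S = (\<Sum>k<N. \<mu> * \<tau> k ^ p + w k)"
        unfolding S_def using m2 vp by (intro sum.cong) (auto simp del: vprev.simps)
      also have "\<dots> = \<mu> * (\<Sum>k<N. \<tau> k ^ p) + (\<Sum>k<N. w k)"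
        by (simp add: sum.distrib sum_distrib_left)
      finally show ?thesis using N by (simp add: P_def pow_avg_def v_def var_avg_def w_def \<tau>_def field_simps)
    qed
    have m0: "0 \<le> m k" "m k \<le> sqrt \<mu>" "m (k - 1) \<le> m k" if "k < N" for k
    proof -
      show "0 \<le> m k" using \<mu> \<tau>[OF that] by (simp add: m_def)
      have "\<mu> * \<tau> k ^ p \<le> \<mu> * 1" using \<mu> \<tau>[OF that] by (intro mult_left_mono power_le_one) auto
      then show "m k \<le> sqrt \<mu>" by (simp add: m_def)
      have "k - 1 < N" using that by simp
      then show "m (k - 1) \<le> m k" using \<mu> \<tau>[OF that] \<tau>(1)[of "k - 1"] unfolding m_def
        by (intro real_sqrt_le_mono mult_left_mono power_mono) auto
    qed
    \<comment> \<open>The chain part uses (2 D - theta) wp <= (2 D - theta) w = 1, and the summand -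
      1/2 will cancel the N / 2 of \<open>logZ_lower\<close>. The shift part uses tau (k - 1) <= tau
      k <= sqrt (tau k), so that a shifted power sum appears.\<close>
    have e: "\<theta> / 2 * wp k - 1 / 2 + \<beta> * (if k = 0 then 0 else \<mu> * \<tau> (k - 1) ^ Suc p)
      \<le> \<beta> * sqrt (real k / real N) * (m k * m (k - 1) + r k * vprev r s k)" if k: "k < N" for k
    proof (cases "k = 0")
      case True then show ?thesis by (simp add: wp_def)
    next
      case False
      have k1: "k - 1 < N" using k by simp
      have 1: "\<beta> * sqrt (\<tau> k) * (r k * wp k) = (\<theta> - D k) * wp k"
        using De[OF k, symmetric] \<tau>[OF k] by (simp add: r_def power2_eq_square)
      have "(2 * D k - \<theta>) * wp k \<le> (2 * D k - \<theta>) * w k"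
        using wpw[OF k] Dge[OF k] by (intro mult_left_mono) auto
      then have 2: "\<theta> / 2 * wp k - 1 / 2 \<le> (\<theta> - D k) * wp k"
        using Dw[OF k] by (simp add: algebra_simps)
      have "\<tau> k \<le> sqrt (\<tau> k)"
        using \<tau>[OF k] by (intro real_le_rsqrt) (simp add: power2_eq_square mult_left_le)
      then have t: "\<tau> (k - 1) \<le> sqrt (\<tau> k)" using \<tau>(3)[OF k] by simp
      have "\<tau> (k - 1) * (m (k - 1) * m (k - 1)) \<le> sqrt (\<tau> k) * (m k * m (k - 1))"
        using t m0[OF k] m0[OF k1] \<tau>(1)[OF k1] \<tau>[OF k] by (intro mult_mono) auto
      moreover have "m (k - 1) * m (k - 1) = \<mu> * \<tau> (k - 1) ^ p"
        using m2[OF k1] by (simp add: power2_eq_square)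
      ultimately have "\<mu> * \<tau> (k - 1) ^ Suc p \<le> sqrt (\<tau> k) * (m k * m (k - 1))"
        by (simp add: mult_ac)
      then have 3: "\<beta> * (\<mu> * \<tau> (k - 1) ^ Suc p) \<le> \<beta> * (sqrt (\<tau> k) * (m k * m (k - 1)))"
        using \<beta> by (intro mult_left_mono) auto
      have "\<beta> * sqrt (\<tau> k) * (m k * m (k - 1) + r k * wp k)
        = \<beta> * (sqrt (\<tau> k) * (m k * m (k - 1))) + \<beta> * sqrt (\<tau> k) * (r k * wp k)"
        by (simp add: algebra_simps)
      then show ?thesis using False vp[OF k] 1 2 3 unfolding \<tau>_def[of k, symmetric] by simp
    qed
    have "(\<Sum>k<N. \<theta> / 2 * wp k - 1 / 2 + \<beta> * (if k = 0 then 0 else \<mu> * \<tau> (k - 1) ^ Suc p))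
      = \<theta> / 2 * (\<Sum>k<N. wp k) - real N / 2 + \<beta> * (\<Sum>k<N. if k = 0 then 0 else \<mu> * \<tau> (k - 1) ^ Suc p)"
      by (simp add: sum.distrib sum_subtractf sum_distrib_left)
    also have "(\<Sum>k<N. wp k) = real N * v N - w (N - 1)"
      unfolding wp_def sum_shift_pred[OF N] using N by (simp add: v_def var_avg_def w_def \<tau>_def)
    also have "(\<Sum>k<N. if k = 0 then 0 else \<mu> * \<tau> (k - 1) ^ Suc p) = real N * (\<mu> * P (Suc p) N) - \<mu> * \<tau> (N - 1) ^ Suc p"
      unfolding sum_shift_pred[OF N, of "\<lambda>k. \<mu> * \<tau> k ^ Suc p"] using N
      by (simp add: P_def pow_avg_def \<tau>_def sum_distrib_left sum_divide_distrib)
    finally have Eeq: "(\<Sum>k<N. \<theta> / 2 * wp k - 1 / 2 + \<beta> * (if k = 0 then 0 else \<mu> * \<tau> (k - 1) ^ Suc p))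
      = \<theta> / 2 * (real N * v N - w (N - 1)) - real N / 2
        + \<beta> * (real N * (\<mu> * P (Suc p) N) - \<mu> * \<tau> (N - 1) ^ Suc p)" .
    have Ele: "(\<Sum>k<N. \<theta> / 2 * wp k - 1 / 2 + \<beta> * (if k = 0 then 0 else \<mu> * \<tau> (k - 1) ^ Suc p))
      \<le> (\<Sum>k<N. \<beta> * sqrt (real k / real N) * (m k * m (k - 1) + r k * vprev r s k))"
      by (rule sum_mono, rule e) simp
    have Esum: "\<theta> / 2 * (real N * v N - w (N - 1)) - real N / 2
        + \<beta> * (real N * (\<mu> * P (Suc p) N) - \<mu> * \<tau> (N - 1) ^ Suc p)
      \<le> (\<Sum>k<N. \<beta> * sqrt (real k / real N) * (m k * m (k - 1) + r k * vprev r s k))"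
      using Ele unfolding Eeq .
    have N1: "N - 1 < N" using N by simp
    have b1: "\<theta> / 2 * w (N - 1) \<le> \<theta> / 2 * V" using wV[OF N1] \<theta>0 by (intro mult_left_mono) auto
    have b2: "\<beta> * (\<mu> * \<tau> (N - 1) ^ Suc p) \<le> \<beta> * \<mu>"
    proof -
      have "\<mu> * \<tau> (N - 1) ^ Suc p \<le> \<mu> * 1" using \<mu> \<tau>[OF N1] by (intro mult_left_mono power_le_one) auto
      then show ?thesis using \<beta> by simp
    qed
    have lnsum: "- (real N * a N) / 2 \<le> (\<Sum>k<N. ln (s k))"
    proof -
      have "(\<Sum>k<N. - ln (D k) / 2) \<le> (\<Sum>k<N. ln (s k))" by (rule sum_mono) (use lns in auto)
      moreover have "(\<Sum>k<N. - ln (D k) / 2) = - (real N * a N) / 2"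
        using N by (simp add: a_def lnD_avg_def D_def \<tau>_def sum_negf sum_divide_distrib[symmetric])
      ultimately show ?thesis by simp
    qed
    have "Uvar m r s N \<le> real N * K"
      unfolding K_def by (rule Uvar_bound) (use m0 r0 rR R wV vp in \<open>auto simp del: vprev.simps\<close>)
    then have "\<beta>\<^sup>2 / (4 * real N) * Uvar m r s N \<le> \<beta>\<^sup>2 / (4 * real N) * (real N * K)"
      by (intro mult_left_mono) auto
    then have U: "\<beta>\<^sup>2 / (4 * real N) * Uvar m r s N \<le> \<beta>\<^sup>2 / 4 * K" using N by simp
    have SS: "\<beta>\<^sup>2 / (4 * real N) * S\<^sup>2 = real N * (\<beta>\<^sup>2 / 4 * (v N + \<mu> * P p N)\<^sup>2)"
    proof -
      have "\<beta>\<^sup>2 / (4 * real N) * (real N * y)\<^sup>2 = real N * (\<beta>\<^sup>2 / 4 * y\<^sup>2)" for y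
        using N by (simp add: power2_eq_square)
      then show ?thesis unfolding S .
    qed
    have "(\<Sum>k<N. ln (s k)) + real N / 2 + (\<Sum>k<N. \<beta> * sqrt (real k / real N) * (m k * m (k - 1) + r k * vprev r s k))
      - ((1 - lam) / 2 + 2 * x) * S - \<beta>\<^sup>2 / (4 * real N) * (S\<^sup>2 + Uvar m r s N)
      \<le> logZ N (phi N \<beta> lam) q"
      unfolding S_def by (rule logZ_lower[OF N spos q int]) (use ge in auto)
    then have "(\<Sum>k<N. ln (s k)) + real N / 2 + (\<Sum>k<N. \<beta> * sqrt (real k / real N) * (m k * m (k - 1) + r k * vprev r s k))
      - ((1 - lam) / 2 + 2 * x) * S - (\<beta>\<^sup>2 / (4 * real N) * S\<^sup>2 + \<beta>\<^sup>2 / (4 * real N) * Uvar m r s N)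
      \<le> logZ N (phi N \<beta> lam) q"
      by (simp only: distrib_left)
    moreover have "real N * (Lval \<beta> lam \<theta> (a N) (v N) (\<mu> * P p N) (\<mu> * P (Suc p) N) - 2 * x * (v N + \<mu> * P p N))
      = - (real N * a N) / 2 + \<theta> / 2 * (real N * v N) + \<beta> * (real N * (\<mu> * P (Suc p) N))
        - ((1 - lam) / 2 + 2 * x) * S - \<beta>\<^sup>2 / (4 * real N) * S\<^sup>2"
      by (subst SS) (simp add: Lval_def S algebra_simps)
    moreover have "\<theta> / 2 * (real N * v N - w (N - 1)) = \<theta> / 2 * (real N * v N) - \<theta> / 2 * w (N - 1)"
      "\<beta> * (real N * (\<mu> * P (Suc p) N) - \<mu> * \<tau> (N - 1) ^ Suc p)
        = \<beta> * (real N * (\<mu> * P (Suc p) N)) - \<beta> * (\<mu> * \<tau> (N - 1) ^ Suc p)"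
      by (simp_all only: right_diff_distrib)
    ultimately have "real N * (Lval \<beta> lam \<theta> (a N) (v N) (\<mu> * P p N) (\<mu> * P (Suc p) N)
        - 2 * x * (v N + \<mu> * P p N)) - c0 \<le> logZ N (phi N \<beta> lam) q"
      using Esum b1 b2 lnsum U unfolding c0_def by linarith
    then show "real N * (Lval \<beta> lam \<theta> (lnD_avg \<beta> \<theta> N) (var_avg \<beta> \<theta> N) (\<mu> * pow_avg p N) (\<mu> * pow_avg (Suc p) N)
        - 2 * x * (var_avg \<beta> \<theta> N + \<mu> * pow_avg p N)) - c0 \<le> logZ N (phi N \<beta> lam) q"
      unfolding a_def v_def P_def .
  qed
qed

section \<open>Fluctuations of the tridiagonal disorder\<close>

text \<open>The integrand times the standard density is proportional to a centred normal density of
  variance 1 / (1 - 2 sigma); substituting with that scale makes the integrand the constant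
  s.\<close>

lemma gauss1_exp_square:
  assumes "\<sigma> < 1 / 2"
  shows "integrable gauss1 (\<lambda>x. exp (\<sigma> * x\<^sup>2))" "(\<integral>x. exp (\<sigma> * x\<^sup>2) \<partial>gauss1) = 1 / sqrt (1 - 2 * \<sigma>)"
proof -
  define s where "s = 1 / sqrt (1 - 2 * \<sigma>)"
  have s: "0 < s" "s\<^sup>2 = 1 / (1 - 2 * \<sigma>)" using assms by (auto simp: s_def power_divide)
  interpret prob_space gauss1 by (rule prob_space_gauss1)
  have "(\<integral>\<^sup>+x. ennreal (exp (\<sigma> * x\<^sup>2)) \<partial>gauss1)
    = (\<integral>\<^sup>+x. ennreal (exp (\<sigma> * (0 + s * x)\<^sup>2)) * ennreal (s * exp (- (0 + s * x)\<^sup>2 / 2 + x\<^sup>2 / 2)) \<partial>gauss1)"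
    by (rule nn_integral_gauss1_affine[OF s(1)]) measurable
  also have "\<dots> = (\<integral>\<^sup>+x. ennreal s \<partial>gauss1)"
  proof (rule nn_integral_cong)
    fix x :: real
    have "\<sigma> * (s * x)\<^sup>2 + (- (s * x)\<^sup>2 / 2 + x\<^sup>2 / 2) = x\<^sup>2 * (1 - s\<^sup>2 * (1 - 2 * \<sigma>)) / 2"
      by (simp add: power_mult_distrib field_simps)
    also have "\<dots> = 0" using assms by (simp add: s)
    finally have "exp (\<sigma> * (s * x)\<^sup>2) * exp (- (s * x)\<^sup>2 / 2 + x\<^sup>2 / 2) = 1"
      by (simp add: mult_exp_exp)
    then have "exp (\<sigma> * (0 + s * x)\<^sup>2) * (s * exp (- (0 + s * x)\<^sup>2 / 2 + x\<^sup>2 / 2)) = s"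
      by simp
    then show "ennreal (exp (\<sigma> * (0 + s * x)\<^sup>2)) * ennreal (s * exp (- (0 + s * x)\<^sup>2 / 2 + x\<^sup>2 / 2)) = ennreal s"
      using s(1) by (subst ennreal_mult[symmetric]) (auto simp: less_imp_le)
  qed
  also have "\<dots> = ennreal s" using emeasure_space_1 by simp
  finally have nn: "(\<integral>\<^sup>+x. ennreal (exp (\<sigma> * x\<^sup>2)) \<partial>gauss1) = ennreal s" .
  show "integrable gauss1 (\<lambda>x. exp (\<sigma> * x\<^sup>2))"
    by (rule integrableI_nonneg) (auto simp: nn)
  show "(\<integral>x. exp (\<sigma> * x\<^sup>2) \<partial>gauss1) = 1 / sqrt (1 - 2 * \<sigma>)"
    using nn s(1) by (subst integral_eq_nn_integral) (auto simp: s_def)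
qed

lemma integral_gaussPi_prod_subset:
  fixes f :: "real \<Rightarrow> real"
  assumes I: "finite I" "A \<subseteq> I" and f: "integrable gauss1 f"
  shows "integrable (gaussPi I) (\<lambda>g. \<Prod>i\<in>A. f (g i))"
    and "(\<integral>g. (\<Prod>i\<in>A. f (g i)) \<partial>gaussPi I) = (\<integral>x. f x \<partial>gauss1) ^ card A"
proof -
  interpret prob_space gauss1 by (rule prob_space_gauss1)
  let ?h = "\<lambda>i x. if i \<in> A then f x else 1"
  have h: "integrable gauss1 (?h i)" for i using f by (cases "i \<in> A") auto
  have e: "(\<Prod>i\<in>A. f (g i)) = (\<Prod>i\<in>I. ?h i (g i))" for g
    using I by (simp add: prod.inter_restrict[symmetric] Int_absorb1)
  show "integrable (gaussPi I) (\<lambda>g. \<Prod>i\<in>A. f (g i))"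
    unfolding e by (rule gaussP.product_integrable_prod[OF I(1) h])
  have hi: "(\<integral>x. ?h i x \<partial>gauss1) = (if i \<in> A then (\<integral>x. f x \<partial>gauss1) else 1)" for i
    using prob_space by simp
  have "(\<integral>g. (\<Prod>i\<in>A. f (g i)) \<partial>gaussPi I) = (\<Prod>i\<in>I. (\<integral>x. ?h i x \<partial>gauss1))"
    unfolding e by (rule gaussP.product_integral_prod[OF I(1) h])
  also have "\<dots> = (\<Prod>i\<in>A. (\<integral>x. f x \<partial>gauss1))"
    unfolding hi using I by (simp add: prod.inter_restrict[symmetric] Int_absorb1)
  finally show "(\<integral>g. (\<Prod>i\<in>A. f (g i)) \<partial>gaussPi I) = (\<integral>x. f x \<partial>gauss1) ^ card A" by simp
qed

text \<open>The row is a product of k independent factors, so the value is exp (- sigma k) (1 - 2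
  sigma)^(-k/2). For sigma >= 0 the bound ln (1 - x) >= - x - 2 x^2 at x = 2 sigma <= 1/2 gives the
  constant 4 and explains the restriction to 1/4; for negative sigma the quadratic bound for ln (1 +
  x) is even better.\<close>

lemma chi_mgf_bound:
  assumes k: "k < N" and \<sigma>: "\<bar>\<sigma>\<bar> \<le> 1 / 4"
  shows "integrable (disorder N) (\<lambda>J. exp (\<sigma> * (Yrow k J - real k)))"
    and "(\<integral>J. exp (\<sigma> * (Yrow k J - real k)) \<partial>disorder N) \<le> exp (4 * \<sigma>\<^sup>2 * real k)"
proof -
  let ?A = "{k} \<times> {..<k}"
  have A: "?A \<subseteq> {..<N} \<times> {..<N}" using k by auto
  have \<sigma>2: "\<sigma> < 1 / 2" using \<sigma> by auto
  have e: "exp (\<sigma> * (Yrow k J - real k)) = exp (- \<sigma> * real k) * (\<Prod>i\<in>?A. exp (\<sigma> * (J i)\<^sup>2))" for J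
  proof -
    have "(\<Prod>i\<in>?A. exp (\<sigma> * (J i)\<^sup>2)) = exp (\<Sum>i\<in>?A. \<sigma> * (J i)\<^sup>2)"
      by (rule exp_sum[symmetric]) simp
    also have "(\<Sum>i\<in>?A. \<sigma> * (J i)\<^sup>2) = \<sigma> * Yrow k J"
    proof -
      have "?A = Pair k ` {..<k}" by auto
      then show ?thesis by (simp add: Yrow_def sum.reindex inj_on_def sum_distrib_left)
    qed
    finally show ?thesis by (simp add: mult_exp_exp algebra_simps)
  qed
  note I = integral_gaussPi_prod_subset[OF _ A gauss1_exp_square(1)[OF \<sigma>2]]
  show "integrable (disorder N) (\<lambda>J. exp (\<sigma> * (Yrow k J - real k)))"
    unfolding e disorder_eq by (intro integrable_mult_right I) auto
  have "(\<integral>J. exp (\<sigma> * (Yrow k J - real k)) \<partial>disorder N) = exp (- \<sigma> * real k) * (1 / sqrt (1 - 2 * \<sigma>)) ^ k"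
    unfolding e disorder_eq using I(2) gauss1_exp_square(2)[OF \<sigma>2] by simp
  also have "\<dots> = exp (real k * (- \<sigma> - ln (1 - 2 * \<sigma>) / 2))"
  proof -
    have "1 / sqrt (1 - 2 * \<sigma>) = exp (- ln (1 - 2 * \<sigma>) / 2)"
      using \<sigma>2 by (simp add: exp_minus ln_sqrt[symmetric] inverse_eq_divide)
    then have "(1 / sqrt (1 - 2 * \<sigma>)) ^ k = exp (real k * (- ln (1 - 2 * \<sigma>) / 2))"
      by (simp only: exp_of_nat_mult)
    then show ?thesis by (simp add: mult_exp_exp algebra_simps)
  qed
  also have "\<dots> \<le> exp (real k * (4 * \<sigma>\<^sup>2))"
  proof -
    have "- \<sigma> - ln (1 - 2 * \<sigma>) / 2 \<le> 4 * \<sigma>\<^sup>2"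
    proof (cases "0 \<le> \<sigma>")
      case True
      then show ?thesis
        using ln_one_minus_pos_lower_bound[of "2 * \<sigma>"] \<sigma> by (simp add: power2_eq_square)
    next
      case False
      then have "- (2 * \<sigma>) - 4 * \<sigma>\<^sup>2 \<le> ln (1 - 2 * \<sigma>)"
        using ln_one_plus_pos_lower_bound[of "- (2 * \<sigma>)"] \<sigma> by (simp add: power_mult_distrib)
      moreover have "0 \<le> \<sigma>\<^sup>2" by simp
      ultimately show ?thesis by linarith
    qed
    then show ?thesis by (simp add: mult_left_mono)
  qed
  finally show "(\<integral>J. exp (\<sigma> * (Yrow k J - real k)) \<partial>disorder N) \<le> exp (4 * \<sigma>\<^sup>2 * real k)"
    by (simp add: mult_ac)
qed

lemma abs_sqrt_diff_le:
  assumes "0 \<le> a" "0 \<le> b"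
  shows "\<bar>sqrt a - sqrt b\<bar> \<le> sqrt \<bar>a - b\<bar>"
proof (rule real_le_rsqrt)
  have "\<bar>sqrt a - sqrt b\<bar>\<^sup>2 \<le> \<bar>sqrt a - sqrt b\<bar> * (sqrt a + sqrt b)"
    unfolding power2_eq_square using assms by (intro mult_left_mono) (auto simp: abs_le_iff)
  also have "\<dots> = \<bar>(sqrt a - sqrt b) * (sqrt a + sqrt b)\<bar>" using assms by (simp add: abs_mult)
  also have "(sqrt a - sqrt b) * (sqrt a + sqrt b) = a - b" using assms by (simp add: algebra_simps)
  finally show "\<bar>sqrt a - sqrt b\<bar>\<^sup>2 \<le> \<bar>a - b\<bar>" .
qed

text \<open>The maximum over \<open>k\<close> is replaced by a sum, through \<open>t \<le> \<eta> + t\<^sup>2 / \<eta>\<close> for the diagonal entries and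
  \<open>t \<le> \<eta> + exp (c * (t - \<eta>)) / c\<close> for the chi-square deviations.\<close>

lemma disorder_fluctuation:
  fixes \<beta> \<eta> :: real
  assumes \<beta>: "0 < \<beta>" and \<eta>: "0 < \<eta>" "\<eta> \<le> 1"
  obtains X :: "nat \<Rightarrow> (nat \<times> nat \<Rightarrow> real) \<Rightarrow> real" where
    "\<And>N J. 0 \<le> X N J"
    "\<And>N. X N \<in> borel_measurable (disorder N)"
    "\<And>N J k. k < N \<Longrightarrow> \<bar>\<beta> / sqrt (2 * real N) * J (k, k)\<bar> \<le> X N J"
    "\<And>N J k. k < N \<Longrightarrow> \<bar>\<beta> * sqrt (Yrow k J / real N) - \<beta> * sqrt (real k / real N)\<bar> \<le> X N J"
    "\<And>N. integrable (disorder N) (\<lambda>J. (X N J)\<^sup>2)"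
    "\<forall>\<^sub>F N in sequentially. (\<integral>J. (X N J)\<^sup>2 \<partial>disorder N) \<le> 2 * \<beta>\<^sup>2 * \<eta>"
proof -
  \<comment> \<open>With this choice 4 sigma^2 is half of sigma eta, so the growth exp (4 sigma^2 N)
    of the moment generating functions is beaten by exp (- sigma eta N).\<close>
  define \<sigma> where "\<sigma> = \<eta> / 8"
  have \<sigma>: "0 < \<sigma>" "\<bar>\<sigma>\<bar> \<le> 1 / 4" "\<bar>- \<sigma>\<bar> \<le> 1 / 4" using \<eta> by (auto simp: \<sigma>_def)
  \<comment> \<open>The first summand is t^2 / eta for t = J_kk^2 / (2 N), with expectation of order
    N^(-2); the second is a two-sided exponential bound for |Y_k - k| / N beyond eta, with
    exponentially small expectation. Both survive summation over k. Square roots are taken at the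
    end only, so the square of X is linear in these terms.\<close>
  define w where "w N k J = (J (k, k)) ^ 4 / (4 * (real N)\<^sup>2 * \<eta>)
     + exp (- (\<sigma> * \<eta> * real N)) / (\<sigma> * real N)
       * (exp (\<sigma> * (Yrow k J - real k)) + exp (- \<sigma> * (Yrow k J - real k)))"
    for N k and J :: "nat \<times> nat \<Rightarrow> real"
  define u where "u N J = \<eta> + (\<Sum>k<N. w N k J)" for N and J :: "nat \<times> nat \<Rightarrow> real"
  define X where "X N J = \<beta> * sqrt (u N J)" for N J
  have w0: "0 \<le> w N k J" for N k J
    using \<eta> \<sigma> by (auto simp: w_def intro!: add_nonneg_nonneg mult_nonneg_nonneg divide_nonneg_nonneg)
  have u0: "0 \<le> u N J" for N J using \<eta> w0 by (auto simp: u_def intro!: add_nonneg_nonneg sum_nonneg)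
  have wu: "\<eta> + w N k J \<le> u N J" if "k < N" for N k J
    unfolding u_def using that by (intro add_left_mono member_le_sum) (auto simp: w0)
  have X2: "(X N J)\<^sup>2 = \<beta>\<^sup>2 * u N J" for N J using u0 by (simp add: X_def power_mult_distrib)
  have dpoly: "polyint (disorder N) (\<lambda>J. J (k, k))" if "k < N" for N k
    unfolding disorder_eq using that by (intro polyint_gaussPi_coordinate) auto
  have fm: "finite_measure (disorder N)" for N
    unfolding disorder_eq using prob_space_gaussPi[of "{..<N} \<times> {..<N}"] by (simp add: prob_space_def)
  have i4: "integrable (disorder N) (\<lambda>J. (J (k, k)) ^ 4)" if "k < N" for N k
    by (intro polyint_integrable polyint_power fm dpoly that)
  have e4: "(\<integral>J. (J (k, k)) ^ 4 \<partial>disorder N) = 3" if "k < N" for N k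
    using integral_gaussPi_prod_subset(2)[of "{..<N} \<times> {..<N}" "{(k, k)}" "\<lambda>x. x ^ 4"] that
      integrable_gauss1_power gauss1_moments(4) by (simp add: disorder_eq)
  note ie = chi_mgf_bound(1)[OF _ \<sigma>(2)] chi_mgf_bound(1)[OF _ \<sigma>(3)]
  have iw: "integrable (disorder N) (w N k)" if "k < N" for N k
    unfolding w_def[abs_def] using i4[OF that] ie[OF that] by simp
  have iu: "integrable (disorder N) (u N)" for N
    unfolding u_def[abs_def] using iw finite_measure.integrable_const[OF fm]
    by (intro Bochner_Integration.integrable_add Bochner_Integration.integrable_sum) auto
  show ?thesis
  proof
    show "0 \<le> X N J" for N J using \<beta> u0 by (simp add: X_def)
    show "X N \<in> borel_measurable (disorder N)" for N
      unfolding X_def[abs_def] using borel_measurable_integrable[OF iu[of N]] by measurable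
    show "\<bar>\<beta> / sqrt (2 * real N) * J (k, k)\<bar> \<le> X N J" if k: "k < N" for N J k
    proof -
      define t where "t = (J (k, k))\<^sup>2 / (2 * real N)"
      have t0: "0 \<le> t" by (simp add: t_def)
      have "t \<le> \<eta> + t\<^sup>2 / \<eta>"
      proof (cases "t \<le> \<eta>")
        case False
        then have "t * \<eta> \<le> t * t" using t0 by (intro mult_left_mono) auto
        then have "t \<le> t\<^sup>2 / \<eta>" using \<eta> by (simp add: field_simps power2_eq_square)
        then show ?thesis using \<eta> by simp
      qed (use \<eta> in \<open>auto intro: order_trans\<close>)
      also have "t\<^sup>2 / \<eta> \<le> w N k J"
      proof -
        have "t\<^sup>2 / \<eta> = (J (k, k)) ^ 4 / (4 * (real N)\<^sup>2 * \<eta>)"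
          by (simp add: t_def power_divide power_mult_distrib power_mult[symmetric])
        then show ?thesis using \<sigma> by (auto simp: w_def intro!: mult_nonneg_nonneg divide_nonneg_nonneg)
      qed
      also have "\<eta> + w N k J \<le> u N J" by (rule wu[OF k])
      finally have "sqrt t \<le> sqrt (u N J)" by simp
      moreover have "\<bar>\<beta> / sqrt (2 * real N) * J (k, k)\<bar> = \<beta> * sqrt t"
        using \<beta> by (simp add: t_def real_sqrt_divide abs_mult)
      ultimately show ?thesis using \<beta> by (simp add: X_def)
    qed
    show "\<bar>\<beta> * sqrt (Yrow k J / real N) - \<beta> * sqrt (real k / real N)\<bar> \<le> X N J" if k: "k < N" for N J k
    proof -
      have N: "0 < real N" using k by simp
      define t where "t = \<bar>Yrow k J - real k\<bar> / real N"
      have "1 + \<sigma> * real N * (t - \<eta>) \<le> exp (\<sigma> * real N * (t - \<eta>))" by (rule exp_ge_add_one_self)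
      then have "\<sigma> * real N * (t - \<eta>) \<le> exp (\<sigma> * real N * (t - \<eta>))" by linarith
      then have "t \<le> \<eta> + exp (\<sigma> * real N * (t - \<eta>)) / (\<sigma> * real N)"
        using \<sigma> N by (simp add: field_simps)
      also have "exp (\<sigma> * real N * (t - \<eta>)) = exp (- (\<sigma> * \<eta> * real N)) * exp (\<sigma> * \<bar>Yrow k J - real k\<bar>)"
        using N by (simp add: mult_exp_exp t_def field_simps)
      also have "exp (\<sigma> * \<bar>Yrow k J - real k\<bar>) \<le> exp (\<sigma> * (Yrow k J - real k)) + exp (- \<sigma> * (Yrow k J - real k))"
        by (cases "0 \<le> Yrow k J - real k") (auto simp: abs_if algebra_simps)
      finally have "t \<le> \<eta> + exp (- (\<sigma> * \<eta> * real N)) * (exp (\<sigma> * (Yrow k J - real k)) + exp (- \<sigma> * (Yrow k J - real k))) / (\<sigma> * real N)"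
        using \<sigma> N by (simp add: divide_right_mono mult_left_mono)
      also have "exp (- (\<sigma> * \<eta> * real N)) * (exp (\<sigma> * (Yrow k J - real k)) + exp (- \<sigma> * (Yrow k J - real k))) / (\<sigma> * real N) \<le> w N k J"
        using \<eta> by (simp add: w_def)
      also have "\<eta> + w N k J \<le> u N J" by (rule wu[OF k])
      finally have tu: "t \<le> u N J" by simp
      have "\<bar>sqrt (Yrow k J / real N) - sqrt (real k / real N)\<bar> \<le> sqrt \<bar>Yrow k J / real N - real k / real N\<bar>"
        by (rule abs_sqrt_diff_le) (auto simp: Yrow_def sum_nonneg)
      also have "\<bar>Yrow k J / real N - real k / real N\<bar> = t"
        by (simp add: t_def diff_divide_distrib[symmetric] abs_div)
      also have "sqrt t \<le> sqrt (u N J)" using tu by simp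
      finally have "\<beta> * \<bar>sqrt (Yrow k J / real N) - sqrt (real k / real N)\<bar> \<le> X N J"
        using \<beta> by (simp add: X_def)
      moreover have "\<bar>\<beta> * sqrt (Yrow k J / real N) - \<beta> * sqrt (real k / real N)\<bar>
        = \<beta> * \<bar>sqrt (Yrow k J / real N) - sqrt (real k / real N)\<bar>"
        using \<beta> by (simp add: right_diff_distrib[symmetric] abs_mult)
      ultimately show ?thesis by simp
    qed
    show "integrable (disorder N) (\<lambda>J. (X N J)\<^sup>2)" for N
      unfolding X2 using iu by simp
    have Ew: "(\<integral>J. w N k J \<partial>disorder N) \<le> 3 / (4 * (real N)\<^sup>2 * \<eta>)
      + 2 * exp (- (4 * \<sigma>\<^sup>2 * real N)) / (\<sigma> * real N)" if k: "k < N" for N k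
    proof -
      have "(\<integral>J. w N k J \<partial>disorder N) = 3 / (4 * (real N)\<^sup>2 * \<eta>) + exp (- (\<sigma> * \<eta> * real N)) / (\<sigma> * real N)
        * ((\<integral>J. exp (\<sigma> * (Yrow k J - real k)) \<partial>disorder N) + (\<integral>J. exp (- \<sigma> * (Yrow k J - real k)) \<partial>disorder N))"
        unfolding w_def using i4[OF k] ie[OF k] e4[OF k] by simp
      also have "\<dots> \<le> 3 / (4 * (real N)\<^sup>2 * \<eta>) + exp (- (\<sigma> * \<eta> * real N)) / (\<sigma> * real N)
        * (exp (4 * \<sigma>\<^sup>2 * real N) + exp (4 * \<sigma>\<^sup>2 * real N))"
      proof (intro add_left_mono mult_left_mono add_mono)
        have kk: "exp (4 * \<sigma>\<^sup>2 * real k) \<le> exp (4 * \<sigma>\<^sup>2 * real N)" using k by (simp add: mult_left_mono)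
        show "(\<integral>J. exp (\<sigma> * (Yrow k J - real k)) \<partial>disorder N) \<le> exp (4 * \<sigma>\<^sup>2 * real N)"
          using chi_mgf_bound(2)[OF k \<sigma>(2)] kk unfolding power2_minus by (rule order_trans)
        show "(\<integral>J. exp (- \<sigma> * (Yrow k J - real k)) \<partial>disorder N) \<le> exp (4 * \<sigma>\<^sup>2 * real N)"
          using chi_mgf_bound(2)[OF k \<sigma>(3)] kk unfolding power2_minus by (rule order_trans)
      qed (use \<sigma> in auto)
      also have "exp (- (\<sigma> * \<eta> * real N)) / (\<sigma> * real N) * (exp (4 * \<sigma>\<^sup>2 * real N) + exp (4 * \<sigma>\<^sup>2 * real N))
        = 2 * exp (- (4 * \<sigma>\<^sup>2 * real N)) / (\<sigma> * real N)"
      proof -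
        have "- (\<sigma> * \<eta> * real N) + 4 * \<sigma>\<^sup>2 * real N = - (4 * \<sigma>\<^sup>2 * real N)"
          by (simp add: \<sigma>_def power2_eq_square)
        then have "exp (- (\<sigma> * \<eta> * real N)) * exp (4 * \<sigma>\<^sup>2 * real N) = exp (- (4 * \<sigma>\<^sup>2 * real N))"
          by (simp only: mult_exp_exp)
        then show ?thesis by (simp add: mult_ac)
      qed
      finally show ?thesis .
    qed
    have Eu: "(\<integral>J. u N J \<partial>disorder N) \<le> \<eta> + 3 / (4 * \<eta>) / real N + 2 / \<sigma> * exp (- (4 * \<sigma>\<^sup>2) * real N)"
      if N: "0 < N" for N
    proof -
      interpret prob_space "disorder N" unfolding disorder_eq by (rule prob_space_gaussPi)
      have "(\<integral>J. u N J \<partial>disorder N) = \<eta> + (\<Sum>k<N. (\<integral>J. w N k J \<partial>disorder N))"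
      proof -
        have i: "integrable (disorder N) (\<lambda>J. \<Sum>k<N. w N k J)"
          using iw by (intro Bochner_Integration.integrable_sum) auto
        have "(\<integral>J. (\<Sum>k<N. w N k J) \<partial>disorder N) = (\<Sum>k<N. (\<integral>J. w N k J \<partial>disorder N))"
          using iw by (intro Bochner_Integration.integral_sum) auto
        then show ?thesis unfolding u_def using i by (simp add: prob_space)
      qed
      also have "\<dots> \<le> \<eta> + (\<Sum>k<N. 3 / (4 * (real N)\<^sup>2 * \<eta>) + 2 * exp (- (4 * \<sigma>\<^sup>2 * real N)) / (\<sigma> * real N))"
        by (intro add_left_mono sum_mono Ew) auto
      also have "\<dots> = \<eta> + 3 / (4 * \<eta>) / real N + 2 / \<sigma> * exp (- (4 * \<sigma>\<^sup>2) * real N)"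
        using N by (simp add: field_simps power2_eq_square)
      finally show ?thesis .
    qed
    have lim: "(\<lambda>N. \<eta> + 3 / (4 * \<eta>) / real N + 2 / \<sigma> * exp (- (4 * \<sigma>\<^sup>2) * real N)) \<longlonglongrightarrow> \<eta> + 0 + 2 / \<sigma> * 0"
    proof (intro tendsto_add tendsto_const tendsto_mult)
      show "(\<lambda>N. 3 / (4 * \<eta>) / real N) \<longlonglongrightarrow> 0"
        by (rule tendsto_divide_0[OF tendsto_const filterlim_at_top_imp_at_infinity[OF filterlim_real_sequentially]])
      show "(\<lambda>N. exp (- (4 * \<sigma>\<^sup>2) * real N)) \<longlonglongrightarrow> 0"
        using \<sigma>(1) by (intro filterlim_compose[OF exp_at_bot]
            filterlim_tendsto_neg_mult_at_bot[OF tendsto_const _ filterlim_real_sequentially]) auto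
    qed
    have "\<forall>\<^sub>F N in sequentially. \<eta> + 3 / (4 * \<eta>) / real N + 2 / \<sigma> * exp (- (4 * \<sigma>\<^sup>2) * real N) < 2 * \<eta>"
      by (rule order_tendstoD(2)[OF lim]) (use \<eta> in simp)
    then show "\<forall>\<^sub>F N in sequentially. (\<integral>J. (X N J)\<^sup>2 \<partial>disorder N) \<le> 2 * \<beta>\<^sup>2 * \<eta>"
      using eventually_gt_at_top[of 0]
    proof eventually_elim
      case (elim N)
      have "(\<integral>J. (X N J)\<^sup>2 \<partial>disorder N) = \<beta>\<^sup>2 * (\<integral>J. u N J \<partial>disorder N)"
        unfolding X2 by simp
      also have "\<dots> \<le> \<beta>\<^sup>2 * (2 * \<eta>)" using Eu[of N] elim by (intro mult_left_mono) auto
      finally show ?case by simp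
    qed
  qed
qed

section \<open>The variational formulas\<close>

lemma Atilde_eq:
  assumes "0 < 1 - lam + \<beta>\<^sup>2 * q"
  shows "Atilde \<beta> lam q = - ln (1 - lam + \<beta>\<^sup>2 * q) / 2 + \<beta>\<^sup>2 * q / (2 * (1 - lam + \<beta>\<^sup>2 * q)) + \<beta>\<^sup>2 / 4 * q\<^sup>2"
proof -
  define D where "D = 1 - lam + \<beta>\<^sup>2 * q"
  have D: "0 < D" using assms by (simp add: D_def)
  have "(D powr (- 1 / 2))\<^sup>2 = D powr (- 1)"
    using D by (simp add: powr_power)
  also have "\<dots> = 1 / D" using D by (simp add: powr_minus_divide)
  finally have "(D powr (- 1 / 2))\<^sup>2 = 1 / D" .
  then show ?thesis
    using D by (simp add: Atilde_def Let_def D_def[symmetric] ln_powr)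
qed

text \<open>The derivative factorizes: for q > 0 its sign is that of D - beta, where D = 1 - lam +
  beta^2 q. So the minimum lies at D = beta if that is reached with q >= 0, and at q = 0
  otherwise.\<close>

lemma Atilde_deriv:
  assumes D: "0 < 1 - lam + \<beta>\<^sup>2 * q"
  shows "((\<lambda>q. - ln (1 - lam + \<beta>\<^sup>2 * q) / 2 + \<beta>\<^sup>2 * q / (2 * (1 - lam + \<beta>\<^sup>2 * q)) + \<beta>\<^sup>2 / 4 * q\<^sup>2)
     has_real_derivative \<beta>\<^sup>2 * q / 2 * (1 - \<beta>\<^sup>2 / (1 - lam + \<beta>\<^sup>2 * q)\<^sup>2)) (at q)"
proof -
  define E where "E = 1 - lam + \<beta>\<^sup>2 * q"
  have E: "0 < E" using D by (simp add: E_def)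
  have "((\<lambda>q. - ln (1 - lam + \<beta>\<^sup>2 * q) / 2 + \<beta>\<^sup>2 * q / (2 * (1 - lam + \<beta>\<^sup>2 * q)) + \<beta>\<^sup>2 / 4 * q\<^sup>2)
     has_real_derivative - (\<beta>\<^sup>2 / E) / 2 + (\<beta>\<^sup>2 * (2 * E) - \<beta>\<^sup>2 * q * (2 * \<beta>\<^sup>2)) / (2 * E)\<^sup>2 + \<beta>\<^sup>2 / 4 * (2 * q)) (at q)"
  proof -
    have dE: "((\<lambda>q. 1 - lam + \<beta>\<^sup>2 * q) has_real_derivative \<beta>\<^sup>2) (at q)"
      by (auto intro!: derivative_eq_intros)
    have dl: "((\<lambda>q. ln (1 - lam + \<beta>\<^sup>2 * q)) has_real_derivative \<beta>\<^sup>2 / E) (at q)"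
      by (rule DERIV_cong[OF DERIV_chain2[OF DERIV_ln dE]]) (use D in \<open>auto simp: E_def divide_inverse\<close>)
    have dq: "((\<lambda>q. \<beta>\<^sup>2 * q) has_real_derivative \<beta>\<^sup>2) (at q)"
      by (auto intro!: derivative_eq_intros)
    have dr: "((\<lambda>q. \<beta>\<^sup>2 * q / (2 * (1 - lam + \<beta>\<^sup>2 * q))) has_real_derivative
        (\<beta>\<^sup>2 * (2 * E) - \<beta>\<^sup>2 * q * (2 * \<beta>\<^sup>2)) / (2 * E)\<^sup>2) (at q)"
      by (rule DERIV_cong[OF DERIV_divide[OF dq DERIV_cmult[OF dE, of 2]]])
        (use D in \<open>auto simp: E_def power2_eq_square\<close>)
    have ds: "((\<lambda>q. \<beta>\<^sup>2 / 4 * q\<^sup>2) has_real_derivative \<beta>\<^sup>2 / 4 * (2 * q)) (at q)"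
      by (rule DERIV_cmult) (auto intro!: derivative_eq_intros)
    show ?thesis
      by (intro DERIV_add DERIV_cdivide DERIV_minus dl dr ds)
  qed
  also have "- (\<beta>\<^sup>2 / E) / 2 + (\<beta>\<^sup>2 * (2 * E) - \<beta>\<^sup>2 * q * (2 * \<beta>\<^sup>2)) / (2 * E)\<^sup>2 + \<beta>\<^sup>2 / 4 * (2 * q)
    = \<beta>\<^sup>2 * q / 2 * (1 - \<beta>\<^sup>2 / E\<^sup>2)"
    using E by (simp add: field_simps power2_eq_square)
  finally show ?thesis by (simp add: E_def)
qed

lemma Atilde_mono:
  assumes \<beta>: "0 < \<beta>" and q: "0 \<le> q" "q \<le> q'" and D: "\<beta> \<le> 1 - lam + \<beta>\<^sup>2 * q"
  shows "Atilde \<beta> lam q \<le> Atilde \<beta> lam q'"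
proof -
  let ?h = "\<lambda>q. - ln (1 - lam + \<beta>\<^sup>2 * q) / 2 + \<beta>\<^sup>2 * q / (2 * (1 - lam + \<beta>\<^sup>2 * q)) + \<beta>\<^sup>2 / 4 * q\<^sup>2"
  have Dx: "\<beta> \<le> 1 - lam + \<beta>\<^sup>2 * x" if "q \<le> x" for x
    using D mult_left_mono[OF that, of "\<beta>\<^sup>2"] by simp
  have "?h q \<le> ?h q'"
  proof (rule DERIV_nonneg_imp_nondecreasing[OF q(2)])
    fix x assume x: "q \<le> x" "x \<le> q'"
    note Dx = Dx[OF x(1)]
    have "\<beta>\<^sup>2 \<le> (1 - lam + \<beta>\<^sup>2 * x)\<^sup>2" using Dx \<beta> by (intro power_mono) auto
    then have "\<beta>\<^sup>2 / (1 - lam + \<beta>\<^sup>2 * x)\<^sup>2 \<le> 1" using Dx \<beta> by (simp add: divide_le_eq_1)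
    then have "0 \<le> \<beta>\<^sup>2 * x / 2 * (1 - \<beta>\<^sup>2 / (1 - lam + \<beta>\<^sup>2 * x)\<^sup>2)" using q x by simp
    then show "\<exists>y. DERIV ?h x :> y \<and> 0 \<le> y"
      using Atilde_deriv[of lam \<beta> x] Dx \<beta> by auto
  qed
  then show ?thesis using Dx[of q] Dx[of q'] q \<beta> by (simp add: Atilde_eq)
qed

lemma Atilde_antimono:
  assumes \<beta>: "0 < \<beta>" and q: "0 \<le> q" "q \<le> q'" and D: "0 < 1 - lam + \<beta>\<^sup>2 * q" "1 - lam + \<beta>\<^sup>2 * q' \<le> \<beta>"
  shows "Atilde \<beta> lam q' \<le> Atilde \<beta> lam q"
proof -
  let ?h = "\<lambda>q. - ln (1 - lam + \<beta>\<^sup>2 * q) / 2 + \<beta>\<^sup>2 * q / (2 * (1 - lam + \<beta>\<^sup>2 * q)) + \<beta>\<^sup>2 / 4 * q\<^sup>2"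
  have Dx: "0 < 1 - lam + \<beta>\<^sup>2 * x" if "q \<le> x" for x
    using D mult_left_mono[OF that, of "\<beta>\<^sup>2"] by simp
  have "?h q' \<le> ?h q"
  proof (rule DERIV_nonpos_imp_nonincreasing[OF q(2)])
    fix x assume x: "q \<le> x" "x \<le> q'"
    note Dx = Dx[OF x(1)]
    have Dy: "1 - lam + \<beta>\<^sup>2 * x \<le> \<beta>" using D mult_left_mono[OF x(2), of "\<beta>\<^sup>2"] by simp
    have "(1 - lam + \<beta>\<^sup>2 * x)\<^sup>2 \<le> \<beta>\<^sup>2" using Dx Dy by (intro power_mono) auto
    then have "1 \<le> \<beta>\<^sup>2 / (1 - lam + \<beta>\<^sup>2 * x)\<^sup>2" using Dx by (simp add: le_divide_eq_1)
    then have "\<beta>\<^sup>2 * x / 2 * (1 - \<beta>\<^sup>2 / (1 - lam + \<beta>\<^sup>2 * x)\<^sup>2) \<le> 0"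
      using q x by (intro mult_nonneg_nonpos) auto
    then show "\<exists>y. DERIV ?h x :> y \<and> y \<le> 0"
      using Atilde_deriv[OF Dx] by blast
  qed
  then show ?thesis using Dx[of q] Dx[of q'] q \<beta> by (simp add: Atilde_eq)
qed

section \<open>Closed forms of the infimum and of the supremum\<close>

lemma ARS_high:
  assumes \<beta>: "0 < \<beta>" and lam: "\<beta> \<le> 1 - lam"
  shows "ARS \<beta> lam = - 1/2 * ln (1 - lam)"
proof -
  have "ARS \<beta> lam = Atilde \<beta> lam 0"
    unfolding ARS_def
  proof (rule cInf_eq_minimum)
    show "Atilde \<beta> lam 0 \<in> Atilde \<beta> lam ` {q. 0 \<le> q \<and> 0 < 1 - lam + \<beta>\<^sup>2 * q}"
      using assms by auto
    show "Atilde \<beta> lam 0 \<le> x" if "x \<in> Atilde \<beta> lam ` {q. 0 \<le> q \<and> 0 < 1 - lam + \<beta>\<^sup>2 * q}" for x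
      using that assms by (auto intro!: Atilde_mono)
  qed
  then show ?thesis using assms by (simp add: Atilde_eq)
qed

text \<open>The q of the statement solves 1 - lam + beta^2 q = beta; \<open>Atilde\<close> decreases
  up to this point and increases after it.\<close>

lemma ARS_low:
  assumes \<beta>: "0 < \<beta>" and lam: "1 - lam \<le> \<beta>"
  defines "q \<equiv> (\<beta> - (1 - lam)) / \<beta>\<^sup>2"
  shows "ARS \<beta> lam = - 1/2 * ln \<beta> + \<beta> * q / 2 + \<beta>\<^sup>2 * q\<^sup>2 / 4"
proof -
  have q0: "0 \<le> q" using assms by simp
  have Dq: "1 - lam + \<beta>\<^sup>2 * q = \<beta>" using \<beta> by (simp add: q_def)
  have "ARS \<beta> lam = Atilde \<beta> lam q"
    unfolding ARS_def
  proof (rule cInf_eq_minimum)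
    show "Atilde \<beta> lam q \<in> Atilde \<beta> lam ` {q. 0 \<le> q \<and> 0 < 1 - lam + \<beta>\<^sup>2 * q}"
      using \<beta> q0 Dq by auto
    fix x assume "x \<in> Atilde \<beta> lam ` {q. 0 \<le> q \<and> 0 < 1 - lam + \<beta>\<^sup>2 * q}"
    then obtain y where y: "x = Atilde \<beta> lam y" "0 \<le> y" "0 < 1 - lam + \<beta>\<^sup>2 * y" by auto
    show "Atilde \<beta> lam q \<le> x"
    proof (cases "q \<le> y")
      case True
      then show ?thesis unfolding y using \<beta> q0 Dq by (intro Atilde_mono) auto
    next
      case False
      then show ?thesis unfolding y using \<beta> y Dq by (intro Atilde_antimono) auto
    qed
  qed
  also have "\<dots> = - 1/2 * ln \<beta> + \<beta> * q / 2 + \<beta>\<^sup>2 * q\<^sup>2 / 4"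
  proof -
    have "0 < 1 - lam + \<beta>\<^sup>2 * q" using Dq \<beta> by simp
    from Atilde_eq[OF this] show ?thesis
      unfolding Dq using \<beta> by (simp add: power2_eq_square)
  qed
  finally show ?thesis .
qed

text \<open>Written in u = R^2: on the first branch the quartic terms cancel, and on the second the
  logarithms of R do, which leaves a parabola in u.\<close>

lemma SupRHS_summand:
  assumes \<beta>: "0 < \<beta>" and R: "0 < R"
  shows "Asf \<beta> R - \<beta>\<^sup>2 * R ^ 4 / 4 + (lam - 1) * R\<^sup>2 / 2 + ln R + 1/2
    = (if \<beta> * R\<^sup>2 \<le> 1 then ((lam - 1) * R\<^sup>2 + ln (R\<^sup>2) + 1) / 2
       else \<beta> * R\<^sup>2 - ln \<beta> / 2 - 1 / 4 - \<beta>\<^sup>2 * (R\<^sup>2)\<^sup>2 / 4 + (lam - 1) * R\<^sup>2 / 2)"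
proof -
  have "ln (R\<^sup>2) = 2 * ln R" using R by (simp add: ln_realpow)
  moreover have "(R\<^sup>2)\<^sup>2 = R ^ 4" by simp
  ultimately show ?thesis by (simp add: Asf_def field_simps)
qed

text \<open>The tangent inequality ln y <= y - 1 at y = (1 - lam) u handles the first branch, with
  equality at u = 1 / (1 - lam), a point that satisfies beta u <= 1. The second branch stays below
  the value of the first at the transition u = 1 / beta.\<close>

lemma SupRHS_high:
  assumes \<beta>: "0 < \<beta>" and lam: "\<beta> \<le> 1 - lam"
  shows "SupRHS \<beta> lam = - 1/2 * ln (1 - lam)"
  unfolding SupRHS_def
proof (rule cSup_eq_maximum)
  let ?f = "\<lambda>R. Asf \<beta> R - \<beta>\<^sup>2 * R ^ 4 / 4 + (lam - 1) * R\<^sup>2 / 2 + ln R + 1/2"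
  have l: "0 < 1 - lam" using assms by simp
  show "- 1/2 * ln (1 - lam) \<in> ?f ` {0<..}"
  proof
    let ?R = "1 / sqrt (1 - lam)"
    have R2: "?R\<^sup>2 = 1 / (1 - lam)" using l by (simp add: power_divide)
    show "- 1/2 * ln (1 - lam) = ?f ?R"
      using l lam \<beta> by (subst SupRHS_summand) (auto simp: R2 ln_div divide_simps)
  qed (use l in auto)
  have first: "((lam - 1) * u + ln u + 1) / 2 \<le> - 1/2 * ln (1 - lam)" if "0 < u" for u
  proof -
    have "ln ((1 - lam) * u) \<le> (1 - lam) * u - 1" using l that by (intro ln_le_minus_one) auto
    moreover have "ln ((1 - lam) * u) = ln (1 - lam) + ln u" using l that by (intro ln_mult_pos) auto
    ultimately have "ln u \<le> (1 - lam) * u - 1 - ln (1 - lam)" by simp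
    then have "((lam - 1) * u + ln u + 1) / 2 \<le> ((lam - 1) * u + ((1 - lam) * u - 1 - ln (1 - lam)) + 1) / 2"
      by simp
    also have "\<dots> = - 1/2 * ln (1 - lam)" by (simp add: algebra_simps)
    finally show ?thesis .
  qed
  fix x assume "x \<in> ?f ` {0<..}"
  then obtain R where R: "0 < R" "x = ?f R" by auto
  define u where "u = R\<^sup>2"
  have u: "0 < u" using R by (simp add: u_def)
  have x: "x = (if \<beta> * u \<le> 1 then ((lam - 1) * u + ln u + 1) / 2
       else \<beta> * u - ln \<beta> / 2 - 1 / 4 - \<beta>\<^sup>2 * u\<^sup>2 / 4 + (lam - 1) * u / 2)"
    unfolding R(2) u_def by (rule SupRHS_summand[OF \<beta> R(1)])
  show "x \<le> - 1/2 * ln (1 - lam)"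
  proof (cases "\<beta> * u \<le> 1")
    case True
    then show ?thesis using first[OF u] by (simp add: x)
  next
    case False
    \<comment> \<open>Expansion around the transition point u = 1 / beta; beyond it both subtracted
      terms are nonnegative, the last one because beta <= 1 - lam.\<close>
    have "\<beta> * u - ln \<beta> / 2 - 1 / 4 - \<beta>\<^sup>2 * u\<^sup>2 / 4 + (lam - 1) * u / 2
      = ((lam - 1) * (1 / \<beta>) + ln (1 / \<beta>) + 1) / 2 - (\<beta> * u - 1)\<^sup>2 / 4 - (1 - lam - \<beta>) * (u - 1 / \<beta>) / 2"
      using \<beta> by (simp add: ln_div field_simps power2_eq_square)
    also have "\<dots> \<le> ((lam - 1) * (1 / \<beta>) + ln (1 / \<beta>) + 1) / 2"
    proof -
      have "0 \<le> (\<beta> * u - 1)\<^sup>2" by simp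
      moreover have "0 \<le> (1 - lam - \<beta>) * (u - 1 / \<beta>)" using lam False \<beta> by (intro mult_nonneg_nonneg) (auto simp: field_simps)
      have le: "a - b / 4 - c / 2 \<le> a" if "0 \<le> b" "0 \<le> c" for a b c :: real
        using that by simp
      show ?thesis by (rule le) fact+
    qed
    also have "\<dots> \<le> - 1/2 * ln (1 - lam)" using first[of "1 / \<beta>"] \<beta> by simp
    finally show ?thesis using False by (simp add: x)
  qed
qed

text \<open>The maximizer is R^2 = q + 1 / beta, the vertex of the parabola on the second branch; it
  is the level rho of the upper bound at d = beta.\<close>

lemma SupRHS_low:
  assumes \<beta>: "0 < \<beta>" and lam: "1 - lam \<le> \<beta>"
  defines "q \<equiv> (\<beta> - (1 - lam)) / \<beta>\<^sup>2"
  shows "SupRHS \<beta> lam = - 1/2 * ln \<beta> + \<beta> * q / 2 + \<beta>\<^sup>2 * q\<^sup>2 / 4"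
  unfolding SupRHS_def
proof (rule cSup_eq_maximum)
  let ?f = "\<lambda>R. Asf \<beta> R - \<beta>\<^sup>2 * R ^ 4 / 4 + (lam - 1) * R\<^sup>2 / 2 + ln R + 1/2"
  let ?A = "- 1/2 * ln \<beta> + \<beta> * q / 2 + \<beta>\<^sup>2 * q\<^sup>2 / 4"
  have q0: "0 \<le> q" using assms by simp
  have l: "lam - 1 = \<beta>\<^sup>2 * q - \<beta>" using \<beta> by (simp add: q_def)
  have second: "\<beta> * u - ln \<beta> / 2 - 1 / 4 - \<beta>\<^sup>2 * u\<^sup>2 / 4 + (lam - 1) * u / 2 = ?A - (\<beta> * u - (\<beta> * q + 1))\<^sup>2 / 4" for u
    unfolding l by (simp add: field_simps power2_eq_square)
  have first: "((lam - 1) * u + ln u + 1) / 2 \<le> ?A" if u: "0 < u" "\<beta> * u \<le> 1" for u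
  proof -
    have "ln (\<beta> * u) \<le> \<beta> * u - 1" using u \<beta> by (intro ln_le_minus_one) auto
    then have "ln u \<le> \<beta> * u - 1 - ln \<beta>" using u \<beta> by (simp add: ln_mult)
    then have "((lam - 1) * u + ln u + 1) / 2 \<le> ((lam - 1) * u + (\<beta> * u - 1 - ln \<beta>) + 1) / 2" by simp
    also have "\<dots> = \<beta> * q * (\<beta> * u) / 2 - ln \<beta> / 2" unfolding l by (simp add: field_simps power2_eq_square)
    also have "\<beta> * q * (\<beta> * u) \<le> \<beta> * q * 1" using u \<beta> q0 by (intro mult_left_mono) auto
    also have "\<beta> * q * 1 / 2 - ln \<beta> / 2 \<le> ?A" by simp
    finally show ?thesis by simp
  qed
  show "?A \<in> ?f ` {0<..}"
  proof
    let ?R = "sqrt (q + 1 / \<beta>)"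
    have p: "0 < q + 1 / \<beta>" using q0 \<beta> by (simp add: add_nonneg_pos)
    then have R2: "?R\<^sup>2 = q + 1 / \<beta>" by simp
    have bR: "\<beta> * (q + 1 / \<beta>) = \<beta> * q + 1" using \<beta> by (simp add: distrib_left)
    show "?A = ?f ?R"
    \<comment> \<open>For q = 0 the vertex is the transition point 1 / beta itself, which the
      definition of \<open>Asf\<close> assigns to the first branch.\<close>
    proof (cases "q = 0")
      case True
      then show ?thesis
        using p \<beta> l by (subst SupRHS_summand) (auto simp: R2 ln_div)
    next
      case False
      then have "0 < \<beta> * q" using q0 \<beta> by simp
      then have nle: "(\<beta> * (q + 1 / \<beta>) \<le> 1) = False" unfolding bR by simp
      have "?f ?R = ?A - (\<beta> * (q + 1 / \<beta>) - (\<beta> * q + 1))\<^sup>2 / 4"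
        by (subst SupRHS_summand[OF \<beta> real_sqrt_gt_zero[OF p]]) (simp only: R2 nle if_False second)
      then show ?thesis unfolding bR by simp
    qed
  qed (use q0 \<beta> in \<open>simp add: add_nonneg_pos\<close>)
  fix x assume "x \<in> ?f ` {0<..}"
  then obtain R where R: "0 < R" "x = ?f R" by auto
  then show "x \<le> ?A"
    unfolding R(2) SupRHS_summand[OF \<beta> R(1)] second using first[of "R\<^sup>2"] by auto
qed

section \<open>The limit\<close>

lemma AN_eq_logZ:
  "AN N \<beta> lam = (1 / real N)
    * (\<integral>J. logZ N (phi N \<beta> lam) (\<lambda>z. \<beta> / sqrt (2 * real N) * Qchi N J z) \<partial>disorder N)"
proof -
  have "Hamil N \<beta> lam J z = \<beta> / sqrt (2 * real N) * Qtri N N J z + phi N \<beta> lam (\<Sum>k<N. (z k)\<^sup>2)" for J z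
    by (simp add: Hamil_def Qtri_def phi_def)
  then have "ln (ZN N \<beta> lam J) = logZ N (phi N \<beta> lam) (\<lambda>z. \<beta> / sqrt (2 * real N) * Qtri N N J z)" for J
    by (simp add: ZN_def logZ_def)
  moreover have "phi N \<beta> lam \<in> borel_measurable borel"
    unfolding phi_def[abs_def] by measurable
  ultimately show ?thesis
    unfolding AN_def by (simp only: integral_logZ_chi)
qed

text \<open>A coupling error is at most x times (z_k^2 + z_(k-1)^2) / 2. Each square thus occurs
  once from the diagonal and at most twice with weight 1/2 from its neighbours, hence the factor
  2.\<close>

lemma Qchi_Hdet:
  assumes N: "0 < N" and x: "0 \<le> x"
    and diag: "\<And>k. k < N \<Longrightarrow> \<bar>\<beta> / sqrt (2 * real N) * J (k, k)\<bar> \<le> x"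
    and off: "\<And>k. k < N \<Longrightarrow> \<bar>\<beta> * sqrt (Yrow k J / real N) - \<beta> * sqrt (real k / real N)\<bar> \<le> x"
  shows "\<bar>\<beta> / sqrt (2 * real N) * Qchi N J z - Hdet N \<beta> z\<bar> \<le> 2 * x * (\<Sum>k<N. (z k)\<^sup>2)"
proof -
  define e where "e k = \<beta> / sqrt (2 * real N) * J (k, k) * (z k)\<^sup>2
    + (\<beta> * sqrt (Yrow k J / real N) - \<beta> * sqrt (real k / real N)) * (z k * z (k - 1))" for k
  have c: "\<beta> / sqrt (2 * real N) * (sqrt 2 * sqrt (Yrow k J)) = \<beta> * sqrt (Yrow k J / real N)" for k
    by (simp add: real_sqrt_mult real_sqrt_divide)
  have eq: "\<beta> / sqrt (2 * real N) * Qchi N J z - Hdet N \<beta> z = (\<Sum>k<N. e k)"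
    unfolding Qchi_def Hdet_def sum_distrib_left sum_subtractf[symmetric]
  proof (rule sum.cong[OF refl])
    fix k
    have "\<beta> / sqrt (2 * real N) * (J (k, k) * (z k)\<^sup>2 + sqrt 2 * sqrt (Yrow k J) * z k * z (k - 1))
      = \<beta> / sqrt (2 * real N) * J (k, k) * (z k)\<^sup>2
        + \<beta> / sqrt (2 * real N) * (sqrt 2 * sqrt (Yrow k J)) * (z k * z (k - 1))"
      by (simp only: distrib_left mult.assoc)
    then show "\<beta> / sqrt (2 * real N) * (J (k, k) * (z k)\<^sup>2 + sqrt 2 * sqrt (Yrow k J) * z k * z (k - 1))
      - \<beta> * sqrt (real k / real N) * z k * z (k - 1) = e k"
      unfolding c e_def by (simp only: left_diff_distrib mult.assoc add_diff_eq)
  qed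
  have "\<bar>\<Sum>k<N. e k\<bar> \<le> (\<Sum>k<N. \<bar>e k\<bar>)" by (rule sum_abs)
  also have "\<dots> \<le> (\<Sum>k<N. x * (z k)\<^sup>2 + x * (((z k)\<^sup>2 + (if k = 0 then 0 else (z (k - 1))\<^sup>2)) / 2))"
  proof (rule sum_mono)
    fix k assume "k \<in> {..<N}"
    then have k: "k < N" by simp
    have "\<bar>\<beta> / sqrt (2 * real N) * J (k, k) * (z k)\<^sup>2\<bar> \<le> x * (z k)\<^sup>2"
      unfolding abs_mult[of _ "(z k)\<^sup>2"] abs_power2 by (rule mult_right_mono[OF diag[OF k]]) simp
    moreover have "\<bar>(\<beta> * sqrt (Yrow k J / real N) - \<beta> * sqrt (real k / real N)) * (z k * z (k - 1))\<bar>
      \<le> x * (((z k)\<^sup>2 + (if k = 0 then 0 else (z (k - 1))\<^sup>2)) / 2)"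
    proof (cases "k = 0")
      case True
      then show ?thesis using x by (simp add: Yrow_def)
    next
      case False
      have "0 \<le> (\<bar>z k\<bar> - \<bar>z (k - 1)\<bar>)\<^sup>2" by simp
      then have "\<bar>z k * z (k - 1)\<bar> \<le> ((z k)\<^sup>2 + (z (k - 1))\<^sup>2) / 2"
        by (simp add: power2_diff abs_mult)
      then show ?thesis
        unfolding abs_mult[of _ "z k * z (k - 1)"] using False x
        by (intro mult_mono off[OF k]) auto
    qed
    ultimately show "\<bar>e k\<bar> \<le> x * (z k)\<^sup>2 + x * (((z k)\<^sup>2 + (if k = 0 then 0 else (z (k - 1))\<^sup>2)) / 2)"
      unfolding e_def by linarith
  qed
  also have "\<dots> = x * (\<Sum>k<N. (z k)\<^sup>2) + x * (((\<Sum>k<N. (z k)\<^sup>2) + (\<Sum>k<N. if k = 0 then 0 else (z (k - 1))\<^sup>2)) / 2)"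
    by (simp only: sum.distrib sum_distrib_left[symmetric] sum_divide_distrib[symmetric])
  also have "\<dots> \<le> x * (\<Sum>k<N. (z k)\<^sup>2) + x * (((\<Sum>k<N. (z k)\<^sup>2) + (\<Sum>k<N. (z k)\<^sup>2)) / 2)"
    using x unfolding sum_shift_pred[OF N, of "\<lambda>k. (z k)\<^sup>2"]
    by (intro add_left_mono mult_left_mono divide_right_mono) auto
  also have "\<dots> = 2 * x * (\<Sum>k<N. (z k)\<^sup>2)" by simp
  finally show ?thesis unfolding eq .
qed

lemma Qchi_measurable_pair:
  "(\<lambda>w. c * Qchi N (fst w) (snd w)) \<in> borel_measurable (disorder N \<Otimes>\<^sub>M gaussN N)"
proof -
  have J: "(\<lambda>w. fst w (k, l)) \<in> borel_measurable (disorder N \<Otimes>\<^sub>M gaussN N)" if "k < N" "l < N" for k l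
  proof (rule measurable_compose[OF measurable_fst])
    show "(\<lambda>J. J (k, l)) \<in> borel_measurable (disorder N)"
      using measurable_component_singleton[of "(k, l)" "{..<N} \<times> {..<N}" "\<lambda>_. lborel"] that
      by (simp add: measurable_cong_sets[OF sets_disorder refl])
  qed
  have z: "(\<lambda>w. snd w k) \<in> borel_measurable (disorder N \<Otimes>\<^sub>M gaussN N)" if "k < N" for k
    by (rule measurable_compose[OF measurable_snd gaussN_component_measurable[OF that]])
  show ?thesis
    unfolding Qchi_def Yrow_def
    by (intro borel_measurable_times borel_measurable_const borel_measurable_sum borel_measurable_add
        borel_measurable_power measurable_compose[OF _ borel_measurable_sqrt] J z) auto
qed

text \<open>The two bounds also make F integrable; in this way log Z is seen to be integrable over
  the disorder.\<close>

lemma integral_sandwich: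
  fixes F lo hi :: "'a \<Rightarrow> real"
  assumes F: "F \<in> borel_measurable M" and i: "integrable M lo" "integrable M hi"
    and b: "\<And>x. x \<in> space M \<Longrightarrow> lo x \<le> F x" "\<And>x. x \<in> space M \<Longrightarrow> F x \<le> hi x"
  shows "(\<integral>x. lo x \<partial>M) \<le> (\<integral>x. F x \<partial>M)" "(\<integral>x. F x \<partial>M) \<le> (\<integral>x. hi x \<partial>M)"
proof -
  have "integrable M F"
  proof (rule Bochner_Integration.integrable_bound[OF _ F])
    show "integrable M (\<lambda>x. \<bar>lo x\<bar> + \<bar>hi x\<bar>)" using i by simp
    show "AE x in M. norm (F x) \<le> norm (\<bar>lo x\<bar> + \<bar>hi x\<bar>)"
    proof (intro AE_I2)
      fix x assume "x \<in> space M"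
      then show "norm (F x) \<le> norm (\<bar>lo x\<bar> + \<bar>hi x\<bar>)" using b[of x] by auto
    qed
  qed
  then show "(\<integral>x. lo x \<partial>M) \<le> (\<integral>x. F x \<partial>M)" "(\<integral>x. F x \<partial>M) \<le> (\<integral>x. hi x \<partial>M)"
    using i b by (auto intro: integral_mono)
qed

text \<open>The limit per site of the bound in \<open>logZ_upper\<close> without disorder error, for
  last pivot d; the squared quotient is the level rho determined by d + beta^2 / d = 1 - lam +
  beta^2 rho.\<close>

definition Ubound :: "real \<Rightarrow> real \<Rightarrow> real \<Rightarrow> real" where
  "Ubound \<beta> lam d = \<beta>\<^sup>2 * ((d + \<beta>\<^sup>2 / d - (1 - lam)) / \<beta>\<^sup>2)\<^sup>2 / 4 - (ln d + \<beta>\<^sup>2 / (2 * d\<^sup>2)) / 2"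

definition Lbound :: "real \<Rightarrow> real \<Rightarrow> real \<Rightarrow> real \<Rightarrow> real \<Rightarrow> real" where
  "Lbound \<beta> lam d q t = Lval \<beta> lam (d + \<beta>\<^sup>2 / d) (ln d + \<beta>\<^sup>2 / (2 * d\<^sup>2)) (1 / d) q t"

text \<open>The pointwise bounds contain X linearly, but only the mean square of X is controlled.
  Young's inequality with weight epsilon trades the linear terms for X^2 / epsilon plus O(epsilon),
  and a mean square of order epsilon^2 then leaves O(epsilon) in total.\<close>

lemma AN_sandwich:
  fixes \<beta> lam d \<mu> \<epsilon> :: real and p :: nat
  assumes \<beta>: "0 < \<beta>" "\<beta> < d" and \<mu>: "0 \<le> \<mu>" and \<epsilon>: "0 < \<epsilon>" "\<epsilon> \<le> 1"
  defines "\<theta> \<equiv> d + \<beta>\<^sup>2 / d" and "\<rho> \<equiv> (d + \<beta>\<^sup>2 / d - (1 - lam)) / \<beta>\<^sup>2"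
  shows "\<exists>c0. \<forall>\<^sub>F N in sequentially.
      AN N \<beta> lam \<le> \<beta>\<^sup>2 * \<rho>\<^sup>2 / 4 - lnD_avg \<beta> \<theta> N / 2 + \<epsilon> * (\<beta>\<^sup>2 * \<rho>\<^sup>2 / 4 + 16)
    \<and> Lval \<beta> lam \<theta> (lnD_avg \<beta> \<theta> N) (var_avg \<beta> \<theta> N) (\<mu> * pow_avg p N) (\<mu> * pow_avg (Suc p) N)
        - \<epsilon> * ((2 * \<beta>\<^sup>2 + 1) * (var_avg \<beta> \<theta> N + \<mu> * pow_avg p N)) - c0 / real N \<le> AN N \<beta> lam"
    (is "\<exists>c0. eventually (?P c0) sequentially")
proof -
  have t2: "2 * \<beta> < \<theta>" unfolding \<theta>_def by (rule theta_gt[OF \<beta>])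
  have t\<rho>: "\<theta> = 1 - lam + \<beta>\<^sup>2 * \<rho>" using \<beta> by (simp add: \<theta>_def \<rho>_def)
  have \<epsilon>2: "0 < \<epsilon>\<^sup>2" "\<epsilon>\<^sup>2 \<le> 1" using \<epsilon> by (auto simp: power_le_one)
  \<comment> \<open>The fluctuation bound is taken at eta = epsilon^2 to survive the division by
    epsilon. It contributes 8 (epsilon^2 + epsilon) <= 16 epsilon to the upper bound.\<close>
  obtain X where X: "\<And>N J. 0 \<le> X N J" "\<And>N. X N \<in> borel_measurable (disorder N)"
    "\<And>N J k. k < N \<Longrightarrow> \<bar>\<beta> / sqrt (2 * real N) * J (k, k)\<bar> \<le> X N J"
    "\<And>N J k. k < N \<Longrightarrow> \<bar>\<beta> * sqrt (Yrow k J / real N) - \<beta> * sqrt (real k / real N)\<bar> \<le> X N J"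
    "\<And>N. integrable (disorder N) (\<lambda>J. (X N J)\<^sup>2)"
    "\<forall>\<^sub>F N in sequentially. (\<integral>J. (X N J)\<^sup>2 \<partial>disorder N) \<le> 2 * \<beta>\<^sup>2 * \<epsilon>\<^sup>2"
    by (rule disorder_fluctuation[OF \<beta>(1) \<epsilon>2]) (rule that)
  obtain c0 where c0: "\<forall>N>0. \<forall>x q. q \<in> borel_measurable (gaussN N)
    \<longrightarrow> integrable (gaussN N) (\<lambda>z. exp (q z + phi N \<beta> lam (\<Sum>k<N. (z k)\<^sup>2)))
    \<longrightarrow> (\<forall>z. Hdet N \<beta> z - 2 * x * (\<Sum>k<N. (z k)\<^sup>2) \<le> q z)
    \<longrightarrow> real N * (Lval \<beta> lam \<theta> (lnD_avg \<beta> \<theta> N) (var_avg \<beta> \<theta> N) (\<mu> * pow_avg p N) (\<mu> * pow_avg (Suc p) N)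
        - 2 * x * (var_avg \<beta> \<theta> N + \<mu> * pow_avg p N)) - c0 \<le> logZ N (phi N \<beta> lam) q"
    using logZ_lower_explicit[OF \<beta>(1) t2 \<mu>, of lam p] by blast
  have "eventually (?P c0) sequentially"
    using X(6) eventually_gt_at_top[of 0]
  proof eventually_elim
    case (elim N)
    have EX: "(\<integral>J. (X N J)\<^sup>2 \<partial>disorder N) \<le> 2 * \<beta>\<^sup>2 * \<epsilon>\<^sup>2" and N: "0 < N" using elim by auto
    interpret prob_space "disorder N" unfolding disorder_eq by (rule prob_space_gaussPi)
    define q where "q J z = \<beta> / sqrt (2 * real N) * Qchi N J z" for J z
    define F where "F J = logZ N (phi N \<beta> lam) (q J)" for J
    define s where "s = var_avg \<beta> \<theta> N + \<mu> * pow_avg p N"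
    define B where "B = Lval \<beta> lam \<theta> (lnD_avg \<beta> \<theta> N) (var_avg \<beta> \<theta> N) (\<mu> * pow_avg p N) (\<mu> * pow_avg (Suc p) N)"
    have s0: "0 \<le> s"
    proof -
      have "0 \<le> var_avg \<beta> \<theta> N" unfolding var_avg_def
      proof (intro divide_nonneg_nonneg sum_nonneg)
        fix k assume "k \<in> {..<N}"
        then show "0 \<le> sqrt (\<theta>\<^sup>2 - 4 * \<beta>\<^sup>2 * (real k / real N))"
          using Droot_deriv(2)[OF \<beta>(1) t2, of "real k / real N"] by simp
      qed auto
      moreover have "0 \<le> pow_avg p N" unfolding pow_avg_def by (intro divide_nonneg_nonneg sum_nonneg) auto
      ultimately show ?thesis using \<mu> by (simp add: s_def)
    qed
    have AN: "AN N \<beta> lam = (1 / real N) * (\<integral>J. F J \<partial>disorder N)"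
      unfolding AN_eq_logZ F_def q_def ..
    have qp: "(\<lambda>w. q (fst w) (snd w)) \<in> borel_measurable (disorder N \<Otimes>\<^sub>M gaussN N)"
      unfolding q_def by (rule Qchi_measurable_pair)
    have qm: "q J \<in> borel_measurable (gaussN N)" if "J \<in> space (disorder N)" for J
      using measurable_compose[OF measurable_Pair1'[OF that] qp] by simp
    have Fm: "F \<in> borel_measurable (disorder N)"
      unfolding F_def
      by (rule logZ_measurable[OF qp]) (unfold phi_def[abs_def], measurable)
    have qH: "\<bar>q J z - Hdet N \<beta> z\<bar> \<le> 2 * X N J * (\<Sum>k<N. (z k)\<^sup>2)" for J z
      unfolding q_def using X(1,3,4) N by (intro Qchi_Hdet) auto
    have q_le: "q J z \<le> Hdet N \<beta> z + 2 * X N J * (\<Sum>k<N. (z k)\<^sup>2)"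
      and q_ge: "Hdet N \<beta> z - 2 * X N J * (\<Sum>k<N. (z k)\<^sup>2) \<le> q J z" for J z
      using qH[of J z] by linarith+
    \<comment> \<open>Here 2 rho y <= epsilon rho^2 + y^2 / epsilon is applied with y = 4 X /
      beta^2, and in \<open>lo\<close> the bound 2 X <= X^2 / epsilon + epsilon.\<close>
    define hi where "hi J = real N * (\<beta>\<^sup>2 * ((1 + \<epsilon>) * \<rho>\<^sup>2 + (1 + 1 / \<epsilon>) * (16 / \<beta>^4 * (X N J)\<^sup>2)) / 4 - lnD_avg \<beta> \<theta> N / 2)" for J
    define lo where "lo J = real N * (B - 2 * (((X N J)\<^sup>2 / \<epsilon> + \<epsilon>) / 2) * s) - c0" for J
    have i: "integrable (disorder N) lo" "integrable (disorder N) hi"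
      unfolding lo_def[abs_def] hi_def[abs_def] using X(5)[of N] by auto
    have up: "F J \<le> hi J" if J: "J \<in> space (disorder N)" for J
    proof -
      have "F J \<le> real N * \<beta>\<^sup>2 * (\<rho> + 4 * X N J / \<beta>\<^sup>2)\<^sup>2 / 4 - (\<Sum>k<N. ln (Droot \<beta> \<theta> (real k / real N))) / 2"
        unfolding F_def
        by (rule logZ_upper(2)[OF N \<beta>(1) t\<rho> less_imp_le[OF t2] qm[OF J] q_le])
      also have "\<dots> = real N * (\<beta>\<^sup>2 * (\<rho> + 4 * X N J / \<beta>\<^sup>2)\<^sup>2 / 4 - lnD_avg \<beta> \<theta> N / 2)"
        using N by (simp add: lnD_avg_def field_simps)
      also have "\<dots> \<le> hi J"
      proof -
        define y where "y = 4 * X N J / \<beta>\<^sup>2"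
        have y2: "y\<^sup>2 = 16 / \<beta> ^ 4 * (X N J)\<^sup>2" by (simp add: y_def power_divide power_mult_distrib power_mult[symmetric])
        have "0 \<le> (\<epsilon> * \<rho> - y)\<^sup>2 / \<epsilon>" using \<epsilon> by simp
        also have "\<dots> = \<epsilon> * \<rho>\<^sup>2 + y\<^sup>2 / \<epsilon> - 2 * \<rho> * y" using \<epsilon> by (simp add: power2_eq_square field_simps)
        finally have "(\<rho> + y)\<^sup>2 \<le> (1 + \<epsilon>) * \<rho>\<^sup>2 + (1 + 1 / \<epsilon>) * y\<^sup>2"
          by (simp add: power2_sum distrib_right)
        then have "\<beta>\<^sup>2 * (\<rho> + y)\<^sup>2 / 4 \<le> \<beta>\<^sup>2 * ((1 + \<epsilon>) * \<rho>\<^sup>2 + (1 + 1 / \<epsilon>) * y\<^sup>2) / 4"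
          by (intro divide_right_mono mult_left_mono) auto
        then show ?thesis unfolding hi_def y2[symmetric] y_def[symmetric]
          by (intro mult_left_mono diff_right_mono) auto
      qed
      finally show ?thesis .
    qed
    have low: "lo J \<le> F J" if J: "J \<in> space (disorder N)" for J
    proof -
      have int: "integrable (gaussN N) (\<lambda>z. exp (q J z + phi N \<beta> lam (\<Sum>k<N. (z k)\<^sup>2)))"
        by (rule logZ_upper(1)[OF N \<beta>(1) t\<rho> less_imp_le[OF t2] qm[OF J] q_le])
      have "real N * (B - 2 * X N J * s) - c0 \<le> F J"
        unfolding F_def B_def s_def using c0 N qm[OF J] int q_ge by blast
      moreover have "real N * (B - 2 * (((X N J)\<^sup>2 / \<epsilon> + \<epsilon>) / 2) * s) \<le> real N * (B - 2 * X N J * s)"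
      proof -
        have "0 \<le> (X N J - \<epsilon>)\<^sup>2 / \<epsilon>" using \<epsilon> by simp
        also have "\<dots> = (X N J)\<^sup>2 / \<epsilon> + \<epsilon> - 2 * X N J" using \<epsilon> by (simp add: power2_eq_square field_simps)
        finally have "2 * X N J * s \<le> 2 * (((X N J)\<^sup>2 / \<epsilon> + \<epsilon>) / 2) * s"
          using s0 by (intro mult_right_mono) auto
        then show ?thesis by (intro mult_left_mono) auto
      qed
      ultimately show ?thesis unfolding lo_def by linarith
    qed
    note sand = integral_sandwich[OF Fm i low up]
    have x2: "integrable (disorder N) (\<lambda>J. (X N J)\<^sup>2)" by (rule X(5))
    define E where "E = (\<integral>J. (X N J)\<^sup>2 \<partial>disorder N)"
    have Ehi: "(\<integral>J. hi J \<partial>disorder N) = real N * (\<beta>\<^sup>2 * ((1 + \<epsilon>) * \<rho>\<^sup>2 + (1 + 1 / \<epsilon>) * (16 / \<beta>^4 * E)) / 4 - lnD_avg \<beta> \<theta> N / 2)"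
      unfolding hi_def E_def using x2 by (simp add: prob_space)
    have Elo: "(\<integral>J. lo J \<partial>disorder N) = real N * (B - 2 * ((E / \<epsilon> + \<epsilon>) / 2) * s) - c0"
      unfolding lo_def E_def using x2 by (simp add: prob_space)
    have E: "0 \<le> E" "E \<le> 2 * \<beta>\<^sup>2 * \<epsilon>\<^sup>2" using EX by (auto simp: E_def)
    have "AN N \<beta> lam \<le> \<beta>\<^sup>2 * ((1 + \<epsilon>) * \<rho>\<^sup>2 + (1 + 1 / \<epsilon>) * (16 / \<beta>^4 * E)) / 4 - lnD_avg \<beta> \<theta> N / 2"
      using sand(2) N unfolding AN Ehi by (simp add: field_simps)
    also have "\<beta>\<^sup>2 * ((1 + \<epsilon>) * \<rho>\<^sup>2 + (1 + 1 / \<epsilon>) * (16 / \<beta>^4 * E)) / 4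
      \<le> \<beta>\<^sup>2 * ((1 + \<epsilon>) * \<rho>\<^sup>2 + (1 + 1 / \<epsilon>) * (16 / \<beta>^4 * (2 * \<beta>\<^sup>2 * \<epsilon>\<^sup>2))) / 4"
      using E \<epsilon> \<beta> by (intro divide_right_mono mult_left_mono add_left_mono) auto
    also have "\<dots> = \<beta>\<^sup>2 * \<rho>\<^sup>2 / 4 + \<epsilon> * (\<beta>\<^sup>2 * \<rho>\<^sup>2 / 4) + 8 * (\<epsilon> * \<epsilon> + \<epsilon>)"
      using \<epsilon> \<beta> by (simp add: field_simps power2_eq_square power4_eq_xxxx)
    also have "\<epsilon> * \<epsilon> + \<epsilon> \<le> 2 * \<epsilon>" using \<epsilon> by (simp add: mult_left_le)
    finally have 1: "AN N \<beta> lam \<le> \<beta>\<^sup>2 * \<rho>\<^sup>2 / 4 - lnD_avg \<beta> \<theta> N / 2 + \<epsilon> * (\<beta>\<^sup>2 * \<rho>\<^sup>2 / 4 + 16)"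
      by (simp add: algebra_simps)
    have "B - 2 * ((E / \<epsilon> + \<epsilon>) / 2) * s - c0 / real N \<le> AN N \<beta> lam"
    proof -
      have "y - c0 / real N \<le> 1 / real N * f" if "real N * y - c0 \<le> f" for y f
        using divide_right_mono[OF that, of "real N"] N by (simp add: diff_divide_distrib)
      then show ?thesis using sand(1) unfolding AN Elo .
    qed
    moreover have "2 * ((E / \<epsilon> + \<epsilon>) / 2) * s \<le> \<epsilon> * ((2 * \<beta>\<^sup>2 + 1) * s)"
    proof -
      have "E / \<epsilon> \<le> 2 * \<beta>\<^sup>2 * \<epsilon>\<^sup>2 / \<epsilon>" using E \<epsilon> by (intro divide_right_mono) auto
      then have "E / \<epsilon> + \<epsilon> \<le> 2 * \<beta>\<^sup>2 * \<epsilon> + \<epsilon>" using \<epsilon> by (simp add: power2_eq_square)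
      moreover have "2 * (y / 2) = y" for y :: real by simp
      note this[of "E / \<epsilon> + \<epsilon>"]
      moreover have "2 * \<beta>\<^sup>2 * \<epsilon> + \<epsilon> = \<epsilon> * (2 * \<beta>\<^sup>2 + 1)" by (simp add: algebra_simps)
      ultimately have "2 * ((E / \<epsilon> + \<epsilon>) / 2) \<le> \<epsilon> * (2 * \<beta>\<^sup>2 + 1)" by linarith
      then have "2 * ((E / \<epsilon> + \<epsilon>) / 2) * s \<le> \<epsilon> * (2 * \<beta>\<^sup>2 + 1) * s" using s0 by (rule mult_right_mono)
      then show ?thesis by (simp only: mult.assoc)
    qed
    ultimately have "B - \<epsilon> * ((2 * \<beta>\<^sup>2 + 1) * s) - c0 / real N \<le> AN N \<beta> lam" by linarith
    with 1 show ?case unfolding B_def s_def by simp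
  qed
  then show ?thesis by (rule exI[of _ c0])
qed


section \<open>Passage to the limit\<close>

lemma AN_eventually_less:
  assumes \<beta>: "0 < \<beta>" "\<beta> < d" and x: "Ubound \<beta> lam d < x"
  shows "\<forall>\<^sub>F N in sequentially. AN N \<beta> lam < x"
proof -
  define \<theta> \<rho> where "\<theta> = d + \<beta>\<^sup>2 / d" and "\<rho> = (d + \<beta>\<^sup>2 / d - (1 - lam)) / \<beta>\<^sup>2"
  define K where "K = \<beta>\<^sup>2 * \<rho>\<^sup>2 / 4 + 16"
  define \<epsilon> where "\<epsilon> = min 1 ((x - Ubound \<beta> lam d) / (2 * K))"
  have K: "0 < K" by (simp add: K_def add_nonneg_pos)
  have \<epsilon>: "0 < \<epsilon>" "\<epsilon> \<le> 1" using K x by (auto simp: \<epsilon>_def)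
  have "\<epsilon> * K \<le> (x - Ubound \<beta> lam d) / (2 * K) * K" using K by (intro mult_right_mono) (auto simp: \<epsilon>_def)
  then have \<epsilon>K: "\<epsilon> * K \<le> (x - Ubound \<beta> lam d) / 2" using K by simp
  have "(\<lambda>N. \<beta>\<^sup>2 * \<rho>\<^sup>2 / 4 - lnD_avg \<beta> \<theta> N / 2 + \<epsilon> * K)
    \<longlonglongrightarrow> \<beta>\<^sup>2 * \<rho>\<^sup>2 / 4 - (ln d + \<beta>\<^sup>2 / (2 * d\<^sup>2)) / 2 + \<epsilon> * K"
    by (intro tendsto_intros lnD_avg_tendsto[OF \<beta>]) (auto simp: \<theta>_def)
  then have lim: "(\<lambda>N. \<beta>\<^sup>2 * \<rho>\<^sup>2 / 4 - lnD_avg \<beta> \<theta> N / 2 + \<epsilon> * K) \<longlonglongrightarrow> Ubound \<beta> lam d + \<epsilon> * K"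
    unfolding Ubound_def \<rho>_def .
  have less: "Ubound \<beta> lam d + \<epsilon> * K < x" using \<epsilon>K x by simp
  have "\<forall>\<^sub>F N in sequentially. AN N \<beta> lam \<le> \<beta>\<^sup>2 * \<rho>\<^sup>2 / 4 - lnD_avg \<beta> \<theta> N / 2 + \<epsilon> * K"
    using AN_sandwich[OF \<beta> order_refl \<epsilon>, of lam 0]
    unfolding \<rho>_def \<theta>_def K_def eventually_conj_iff by blast
  from this order_tendstoD(2)[OF lim less] show ?thesis
    by eventually_elim linarith
qed

text \<open>Normalizing the power profile by mu = q (p + 1) gives the shift mass q in the limit; its
  coupling energy is then q (p + 1) / (p + 2), which falls short of q only because the profile is
  not yet concentrated at t = 1.\<close>

lemma AN_eventually_greater:
  fixes p :: nat
  assumes \<beta>: "0 < \<beta>" "\<beta> < d" and q: "0 \<le> q" and x: "x < Lbound \<beta> lam d q (q * (real p + 1) / (real p + 2))"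
  shows "\<forall>\<^sub>F N in sequentially. x < AN N \<beta> lam"
proof -
  define \<theta> where "\<theta> = d + \<beta>\<^sup>2 / d"
  define \<mu> where "\<mu> = q * (real p + 1)"
  define L where "L = Lbound \<beta> lam d q (q * (real p + 1) / (real p + 2))"
  define K where "K = (2 * \<beta>\<^sup>2 + 1) * (1 / d + q)"
  define \<epsilon> where "\<epsilon> = min 1 ((L - x) / (2 * K))"
  have d: "0 < d" using \<beta> by simp
  have K: "0 < K" unfolding K_def using d q by (intro mult_pos_pos add_nonneg_pos add_pos_nonneg) auto
  have \<mu>: "0 \<le> \<mu>" using q by (simp add: \<mu>_def)
  have xL: "x < L" using x by (simp add: L_def)
  have \<epsilon>: "0 < \<epsilon>" "\<epsilon> \<le> 1" using K xL by (auto simp: \<epsilon>_def)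
  have "\<epsilon> * K \<le> (L - x) / (2 * K) * K" using K by (intro mult_right_mono) (auto simp: \<epsilon>_def)
  then have \<epsilon>K: "\<epsilon> * K \<le> (L - x) / 2" using K by simp
  obtain c0 where c0: "\<forall>\<^sub>F N in sequentially.
      Lval \<beta> lam \<theta> (lnD_avg \<beta> \<theta> N) (var_avg \<beta> \<theta> N) (\<mu> * pow_avg p N) (\<mu> * pow_avg (Suc p) N)
        - \<epsilon> * ((2 * \<beta>\<^sup>2 + 1) * (var_avg \<beta> \<theta> N + \<mu> * pow_avg p N)) - c0 / real N \<le> AN N \<beta> lam"
    using AN_sandwich[OF \<beta> \<mu> \<epsilon>, of lam p] unfolding \<theta>_def eventually_conj_iff by blast
  have "(\<lambda>N. \<mu> * pow_avg p N) \<longlonglongrightarrow> \<mu> * (1 / (real p + 1))"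
    by (intro tendsto_mult tendsto_const pow_avg_tendsto)
  then have lP: "(\<lambda>N. \<mu> * pow_avg p N) \<longlonglongrightarrow> q" by (simp add: \<mu>_def)
  have "(\<lambda>N. \<mu> * pow_avg (Suc p) N) \<longlonglongrightarrow> \<mu> * (1 / (real (Suc p) + 1))"
    by (intro tendsto_mult tendsto_const pow_avg_tendsto)
  then have lP': "(\<lambda>N. \<mu> * pow_avg (Suc p) N) \<longlonglongrightarrow> q * (real p + 1) / (real p + 2)"
    by (simp add: \<mu>_def add_ac)
  have l0: "(\<lambda>N. c0 / real N) \<longlonglongrightarrow> 0"
    by (rule tendsto_divide_0[OF tendsto_const filterlim_at_top_imp_at_infinity[OF filterlim_real_sequentially]])
  have lim: "(\<lambda>N. Lval \<beta> lam \<theta> (lnD_avg \<beta> \<theta> N) (var_avg \<beta> \<theta> N) (\<mu> * pow_avg p N) (\<mu> * pow_avg (Suc p) N)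
        - \<epsilon> * ((2 * \<beta>\<^sup>2 + 1) * (var_avg \<beta> \<theta> N + \<mu> * pow_avg p N)) - c0 / real N) \<longlonglongrightarrow> L - \<epsilon> * K - 0"
    unfolding L_def K_def Lval_def Lbound_def \<theta>_def[symmetric]
    by (intro tendsto_diff tendsto_add tendsto_mult tendsto_divide tendsto_minus tendsto_const tendsto_power
        lnD_avg_tendsto[OF \<beta> \<theta>_def] var_avg_tendsto[OF \<beta> \<theta>_def] lP lP' l0) auto
  have "x < L - \<epsilon> * K - 0" using \<epsilon>K xL by simp
  from order_tendstoD(1)[OF lim this] c0 show ?thesis
    by eventually_elim linarith
qed

text \<open>The pivot d = 1 - lam is admissible as it stands, being larger than beta. It corresponds
  to q = 0, so no shift is used, and both bounds agree already at this fixed d.\<close>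

lemma AN_limit_high:
  assumes \<beta>: "0 < \<beta>" "\<beta> < 1 - lam"
  shows "(\<lambda>N. AN N \<beta> lam) \<longlonglongrightarrow> - 1/2 * ln (1 - lam)"
proof (rule order_tendstoI)
  have l: "0 < 1 - lam" using \<beta> by simp
  have "Ubound \<beta> lam (1 - lam) = - 1/2 * ln (1 - lam)"
  proof -
    define D where "D = 1 - lam"
    have D: "0 < D" using l by (simp add: D_def)
    have "(D + \<beta>\<^sup>2 / D - D) / \<beta>\<^sup>2 = 1 / D" using \<beta> by simp
    then show ?thesis
      unfolding Ubound_def D_def[symmetric] using D by (simp add: power_divide add_divide_distrib)
  qed
  then show "\<forall>\<^sub>F N in sequentially. AN N \<beta> lam < x" if "- 1/2 * ln (1 - lam) < x" for x
    using that by (intro AN_eventually_less[OF \<beta>]) simp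
  have "Lbound \<beta> lam (1 - lam) 0 0 = - 1/2 * ln (1 - lam)"
  proof -
    define D where "D = 1 - lam"
    have D: "0 < D" using l by (simp add: D_def)
    show ?thesis
      unfolding Lbound_def Lval_def D_def[symmetric] using D by (simp add: field_simps power2_eq_square)
  qed
  then show "\<forall>\<^sub>F N in sequentially. x < AN N \<beta> lam" if "x < - 1/2 * ln (1 - lam)" for x
    using that by (intro AN_eventually_greater[OF \<beta> order_refl, where p = 0]) simp
qed

text \<open>The optimal pivot d = beta is excluded, but both limiting bounds are continuous there
  and agree at d = beta with shift mass q and perfect concentration. For each x on either side of
  the limit a d slightly above beta suffices, together with a large p in the lower bound.\<close>

lemma AN_limit_low:
  assumes \<beta>: "0 < \<beta>" and lam: "1 - lam \<le> \<beta>"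
  defines "q \<equiv> (\<beta> - (1 - lam)) / \<beta>\<^sup>2"
  shows "(\<lambda>N. AN N \<beta> lam) \<longlonglongrightarrow> - 1/2 * ln \<beta> + \<beta> * q / 2 + \<beta>\<^sup>2 * q\<^sup>2 / 4"
proof (rule order_tendstoI)
  let ?A = "- 1/2 * ln \<beta> + \<beta> * q / 2 + \<beta>\<^sup>2 * q\<^sup>2 / 4"
  have q0: "0 \<le> q" using assms by simp
  have l: "1 - lam = \<beta> - \<beta>\<^sup>2 * q" using \<beta> by (simp add: q_def)
  have lU: "((\<lambda>d. Ubound \<beta> lam d) \<longlongrightarrow> Ubound \<beta> lam \<beta>) (at_right \<beta>)"
    unfolding Ubound_def using \<beta> by (intro tendsto_intros) auto
  have lL: "((\<lambda>d. Lbound \<beta> lam d q q) \<longlongrightarrow> Lbound \<beta> lam \<beta> q q) (at_right \<beta>)"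
    unfolding Lbound_def Lval_def using \<beta> by (intro tendsto_intros) auto
  have U: "Ubound \<beta> lam \<beta> = ?A"
    unfolding Ubound_def l using \<beta> by (simp add: field_simps power2_eq_square)
  have L: "Lbound \<beta> lam \<beta> q q = ?A"
    unfolding Lbound_def Lval_def l using \<beta> by (simp add: field_simps power2_eq_square)
  show "\<forall>\<^sub>F N in sequentially. AN N \<beta> lam < x" if "?A < x" for x
  proof -
    have "\<forall>\<^sub>F d in at_right \<beta>. Ubound \<beta> lam d < x"
      using order_tendstoD(2)[OF lU] that U by simp
    then have "\<forall>\<^sub>F d in at_right \<beta>. Ubound \<beta> lam d < x \<and> \<beta> < d"
      using eventually_at_right_less[of \<beta>] by (rule eventually_conj)
    then obtain d where "Ubound \<beta> lam d < x" "\<beta> < d"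
      using eventually_happens'[OF trivial_limit_at_right_real] by blast
    then show ?thesis by (intro AN_eventually_less[OF \<beta>])
  qed
  show "\<forall>\<^sub>F N in sequentially. x < AN N \<beta> lam" if "x < ?A" for x
  proof -
    have "\<forall>\<^sub>F d in at_right \<beta>. x < Lbound \<beta> lam d q q"
      using order_tendstoD(1)[OF lL] that L by simp
    then have "\<forall>\<^sub>F d in at_right \<beta>. x < Lbound \<beta> lam d q q \<and> \<beta> < d"
      using eventually_at_right_less[of \<beta>] by (rule eventually_conj)
    then obtain d where d: "x < Lbound \<beta> lam d q q" "\<beta> < d"
      using eventually_happens'[OF trivial_limit_at_right_real] by blast
    have "(\<lambda>p. q * (real p + 1) / (real p + 2)) \<longlonglongrightarrow> q"
      by real_asymp
    then have "(\<lambda>p. Lbound \<beta> lam d q (q * (real p + 1) / (real p + 2))) \<longlonglongrightarrow> Lbound \<beta> lam d q q"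
      unfolding Lbound_def Lval_def by (intro tendsto_intros)
    from order_tendstoD(1)[OF this d(1)] obtain p where "x < Lbound \<beta> lam d q (q * (real p + 1) / (real p + 2))"
      using eventually_happens'[OF sequentially_bot] by blast
    then show ?thesis by (intro AN_eventually_greater[OF \<beta> d(2) q0])
  qed
qed

theorem mainTheorem17:
  fixes \<beta> lam :: real
  assumes "\<beta> > 0"
  shows "convergent (\<lambda>N. AN N \<beta> lam)
    \<and> lim (\<lambda>N. AN N \<beta> lam) \<le> ARS \<beta> lam
    \<and> lim (\<lambda>N. AN N \<beta> lam) \<ge> SupRHS \<beta> lam
    \<and> SupRHS \<beta> lam = ARS \<beta> lam
    \<and> (\<lambda>N. AN N \<beta> lam) \<longlonglongrightarrow> ARS \<beta> lam
    \<and> (lam < 1 \<and> \<beta> < 1 - lam \<longrightarrow> ARS \<beta> lam = - 1/2 * ln (1 - lam))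
    \<and> (\<beta> > 1 - lam \<longrightarrow>
        (let q = (\<beta> - (1 - lam)) / \<beta>\<^sup>2 in
          ARS \<beta> lam = - 1/2 * ln \<beta> + \<beta> * q / 2 + \<beta>\<^sup>2 * q\<^sup>2 / 4))"
proof -
  \<comment> \<open>The boundary beta = 1 - lam is assigned to the low-temperature lemmas, all of
    which allow equality.\<close>
  have sup: "SupRHS \<beta> lam = ARS \<beta> lam" and lim: "(\<lambda>N. AN N \<beta> lam) \<longlonglongrightarrow> ARS \<beta> lam"
    using assms SupRHS_high[of \<beta> lam] SupRHS_low[of \<beta> lam] ARS_high[of \<beta> lam] ARS_low[of \<beta> lam]
      AN_limit_high[of \<beta> lam] AN_limit_low[of \<beta> lam]
    by (cases "\<beta> < 1 - lam"; simp)+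
  show ?thesis
    using sup lim limI[OF lim] assms ARS_high[of \<beta> lam] ARS_low[of \<beta> lam]
    by (auto simp: convergent_def Let_def)
qed

end
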